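(* Let $(H_\omega)_{\omega\in\Omega}$ be an ergodic family of Jacobi operators on $\ell^2(\mathbb{Z};\mathbb{C})$ generated by $(a,b,T)$ on $(\Omega,\mathcal F,\mathbb P)$ with $|\mathbb{E}_\omega\log|a||<\infty$, with Lyapunov exponent $L$. For $\omega\in\Omega$ let $$\mathfrak{S}_\omega:=\Big\{E\in\mathbb{R}:\limsup_{\epsilon\to0^+}\big\{\operatorname{Im}G_\omega(0,0;E+i\epsilon)+\operatorname{Im}G_\omega(1,1;E+i\epsilon)\big\}=\infty\Big\}.$$ Let $E\in\mathbb{R}$ be such that $L(E)>0$. Then $\mathbb{P}\{\omega: E\in\mathfrak{S}_\omega\}=0$.
   Context: Jacobi operators: given bounded sequences $(a_n)_{n\in\mathbb{Z}}$ in $\mathbb{C}$ with $|a_n|>0$ for all $n$, and $(b_n)_{n\in\mathbb{Z}}$ in $\mathbb{R}$, the Jacobi operator $H$ is the bounded self-adjoint operator on $\ell^2(\mathbb{Z};\mathbb{C})$ given by $(H\psi)_n=b_n\psi_n+a_n\psi_{n+1}+\overline{a_{n-1}}\psi_{n-1}$. Ergodic family of Jacobi operators: $(\Omega,\mathcal F,\mathbb P)$ is a probability space, $T:\Omega\to\Omega$ is an invertible measure-preserving ergodic map, and $a:\Omega\to\mathbb{C}$, $b:\Omega\to\mathbb{R}$ are random variables with $|\mathbb{E}_\omega\log|a||<\infty$, bounded so that the sequences below are bounded. Put $a_n(\omega)=a(T^n\omega)$, $b_n(\omega)=b(T^n\omega)$, and let $H_\omega$ be the operator above with these sequences. The assumptions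 imply that for $\mathbb P$-a.e. $\omega$ one has $a_n(\omega)\ne0$ for all $n$; only such $\omega$ are considered. Lyapunov exponent: for $z\in\mathbb{C}$ let $B_n(\omega,z)=\frac1{a_n(\omega)}\begin{pmatrix} z-b_n(\omega) & -\overline{a_{n-1}(\omega)}\\ a_n(\omega)&0\end{pmatrix}$ be the one-step transfer matrix of $H_\omega\psi=z\psi$, and $L(z)=\lim_{n\to\infty}\frac1n\mathbb{E}_\omega\log\|B_{n-1}(\omega,z)\cdots B_0(\omega,z)\|$. Green's function: $G_\omega(n,m;z)=\langle\delta_n,(H_\omega-z)^{-1}\delta_m\rangle$ for $z\in\mathbb{C}\setminus\mathbb{R}$, where $\{\delta_n\}_{n\in\mathbb{Z}}$ is the standard basis of $\ell^2(\mathbb{Z})$. *)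

theory Defs
  imports "HOL-Probability.Probability"
begin

section \<open>Jacobi operators on \<open>\<ell>\<^sup>2(\<int>)\<close> and their Green's functions\<close>

definition ell2 :: "(int \<Rightarrow> complex) set" where
  "ell2 = {\<psi>. (\<lambda>n. (cmod (\<psi> n))\<^sup>2) summable_on UNIV}"

definition ell2_inner :: "(int \<Rightarrow> complex) \<Rightarrow> (int \<Rightarrow> complex) \<Rightarrow> complex" where
  "ell2_inner \<phi> \<psi> = (\<Sum>\<^sub>\<infinity>n. cnj (\<phi> n) * \<psi> n)"

definition ell2_delta :: "int \<Rightarrow> int \<Rightarrow> complex" where
  "ell2_delta n = (\<lambda>k. if k = n then 1 else 0)"

definition jacobi_op ::
    "(int \<Rightarrow> complex) \<Rightarrow> (int \<Rightarrow> real) \<Rightarrow> (int \<Rightarrow> complex) \<Rightarrow> (int \<Rightarrow> complex)" where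
  "jacobi_op a b \<psi> =
     (\<lambda>n. of_real (b n) * \<psi> n + a n * \<psi> (n + 1) + cnj (a (n - 1)) * \<psi> (n - 1))"

text \<open>For bounded \<^term>\<open>a\<close>, \<^term>\<open>b\<close> the operator is bounded and self-adjoint on \<^const>\<open>ell2\<close>, so
  for \<^term>\<open>z \<notin> \<real>\<close> the map \<open>H - z\<close> is a bijection of \<^const>\<open>ell2\<close> and the following is
  its inverse; no meaning is attached to it for other \<^term>\<open>z\<close> or outside \<^const>\<open>ell2\<close>.\<close>

definition jacobi_resolvent ::
    "(int \<Rightarrow> complex) \<Rightarrow> (int \<Rightarrow> real) \<Rightarrow> complex \<Rightarrow> (int \<Rightarrow> complex) \<Rightarrow> (int \<Rightarrow> complex)" where
  "jacobi_resolvent a b z = the_inv_into ell2 (\<lambda>\<psi> n. jacobi_op a b \<psi> n - z * \<psi> n)"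

definition green ::
    "(int \<Rightarrow> complex) \<Rightarrow> (int \<Rightarrow> real) \<Rightarrow> int \<Rightarrow> int \<Rightarrow> complex \<Rightarrow> complex" where
  "green a b n m z = ell2_inner (ell2_delta n) (jacobi_resolvent a b z (ell2_delta m))"

definition singular_energies :: "(int \<Rightarrow> complex) \<Rightarrow> (int \<Rightarrow> real) \<Rightarrow> real set" where
  "singular_energies a b =
     {E. Limsup (at_right 0)
           (\<lambda>\<epsilon>. ereal (Im (green a b 0 0 (Complex E \<epsilon>)) + Im (green a b 1 1 (Complex E \<epsilon>)))) = \<infinity>}"


section \<open>Transfer matrices\<close>

text \<open>The factor \<open>mat (1 / a n)\<close> is the scalar \<open>1 / a n\<close> times the identity matrix.\<close>

definition transfer_step ::
    "(int \<Rightarrow> complex) \<Rightarrow> (int \<Rightarrow> real) \<Rightarrow> complex \<Rightarrow> int \<Rightarrow> complex^2^2" where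
  "transfer_step a b z n =
     mat (1 / a n) ** vector [vector [z - of_real (b n), - cnj (a (n - 1))],
                              vector [a n, 0]]"

primrec transfer_prod ::
    "(int \<Rightarrow> complex) \<Rightarrow> (int \<Rightarrow> real) \<Rightarrow> complex \<Rightarrow> nat \<Rightarrow> complex^2^2" where
  "transfer_prod a b z 0 = mat 1"
| "transfer_prod a b z (Suc n) = transfer_step a b z (int n) ** transfer_prod a b z n"


section \<open>Ergodic families\<close>

definition int_iter :: "'w measure \<Rightarrow> ('w \<Rightarrow> 'w) \<Rightarrow> int \<Rightarrow> 'w \<Rightarrow> 'w" where
  "int_iter M T n =
     (if n \<ge> 0 then T ^^ nat n else (the_inv_into (space M) T) ^^ nat (- n))"

definition orbit_seq :: "'w measure \<Rightarrow> ('w \<Rightarrow> 'w) \<Rightarrow> ('w \<Rightarrow> 'c) \<Rightarrow> 'w \<Rightarrow> int \<Rightarrow> 'c" where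
  "orbit_seq M T f \<omega> n = f (int_iter M T n \<omega>)"

locale invertible_ergodic = prob_space M for M :: "'w measure" +
  fixes T :: "'w \<Rightarrow> 'w"
  assumes bij: "bij_betw T (space M) (space M)"
    and measurable_T: "T \<in> measurable M M"
    and measurable_inv_T: "the_inv_into (space M) T \<in> measurable M M"
    and preserving: "distr M M T = M"
    and ergodic: "\<And>A. A \<in> events \<Longrightarrow> T -` A \<inter> space M = A \<Longrightarrow> prob A = 0 \<or> prob A = 1"

text \<open>The condition \<open>\<bar>\<E> log \<bar>a\<bar>\<bar> < \<infinity>\<close> refers to the logarithm with \<open>log 0 = -\<infinity>\<close>. Since the library
  has \<open>ln 0 = 0\<close>, it is split into \<open>a \<noteq> 0\<close> almost everywhere and integrability of \<open>ln \<bar>a\<bar>\<close>.\<close>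

locale ergodic_jacobi = invertible_ergodic M T for M :: "'w measure" and T +
  fixes a :: "'w \<Rightarrow> complex" and b :: "'w \<Rightarrow> real"
  assumes random_variable_a: "random_variable borel a"
    and random_variable_b: "random_variable borel b"
    and bounded_a: "bounded (a ` space M)"
    and bounded_b: "bounded (b ` space M)"
    and a_nonzero: "AE \<omega> in M. a \<omega> \<noteq> 0"
    and integrable_ln_a: "integrable M (\<lambda>\<omega>. ln (cmod (a \<omega>)))"

definition lyapunov_exponent ::
    "'w measure \<Rightarrow> ('w \<Rightarrow> 'w) \<Rightarrow> ('w \<Rightarrow> complex) \<Rightarrow> ('w \<Rightarrow> real) \<Rightarrow> complex \<Rightarrow> real" where
  "lyapunov_exponent M T a b z =
     lim (\<lambda>n. 1 / real n *
       (\<integral>\<omega>. ln (onorm ((*v) (transfer_prod (orbit_seq M T a \<omega>) (orbit_seq M T b \<omega>) z n))) \<partial>M))"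

end

theory Submission
  imports Defs
begin

text \<open>After replacing \<open>b\<close> by \<open>b - E\<close> one may assume \<open>E = 0\<close>. The subadditive ergodic theorem, applied to the
  transfer matrices of \<open>T\<close> and of its inverse, yields for almost every \<open>\<omega>\<close> nonzero solutions \<open>u\<^sup>+\<close>, \<open>u\<^sup>-\<close> of
  \<open>H u = 0\<close> that are square summable at \<open>+\<infinity>\<close> and at \<open>-\<infinity>\<close>. Truncating a solution shows that
  \<open>a\<^sub>-\<^sub>1 u\<^sub>0 \<delta>\<^sub>-\<^sub>1 - cnj a\<^sub>-\<^sub>1 u\<^sub>-\<^sub>1 \<delta>\<^sub>0\<close> lies in the range of \<open>H\<close>. If \<open>u\<^sup>+\<close> and \<open>u\<^sup>-\<close> are independent, all \<open>\<delta>\<^sub>n\<close>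
  therefore lie in the range, and \<open>\<delta>\<^sub>n = H x\<close> bounds \<open>\<bar>G(n,n;i\<epsilon>)\<bar>\<close> by \<open>2 \<parallel>x\<parallel>\<close> for all \<open>\<epsilon>\<close>. If they are
  dependent, \<open>0\<close> is an eigenvalue, so that \<open>\<epsilon> \<bar>G(n,n;i\<epsilon>)\<bar>\<close> stays away from \<open>0\<close> for some \<open>n\<close>. This has probability
  zero: modulo the range, \<open>\<delta>\<^sub>n\<close> is \<open>cnj u\<^sup>+\<^sub>n\<close> times a fixed vector, hence the stationary sequence
  \<open>inf \<epsilon> \<bar>G(n,n;i\<epsilon>)\<bar>\<close> tends to \<open>0\<close> as \<open>n \<rightarrow> \<infinity>\<close> and must vanish almost surely.\<close>

section \<open>The Hilbert space \<open>\<ell>\<^sup>2(\<int>)\<close>\<close>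

text \<open>The energy may lie in the spectrum, where \<open>H\<close> has no bounded inverse, and
  decaying solutions are known on half-lines only. The range of \<open>H\<close> links the two: (H -
  i\<epsilon>)^{-1} H = 1 + i\<epsilon> (H - i\<epsilon>)^{-1} has norm at most 2, so resolvents of
  vectors in the range stay bounded as \<epsilon> tends to 0, and membership in the range can be
  read off from half-line solutions. A bound on |G| bounds Im G and hence the limsup. The transfer
  matrices are first conjugated to matrices with determinant of modulus 1. Their logarithmic norms
  are then nonnegative, and a matrix and its inverse have equal norms, so that the forward and
  backward cocycles share one exponent. Eigenvalues are detected through \<epsilon>
  |G(n,n;i\<epsilon>)| and not through a choice of eigenvector, because this quantity is measurable
  in \<omega> and moves along the orbit. Measurability is a genuine part of the claim, since a null
  set must be an event: the resolvent is a limit of iterates polynomial in the coefficients and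
  their conjugates, and continuity in \<epsilon> reduces the limsup to rational \<epsilon>.\<close>

lemma norm_add_sq_le:
  fixes x y :: "'a::real_normed_vector"
  shows "(norm (x + y))\<^sup>2 \<le> 2 * (norm x)\<^sup>2 + 2 * (norm y)\<^sup>2"
proof -
  have "(norm (x + y))\<^sup>2 \<le> (norm x + norm y)\<^sup>2"
    by (intro power_mono norm_triangle_ineq) auto
  also have "\<dots> \<le> 2 * (norm x)\<^sup>2 + 2 * (norm y)\<^sup>2"
    using sum_squares_bound[of "norm x" "norm y"] by (simp add: power2_sum)
  finally show ?thesis .
qed

lemma ell2_comparison:
  assumes "\<phi> \<in> ell2" "\<And>n. cmod (\<psi> n) \<le> c * cmod (\<phi> n)"
  shows "\<psi> \<in> ell2"
proof -
  have "(\<lambda>n. c\<^sup>2 * (cmod (\<phi> n))\<^sup>2) summable_on UNIV"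
    using assms(1) unfolding ell2_def by (intro summable_on_cmult_right) auto
  then show ?thesis unfolding ell2_def mem_Collect_eq
    by (rule summable_on_comparison_test)
      (use power_mono[OF assms(2) norm_ge_zero, of _ 2] in \<open>auto simp: power_mult_distrib\<close>)
qed

lemma ell2_add:
  assumes "\<phi> \<in> ell2" "\<psi> \<in> ell2"
  shows "(\<lambda>n. \<phi> n + \<psi> n) \<in> ell2"
proof -
  have "(\<lambda>n. 2 * (cmod (\<phi> n))\<^sup>2 + 2 * (cmod (\<psi> n))\<^sup>2) summable_on UNIV"
    using assms unfolding ell2_def by (intro summable_on_add summable_on_cmult_right) auto
  then show ?thesis unfolding ell2_def mem_Collect_eq
    by (rule summable_on_comparison_test) (auto intro: norm_add_sq_le)
qed

lemma ell2_scale: "\<phi> \<in> ell2 \<Longrightarrow> (\<lambda>n. c * \<phi> n) \<in> ell2"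
  by (erule ell2_comparison[where c = "cmod c"]) (simp add: norm_mult)

lemma ell2_shift:
  assumes "\<phi> \<in> ell2"
  shows "(\<lambda>n. \<phi> (n + k)) \<in> ell2"
proof -
  have "bij_betw (\<lambda>n::int. n + k) UNIV UNIV"
    by (rule bij_betwI[where g = "\<lambda>n. n - k"]) auto
  then show ?thesis
    using assms summable_on_reindex_bij_betw[of "\<lambda>n. n + k" UNIV UNIV "\<lambda>n. (cmod (\<phi> n))\<^sup>2"]
    by (simp add: ell2_def)
qed

lemma ell2_finite_support:
  assumes "finite {n. \<phi> n \<noteq> 0}"
  shows "\<phi> \<in> ell2"
  unfolding ell2_def mem_Collect_eq
  by (rule finite_nonzero_values_imp_summable_on) (use assms in auto)

lemma ell2_delta_in_ell2: "ell2_delta n \<in> ell2"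
  by (rule ell2_finite_support) (auto simp: ell2_delta_def)

lemma ell2_inner_summable:
  assumes "\<phi> \<in> ell2" "\<psi> \<in> ell2"
  shows "(\<lambda>n. \<phi> n \<bullet> \<psi> n) summable_on UNIV"
proof -
  have "(\<lambda>n. (cmod (\<phi> n))\<^sup>2 + (cmod (\<psi> n))\<^sup>2) summable_on UNIV"
    using assms unfolding ell2_def by (intro summable_on_add) auto
  then have "(\<lambda>n. norm ((cmod (\<phi> n))\<^sup>2 + (cmod (\<psi> n))\<^sup>2)) summable_on UNIV"
    by (rule summable_on_iff_abs_summable_on_real[THEN iffD1])
  then have "(\<lambda>n. norm (\<phi> n \<bullet> \<psi> n)) summable_on UNIV"
  proof (rule Infinite_Sum.abs_summable_on_comparison_test)
    fix n
    have "\<bar>\<phi> n \<bullet> \<psi> n\<bar> \<le> cmod (\<phi> n) * cmod (\<psi> n)"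
      by (rule Cauchy_Schwarz_ineq2)
    also have "\<dots> \<le> (cmod (\<phi> n))\<^sup>2 + (cmod (\<psi> n))\<^sup>2"
      using sum_squares_bound[of "cmod (\<phi> n)" "cmod (\<psi> n)"]
        mult_nonneg_nonneg[OF norm_ge_zero[of "\<phi> n"] norm_ge_zero[of "\<psi> n"]] by linarith
    finally show "norm (\<phi> n \<bullet> \<psi> n) \<le> norm ((cmod (\<phi> n))\<^sup>2 + (cmod (\<psi> n))\<^sup>2)" by simp
  qed
  then show ?thesis by (rule summable_on_iff_abs_summable_on_real[THEN iffD2])
qed

typedef l2 = ell2 morphisms coord Abs_l2
  using ell2_delta_in_ell2 by blast

setup_lifting type_definition_l2

lemma l2_eqI: "(\<And>n. coord x n = coord y n) \<Longrightarrow> x = y"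
  using coord_inject by blast

instantiation l2 :: real_vector
begin

lift_definition zero_l2 :: l2 is "\<lambda>_. 0" by (rule ell2_finite_support) simp
lift_definition plus_l2 :: "l2 \<Rightarrow> l2 \<Rightarrow> l2" is "\<lambda>x y n. x n + y n" by (rule ell2_add)
lift_definition uminus_l2 :: "l2 \<Rightarrow> l2" is "\<lambda>x n. - x n"
  by (erule ell2_comparison[where c = 1]) simp
lift_definition minus_l2 :: "l2 \<Rightarrow> l2 \<Rightarrow> l2" is "\<lambda>x y n. x n - y n"
  using ell2_add ell2_scale[where c = "- 1"] by fastforce
lift_definition scaleR_l2 :: "real \<Rightarrow> l2 \<Rightarrow> l2" is "\<lambda>r x n. r *\<^sub>R x n"
  using ell2_scale by (simp add: scaleR_conv_of_real)
instance
proof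
  fix x y z :: l2 and r s :: real
  show "x + y + z = x + (y + z)" "x + y = y + x" "0 + x = x" "- x + x = 0" "x - y = x + - y"
    by (transfer, simp add: algebra_simps fun_eq_iff)+
  show "r *\<^sub>R (x + y) = r *\<^sub>R x + r *\<^sub>R y" "(r + s) *\<^sub>R x = r *\<^sub>R x + s *\<^sub>R x"
    "r *\<^sub>R s *\<^sub>R x = (r * s) *\<^sub>R x" "1 *\<^sub>R x = x"
    by (transfer, simp add: algebra_simps fun_eq_iff)+
qed

end

instantiation l2 :: real_inner
begin

text \<open>Only the real part of the sesquilinear product is kept, the summand being Re (cnj x *
  y). The complex structure is carried by \<open>cscale\<close>, which crosses the product with a
  conjugate.\<close>

lift_definition inner_l2 :: "l2 \<Rightarrow> l2 \<Rightarrow> real" is "\<lambda>x y. \<Sum>\<^sub>\<infinity>n. x n \<bullet> y n" .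
definition norm_l2 :: "l2 \<Rightarrow> real" where "norm_l2 x = sqrt (x \<bullet> x)"
definition sgn_l2 :: "l2 \<Rightarrow> l2" where "sgn_l2 x = x /\<^sub>R norm x"
definition dist_l2 :: "l2 \<Rightarrow> l2 \<Rightarrow> real" where "dist_l2 x y = norm (x - y)"
definition uniformity_l2 :: "(l2 \<times> l2) filter" where
  "uniformity_l2 = (INF e\<in>{0<..}. principal {(x, y). dist x y < e})"
definition open_l2 :: "l2 set \<Rightarrow> bool" where
  "open_l2 U = (\<forall>x\<in>U. \<forall>\<^sub>F (x', y) in uniformity. x' = x \<longrightarrow> y \<in> U)"

instance
proof
  fix x y z :: l2 and r :: real
  show "sgn x = x /\<^sub>R norm x" "dist x y = norm (x - y)" "norm x = sqrt (x \<bullet> x)"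
    by (simp_all add: sgn_l2_def dist_l2_def norm_l2_def)
  show "uniformity = (INF e\<in>{0<..}. principal {(x, y :: l2). dist x y < e})"
    by (rule uniformity_l2_def)
  show "open U \<longleftrightarrow> (\<forall>x\<in>U. \<forall>\<^sub>F (x', y) in uniformity. x' = x \<longrightarrow> y \<in> U)" for U :: "l2 set"
    by (rule open_l2_def)
  show "x \<bullet> y = y \<bullet> x" by transfer (simp add: inner_commute)
  show "(x + y) \<bullet> z = x \<bullet> z + y \<bullet> z"
    by transfer (simp add: inner_add_left infsum_add ell2_inner_summable)
  show "r *\<^sub>R x \<bullet> y = r * (x \<bullet> y)"
    by transfer (simp add: infsum_cmult_right ell2_inner_summable)
  show "0 \<le> x \<bullet> x" by transfer (auto intro: infsum_nonneg)
  show "x \<bullet> x = 0 \<longleftrightarrow> x = 0"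
  proof (transfer, safe)
    fix x :: "int \<Rightarrow> complex"
    assume x: "x \<in> ell2" and 0: "(\<Sum>\<^sub>\<infinity>n. x n \<bullet> x n) = 0"
    show "x = (\<lambda>_. 0)"
    proof
      fix n
      have "x n \<bullet> x n = 0"
        by (rule nonneg_infsum_le_0D[where A = UNIV]) (use 0 ell2_inner_summable[OF x x] in auto)
      then show "x n = 0" by simp
    qed
  qed simp
qed

end

lemmas coord_simps [simp] = zero_l2.rep_eq plus_l2.rep_eq minus_l2.rep_eq uminus_l2.rep_eq scaleR_l2.rep_eq

lemma inner_l2_eq: "x \<bullet> y = (\<Sum>\<^sub>\<infinity>n. coord x n \<bullet> coord y n)"
  by transfer simp

lemma norm_l2_sq: "(norm x)\<^sup>2 = (\<Sum>\<^sub>\<infinity>n. (cmod (coord x n))\<^sup>2)"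
  by (simp add: power2_norm_eq_inner inner_l2_eq)

lemma coord_sq_summable: "(\<lambda>n. (cmod (coord x n))\<^sup>2) summable_on UNIV"
  using coord[of x] by (simp add: ell2_def)

lemma norm_coord_le: "cmod (coord x n) \<le> norm x"
proof -
  have "(\<Sum>\<^sub>\<infinity>k\<in>{n}. (cmod (coord x k))\<^sup>2) \<le> (\<Sum>\<^sub>\<infinity>k. (cmod (coord x k))\<^sup>2)"
    by (rule infsum_mono2) (use coord_sq_summable in auto)
  then have "(cmod (coord x n))\<^sup>2 \<le> (norm x)\<^sup>2" by (simp add: norm_l2_sq)
  then show ?thesis by (rule power2_le_imp_le) simp
qed

lift_definition cscale :: "complex \<Rightarrow> l2 \<Rightarrow> l2" is "\<lambda>c x n. c * x n" by (rule ell2_scale)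
lift_definition shift_l2 :: "int \<Rightarrow> l2 \<Rightarrow> l2" is "\<lambda>k x n. x (n + k)" by (rule ell2_shift)
lift_definition delta_l2 :: "int \<Rightarrow> l2" is ell2_delta by (rule ell2_delta_in_ell2)

lemmas [simp] = cscale.rep_eq shift_l2.rep_eq delta_l2.rep_eq

lemma infsum_int_shift: "(\<Sum>\<^sub>\<infinity>n. f (n + k :: int)) = (\<Sum>\<^sub>\<infinity>n. f n)"
  by (rule infsum_reindex_bij_betw, rule bij_betwI[where g = "\<lambda>n. n - k"]) auto

lemma norm_cscale: "norm (cscale c x) = cmod c * norm x"
proof -
  have "(norm (cscale c x))\<^sup>2 = (cmod c * norm x)\<^sup>2"
    by (simp add: norm_l2_sq norm_mult power_mult_distrib infsum_cmult_right coord_sq_summable)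
  then show ?thesis by (simp add: power2_eq_iff_nonneg)
qed

lemma norm_shift_l2 [simp]: "norm (shift_l2 k x) = norm x"
proof -
  have "(norm (shift_l2 k x))\<^sup>2 = (norm x)\<^sup>2"
    using infsum_int_shift[of "\<lambda>n. (cmod (coord x n))\<^sup>2"] by (simp add: norm_l2_sq)
  then show ?thesis by (simp add: power2_eq_iff_nonneg)
qed

lemma inner_shift_l2: "shift_l2 k x \<bullet> y = x \<bullet> shift_l2 (- k) y"
  using infsum_int_shift[of "\<lambda>n. coord x n \<bullet> coord y (n - k)" k] by (simp add: inner_l2_eq)

lemma inner_mult_left_complex: "(c * x) \<bullet> y = x \<bullet> (cnj c * y)" for c x y :: complex
  by (simp add: inner_complex_def algebra_simps)

lemma inner_cscale: "cscale c x \<bullet> y = x \<bullet> cscale (cnj c) y"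
  by (simp add: inner_l2_eq inner_mult_left_complex)

lemma cscale_diff_right: "cscale c (x - y) = cscale c x - cscale c y"
  and cscale_0_right: "cscale c 0 = 0"
  and cscale_0_left: "cscale 0 x = 0"
  and cscale_1: "cscale 1 x = x"
  and cscale_cscale: "cscale c (cscale d x) = cscale (c * d) x"
  by (auto intro!: l2_eqI simp: algebra_simps)

lemma norm_delta_l2: "norm (delta_l2 n) = 1"
proof -
  have "(norm (delta_l2 n))\<^sup>2 = (\<Sum>\<^sub>\<infinity>k\<in>{n}. 1)"
    unfolding norm_l2_sq by (rule infsum_cong_neutral) (auto simp: ell2_delta_def)
  then show ?thesis by (simp add: power2_eq_1_iff) (use norm_ge_zero[of "delta_l2 n"] in linarith)
qed

lemma inner_delta_l2: "cscale c x \<bullet> delta_l2 n = (c * coord x n) \<bullet> 1"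
proof -
  have "cscale c x \<bullet> delta_l2 n = (\<Sum>\<^sub>\<infinity>k\<in>{n}. (c * coord x k) \<bullet> 1)"
    unfolding inner_l2_eq by (rule infsum_cong_neutral) (auto simp: ell2_delta_def)
  then show ?thesis by simp
qed

text \<open>For bounded \<open>c\<close> this is the diagonal operator with entries
  \<open>c\<close>; for other \<open>c\<close> the value of \<open>Abs_l2\<close> is
  unspecified.\<close>

definition mult_l2 :: "(int \<Rightarrow> complex) \<Rightarrow> l2 \<Rightarrow> l2" where
  "mult_l2 c x = Abs_l2 (\<lambda>n. c n * coord x n)"

context
  fixes c :: "int \<Rightarrow> complex" and K :: real
  assumes c: "\<And>n. cmod (c n) \<le> K"
begin

lemma coord_mult_l2: "coord (mult_l2 c x) n = c n * coord x n"
proof -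
  have "(\<lambda>n. c n * coord x n) \<in> ell2"
    by (rule ell2_comparison[OF coord, where c = K])
      (auto simp: norm_mult intro: mult_right_mono c)
  then show ?thesis by (simp add: mult_l2_def Abs_l2_inverse)
qed

lemma norm_mult_l2: "norm (mult_l2 c x) \<le> K * norm x"
proof (rule power2_le_imp_le)
  have K: "0 \<le> K" using c[of 0] norm_ge_zero order_trans by blast
  have "(norm (mult_l2 c x))\<^sup>2 \<le> (\<Sum>\<^sub>\<infinity>n. K\<^sup>2 * (cmod (coord x n))\<^sup>2)"
    unfolding norm_l2_sq
    by (intro infsum_mono coord_sq_summable summable_on_cmult_right)
      (auto simp: coord_mult_l2 norm_mult power_mult_distrib intro!: mult_right_mono power_mono c)
  then show "(norm (mult_l2 c x))\<^sup>2 \<le> (K * norm x)\<^sup>2"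
    by (simp add: infsum_cmult_right coord_sq_summable norm_l2_sq power_mult_distrib)
  show "0 \<le> K * norm x" using K by simp
qed

end

lemma inner_mult_l2:
  assumes c: "\<And>n. cmod (c n) \<le> K"
  shows "mult_l2 c x \<bullet> y = x \<bullet> mult_l2 (\<lambda>n. cnj (c n)) y"
proof -
  have "\<And>n. cmod (cnj (c n)) \<le> K" using c by simp
  from coord_mult_l2[OF this] coord_mult_l2[OF c]
  show ?thesis by (simp add: inner_l2_eq inner_mult_left_complex)
qed

section \<open>Resolvent and Green's function of a bounded Jacobi operator\<close>

text \<open>The iteration x -> x - i t ((H - i\<epsilon>) x - \<delta>_m) started at 0. It is
  written on bare sequences so that each entry is visibly a polynomial in the coefficients and their
  conjugates, hence measurable in \<omega>.\<close>

primrec resolvent_iter ::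
    "(int \<Rightarrow> complex) \<Rightarrow> (int \<Rightarrow> real) \<Rightarrow> real \<Rightarrow> real \<Rightarrow> int \<Rightarrow> nat \<Rightarrow> int \<Rightarrow> complex" where
  "resolvent_iter a b \<epsilon> t m 0 = (\<lambda>n. 0)"
| "resolvent_iter a b \<epsilon> t m (Suc k) =
     (\<lambda>n. resolvent_iter a b \<epsilon> t m k n - \<i> * of_real t *
        (jacobi_op a b (resolvent_iter a b \<epsilon> t m k) n - \<i> * of_real \<epsilon> * resolvent_iter a b \<epsilon> t m k n
          - ell2_delta m n))"

text \<open>An elementary Fatou argument: finite partial sums pass to the limit and keep the bound
  \<open>C\<^sup>2\<close>.\<close>

lemma ell2_bounded_limit:
  assumes lim: "\<And>n. (\<lambda>k. coord (X k) n) \<longlonglongrightarrow> \<psi> n" and bd: "\<And>k. norm (X k) \<le> C"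
  shows "\<psi> \<in> ell2"
  unfolding ell2_def mem_Collect_eq
proof (rule nonneg_bdd_above_summable_on)
  have "(\<Sum>n\<in>F. (cmod (\<psi> n))\<^sup>2) \<le> C\<^sup>2" if "finite F" for F
  proof (rule LIMSEQ_le_const2)
    show "(\<lambda>k. \<Sum>n\<in>F. (cmod (coord (X k) n))\<^sup>2) \<longlonglongrightarrow> (\<Sum>n\<in>F. (cmod (\<psi> n))\<^sup>2)"
      by (intro tendsto_sum tendsto_power tendsto_norm lim)
    have "(\<Sum>n\<in>F. (cmod (coord (X k) n))\<^sup>2) \<le> C\<^sup>2" for k
    proof -
      have "(\<Sum>n\<in>F. (cmod (coord (X k) n))\<^sup>2) \<le> (\<Sum>\<^sub>\<infinity>n. (cmod (coord (X k) n))\<^sup>2)"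
        by (intro finite_sum_le_infsum coord_sq_summable that) auto
      also have "\<dots> = (norm (X k))\<^sup>2" by (simp add: norm_l2_sq)
      also have "\<dots> \<le> C\<^sup>2" by (intro power_mono bd) auto
      finally show ?thesis .
    qed
    then show "\<exists>N. \<forall>k\<ge>N. (\<Sum>n\<in>F. (cmod (coord (X k) n))\<^sup>2) \<le> C\<^sup>2" by blast
  qed
  then show "bdd_above (sum (\<lambda>n. (cmod (\<psi> n))\<^sup>2) ` {F. F \<subseteq> UNIV \<and> finite F})"
    by (auto intro!: bdd_aboveI)
qed auto

locale bounded_jacobi =
  fixes a :: "int \<Rightarrow> complex" and b :: "int \<Rightarrow> real" and K :: real
  assumes a_le: "\<And>n. cmod (a n) \<le> K" and b_le: "\<And>n. \<bar>b n\<bar> \<le> K"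
begin

text \<open>Written as one self-adjoint diagonal term plus two terms adjoint to each other, so that
  symmetry and the norm bound \<open>3 * K\<close> can be read off term by term.\<close>

definition H :: "l2 \<Rightarrow> l2" where
  "H x = mult_l2 (\<lambda>n. of_real (b n)) x + mult_l2 a (shift_l2 1 x)
     + shift_l2 (- 1) (mult_l2 (\<lambda>n. cnj (a n)) x)"

lemma coefficient_bounds:
  "cmod (complex_of_real (b n)) \<le> K" "cmod (a n) \<le> K" "cmod (cnj (a n)) \<le> K"
  using a_le b_le by auto

lemma coord_H: "coord (H x) n = jacobi_op a b (coord x) n"
  by (simp add: H_def coord_mult_l2[OF coefficient_bounds(1)] coord_mult_l2[OF coefficient_bounds(2)]
      coord_mult_l2[OF coefficient_bounds(3)] jacobi_op_def)

lemma H_add: "H (x + y) = H x + H y"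
  and H_diff: "H (x - y) = H x - H y"
  and H_cscale: "H (cscale c x) = cscale c (H x)"
  by (auto intro!: l2_eqI simp: coord_H jacobi_op_def algebra_simps)

lemma H_0 [simp]: "H 0 = 0"
  using H_diff[of 0 0] by simp

lemma H_symmetric: "H x \<bullet> y = x \<bullet> H y"
  using inner_mult_l2[of "\<lambda>n. of_real (b n)" K x y, OF coefficient_bounds(1)]
    inner_mult_l2[of a K "shift_l2 1 x" y, OF coefficient_bounds(2)]
    inner_mult_l2[of "\<lambda>n. cnj (a n)" K x "shift_l2 1 y", OF coefficient_bounds(3)]
    inner_shift_l2[of 1 x "mult_l2 (\<lambda>n. cnj (a n)) y"] inner_shift_l2[of "- 1" "mult_l2 (\<lambda>n. cnj (a n)) x" y]
  by (simp add: H_def inner_add_left inner_add_right)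

lemma norm_H_le: "norm (H x) \<le> 3 * K * norm x"
proof -
  have "norm (H x) \<le> norm (mult_l2 (\<lambda>n. of_real (b n)) x) + norm (mult_l2 a (shift_l2 1 x))
     + norm (shift_l2 (- 1) (mult_l2 (\<lambda>n. cnj (a n)) x))"
    unfolding H_def by (intro norm_triangle_le add_mono order_refl norm_triangle_ineq)
  also have "\<dots> \<le> K * norm x + K * norm (shift_l2 1 x) + K * norm x"
    unfolding norm_shift_l2[of "- 1"] by (intro add_mono norm_mult_l2 coefficient_bounds)
  finally show ?thesis by simp
qed

lemma inner_H_imaginary: "x \<bullet> cscale \<i> (H x) = 0"
proof -
  have "x \<bullet> cscale \<i> (H x) = H x \<bullet> cscale \<i> x"
    by (simp add: H_symmetric flip: H_cscale)
  also have "\<dots> = cscale (- \<i>) (H x) \<bullet> x" by (simp add: inner_cscale)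
  also have "cscale (- \<i>) (H x) = - cscale \<i> (H x)" by (auto intro!: l2_eqI)
  finally show ?thesis by (simp add: inner_commute)
qed

text \<open>Since the pairing of \<open>x\<close> with \<open>H x\<close> is real, \<open>x\<close>
  and i H x are orthogonal for the real inner product, and Pythagoras applies.\<close>

lemma norm_combination_sq:
  "(norm (r *\<^sub>R x + cscale (\<i> * of_real s) (H x)))\<^sup>2 = r\<^sup>2 * (norm x)\<^sup>2 + s\<^sup>2 * (norm (H x))\<^sup>2"
proof -
  have eq: "cscale (\<i> * of_real s) (H x) = s *\<^sub>R cscale \<i> (H x)"
    by (auto intro!: l2_eqI simp: scaleR_conv_of_real)
  have "norm (cscale \<i> (H x)) = norm (H x)" by (simp add: norm_cscale)
  then have "cscale \<i> (H x) \<bullet> cscale \<i> (H x) = H x \<bullet> H x" by (simp flip: power2_norm_eq_inner)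
  then show ?thesis
    unfolding eq power2_norm_eq_inner
    by (simp add: inner_add_left inner_add_right inner_H_imaginary inner_commute[of "cscale \<i> (H x)" x]
        power2_eq_square)
qed

section \<open>Solving (H - i\<epsilon>) x = f by a contraction\<close>

definition shifted_H :: "real \<Rightarrow> l2 \<Rightarrow> l2" where
  "shifted_H \<epsilon> x = H x - cscale (\<i> * of_real \<epsilon>) x"

lemma shifted_H_add: "shifted_H \<epsilon> (x + y) = shifted_H \<epsilon> x + shifted_H \<epsilon> y"
  and shifted_H_diff: "shifted_H \<epsilon> (x - y) = shifted_H \<epsilon> x - shifted_H \<epsilon> y"
  and shifted_H_cscale: "shifted_H \<epsilon> (cscale c x) = cscale c (shifted_H \<epsilon> x)"
  by (auto intro!: l2_eqI simp: shifted_H_def H_add H_diff H_cscale algebra_simps)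

lemma norm_shifted_H_sq: "(norm (shifted_H \<epsilon> x))\<^sup>2 = \<epsilon>\<^sup>2 * (norm x)\<^sup>2 + (norm (H x))\<^sup>2"
proof -
  have "cscale \<i> (shifted_H \<epsilon> x) = \<epsilon> *\<^sub>R x + cscale (\<i> * of_real 1) (H x)"
    by (auto intro!: l2_eqI simp: shifted_H_def scaleR_conv_of_real algebra_simps)
  then have "(norm (shifted_H \<epsilon> x))\<^sup>2 = (norm (\<epsilon> *\<^sub>R x + cscale (\<i> * of_real 1) (H x)))\<^sup>2"
    by (metis norm_cscale norm_ii mult_1)
  then show ?thesis unfolding norm_combination_sq by simp
qed

lemma norm_le_shifted_H:
  assumes "\<epsilon> > 0"
  shows "\<epsilon> * norm x \<le> norm (shifted_H \<epsilon> x)"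
  by (rule power2_le_imp_le) (auto simp: norm_shifted_H_sq power_mult_distrib)

lemma shifted_H_inject:
  assumes "\<epsilon> > 0" "shifted_H \<epsilon> x = shifted_H \<epsilon> y"
  shows "x = y"
  using norm_le_shifted_H[OF assms(1), of "x - y"] assms
  by (simp add: shifted_H_diff mult_le_0_iff)

definition resolvent_step :: "real \<Rightarrow> real \<Rightarrow> l2 \<Rightarrow> l2 \<Rightarrow> l2" where
  "resolvent_step \<epsilon> t f x = x - cscale (\<i> * of_real t) (shifted_H \<epsilon> x - f)"

text \<open>The minimiser in t of (1 - t \<epsilon>)^2 + 9 K^2 t^2, which bounds the squared
  Lipschitz constant of \<open>resolvent_step\<close>; here 3 K bounds the norm of \<open>H\<close>.
  The minimum is 1 - t \<epsilon>.\<close>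

definition step_size :: "real \<Rightarrow> real" where
  "step_size \<epsilon> = \<epsilon> / (\<epsilon>\<^sup>2 + 9 * K\<^sup>2)"

lemma resolvent_step_contraction:
  assumes "\<epsilon> > 0"
  defines "t \<equiv> step_size \<epsilon>"
  shows "norm (resolvent_step \<epsilon> t f x - resolvent_step \<epsilon> t f y) \<le> sqrt (1 - t * \<epsilon>) * norm (x - y)"
    and "0 < t" "0 < t * \<epsilon>" "t * \<epsilon> \<le> 1"
proof -
  have D: "0 < \<epsilon>\<^sup>2 + 9 * K\<^sup>2" using assms(1) by (simp add: add_pos_nonneg)
  show t: "0 < t" using assms D by (simp add: step_size_def)
  then show "0 < t * \<epsilon>" using assms by simp
  have tD: "t * (\<epsilon>\<^sup>2 + 9 * K\<^sup>2) = \<epsilon>" using D by (simp add: t_def step_size_def)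
  show te: "t * \<epsilon> \<le> 1" using D by (simp add: t_def step_size_def field_simps power2_eq_square)
  define d where "d = x - y"
  have "resolvent_step \<epsilon> t f x - resolvent_step \<epsilon> t f y
      = (1 - t * \<epsilon>) *\<^sub>R d + cscale (\<i> * of_real (- t)) (H d)"
    by (auto intro!: l2_eqI simp: d_def resolvent_step_def shifted_H_def H_diff scaleR_conv_of_real algebra_simps)
  then have "(norm (resolvent_step \<epsilon> t f x - resolvent_step \<epsilon> t f y))\<^sup>2
      = (1 - t * \<epsilon>)\<^sup>2 * (norm d)\<^sup>2 + t\<^sup>2 * (norm (H d))\<^sup>2"
    by (simp only: norm_combination_sq) simp
  also have "\<dots> \<le> (1 - t * \<epsilon>)\<^sup>2 * (norm d)\<^sup>2 + t\<^sup>2 * (3 * K * norm d)\<^sup>2"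
    by (intro add_left_mono mult_left_mono power_mono norm_H_le) auto
  also have "\<dots> = (1 - 2 * (t * \<epsilon>) + t * (t * (\<epsilon>\<^sup>2 + 9 * K\<^sup>2))) * (norm d)\<^sup>2"
    by (simp add: power2_eq_square algebra_simps)
  also have "\<dots> = (sqrt (1 - t * \<epsilon>) * norm d)\<^sup>2"
    unfolding tD using te by (simp add: power_mult_distrib)
  finally show "norm (resolvent_step \<epsilon> t f x - resolvent_step \<epsilon> t f y) \<le> sqrt (1 - t * \<epsilon>) * norm (x - y)"
    unfolding d_def by (rule power2_le_imp_le) (use te in simp)
qed

text \<open>Banach's fixed point iteration, summed coordinatewise and put back into the space by
  \<open>ell2_bounded_limit\<close>. The second clause keeps the iterates because they make the
  Green's function measurable in \<omega>.\<close>

lemma resolvent_limit: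
  assumes "\<epsilon> > 0"
  obtains x where "shifted_H \<epsilon> x = f"
    "\<And>n. (\<lambda>k. coord ((resolvent_step \<epsilon> (step_size \<epsilon>) f ^^ k) 0) n) \<longlonglongrightarrow> coord x n"
proof -
  define t where "t = step_size \<epsilon>"
  define q where "q = sqrt (1 - t * \<epsilon>)"
  define X where "X k = (resolvent_step \<epsilon> t f ^^ k) 0" for k
  note c = resolvent_step_contraction[OF assms(1), folded t_def]
  have q: "0 \<le> q" "q < 1" using c(2-4) by (auto simp: q_def)
  have X_Suc: "X (Suc k) = resolvent_step \<epsilon> t f (X k)" for k by (simp add: X_def)
  have X0: "X 0 = 0" by (simp add: X_def)
  have diff: "norm (X (Suc k) - X k) \<le> norm (X 1) * q ^ k" for k
  proof (induction k)
    case (Suc k)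
    have "norm (X (Suc (Suc k)) - X (Suc k)) \<le> q * norm (X (Suc k) - X k)"
    using c(1)[of f "X (Suc k)" "X k"] unfolding q_def X_Suc .
    also have "\<dots> \<le> q * (norm (X 1) * q ^ k)" using Suc q by (intro mult_left_mono) auto
    finally show ?case by (simp add: algebra_simps)
  qed (simp add: X0)
  have geo: "summable (\<lambda>k. norm (X 1) * q ^ k)"
    using q by (intro summable_mult summable_geometric) auto
  have "\<exists>l. (\<lambda>k. coord (X k) n) \<longlonglongrightarrow> l" for n
  proof -
    have "summable (\<lambda>k. coord (X (Suc k)) n - coord (X k) n)"
      by (rule summable_comparison_test'[OF geo, where N = 0])
        (metis diff norm_coord_le order_trans minus_l2.rep_eq)
    then have "convergent (\<lambda>k. \<Sum>j<k. coord (X (Suc j)) n - coord (X j) n)"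
      by (simp add: summable_iff_convergent)
    then show ?thesis
      using sum_lessThan_telescope[of "\<lambda>j. coord (X j) n"] by (simp add: X0 convergent_def)
  qed
  then obtain \<psi> where psi: "(\<lambda>k. coord (X k) n) \<longlonglongrightarrow> \<psi> n" for n by metis
  have "norm (X k) \<le> (\<Sum>k. norm (X 1) * q ^ k)" for k
  proof -
    have "X k = (\<Sum>j<k. X (Suc j) - X j)" by (simp add: sum_lessThan_telescope X0)
    then have "norm (X k) \<le> (\<Sum>j<k. norm (X (Suc j) - X j))" by (simp add: norm_sum)
    also have "\<dots> \<le> (\<Sum>j<k. norm (X 1) * q ^ j)" by (intro sum_mono diff)
    also have "\<dots> \<le> (\<Sum>k. norm (X 1) * q ^ k)" using q by (intro sum_le_suminf geo) auto
    finally show ?thesis .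
  qed
  then have mem: "\<psi> \<in> ell2" using ell2_bounded_limit[OF psi] by blast
  define x where "x = Abs_l2 \<psi>"
  have cx: "coord x = \<psi>" by (simp add: x_def mem Abs_l2_inverse)
  \<comment> \<open>An entry of \<open>H x\<close> involves three entries of \<open>x\<close> only,
    so coordinatewise convergence is enough to pass to the limit in the iteration.\<close>
  have "coord (shifted_H \<epsilon> x - f) n = 0" for n
  proof -
    have "(\<lambda>k. coord (X (Suc k)) n) \<longlonglongrightarrow> \<psi> n - \<i> * of_real t * coord (shifted_H \<epsilon> x - f) n"
      unfolding X_Suc resolvent_step_def shifted_H_def coord_simps cscale.rep_eq coord_H jacobi_op_def cx
      by (intro tendsto_intros psi)
    moreover have "(\<lambda>k. coord (X (Suc k)) n) \<longlonglongrightarrow> \<psi> n" using psi by (rule LIMSEQ_Suc)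
    ultimately have "\<psi> n - \<i> * of_real t * coord (shifted_H \<epsilon> x - f) n = \<psi> n" by (rule LIMSEQ_unique)
    then show ?thesis using c(2) by simp
  qed
  then have "shifted_H \<epsilon> x = f" by (intro l2_eqI) simp
  then show thesis using psi cx that by (auto simp: X_def t_def)
qed

definition resolvent :: "real \<Rightarrow> l2 \<Rightarrow> l2" where
  "resolvent \<epsilon> f = (THE x. shifted_H \<epsilon> x = f)"

lemma resolvent_eq: "\<epsilon> > 0 \<Longrightarrow> shifted_H \<epsilon> x = f \<Longrightarrow> resolvent \<epsilon> f = x"
  unfolding resolvent_def using shifted_H_inject by (intro the_equality) auto

lemma shifted_H_resolvent: "\<epsilon> > 0 \<Longrightarrow> shifted_H \<epsilon> (resolvent \<epsilon> f) = f"
  by (metis resolvent_limit resolvent_eq)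

lemma norm_resolvent_le: "\<epsilon> > 0 \<Longrightarrow> \<epsilon> * norm (resolvent \<epsilon> f) \<le> norm f"
  using norm_le_shifted_H[of \<epsilon> "resolvent \<epsilon> f"] by (simp add: shifted_H_resolvent)

lemma green_eq_resolvent:
  assumes "\<epsilon> > 0"
  shows "green a b n m (Complex 0 \<epsilon>) = coord (resolvent \<epsilon> (delta_l2 m)) n"
proof -
  define F where "F = (\<lambda>\<psi> n. jacobi_op a b \<psi> n - Complex 0 \<epsilon> * \<psi> n)"
  have F: "F (coord x) = coord (shifted_H \<epsilon> x)" for x
    by (auto simp: F_def shifted_H_def coord_H Complex_eq)
  have "inj_on F ell2"
  proof
    fix \<phi> \<psi> assume *: "\<phi> \<in> ell2" "\<psi> \<in> ell2" "F \<phi> = F \<psi>"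
    obtain x y where xy: "\<phi> = coord x" "\<psi> = coord y"
      using *(1,2) by (metis Abs_l2_inverse)
    have "shifted_H \<epsilon> x = shifted_H \<epsilon> y" using * F unfolding xy by (metis coord_inject)
    then show "\<phi> = \<psi>" using shifted_H_inject[OF assms] xy by blast
  qed
  then have "the_inv_into ell2 F (ell2_delta m) = coord (resolvent \<epsilon> (delta_l2 m))"
    by (rule the_inv_into_f_eq)
      (auto simp: F shifted_H_resolvent assms coord)
  then have "green a b n m (Complex 0 \<epsilon>) = (\<Sum>\<^sub>\<infinity>k. cnj (ell2_delta n k) * coord (resolvent \<epsilon> (delta_l2 m)) k)"
    unfolding green_def jacobi_resolvent_def ell2_inner_def F_def[symmetric] by simp
  also have "\<dots> = (\<Sum>\<^sub>\<infinity>k\<in>{n}. coord (resolvent \<epsilon> (delta_l2 m)) k)"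
    by (rule infsum_cong_neutral) (auto simp: ell2_delta_def)
  finally show ?thesis by simp
qed

lemma resolvent_iter_tendsto_green:
  assumes "\<epsilon> > 0"
  shows "(\<lambda>k. resolvent_iter a b \<epsilon> (step_size \<epsilon>) m k n) \<longlonglongrightarrow> green a b n m (Complex 0 \<epsilon>)"
proof -
  have it: "coord ((resolvent_step \<epsilon> t (delta_l2 m) ^^ k) 0) = resolvent_iter a b \<epsilon> t m k" for k t
    by (induction k) (auto simp: resolvent_step_def shifted_H_def coord_H)
  obtain x where x: "shifted_H \<epsilon> x = delta_l2 m"
    "\<And>n. (\<lambda>k. coord ((resolvent_step \<epsilon> (step_size \<epsilon>) (delta_l2 m) ^^ k) 0) n) \<longlonglongrightarrow> coord x n"
    using resolvent_limit[OF assms] by metis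
  then show ?thesis using resolvent_eq[OF assms x(1)] by (simp add: green_eq_resolvent assms it)
qed

section \<open>Bounds for the diagonal Green's function on the imaginary axis\<close>

lemma resolvent_add: "\<epsilon> > 0 \<Longrightarrow> resolvent \<epsilon> (f + g) = resolvent \<epsilon> f + resolvent \<epsilon> g"
  by (rule resolvent_eq) (auto simp: shifted_H_add shifted_H_resolvent)

text \<open>Because (H - i\<epsilon>)^{-1} H x = x + i\<epsilon> (H - i\<epsilon>)^{-1} x, and each
  of the two terms has norm at most \<open>norm x\<close>.\<close>

lemma resolvent_H:
  assumes "\<epsilon> > 0"
  shows "norm (resolvent \<epsilon> (H x)) \<le> 2 * norm x"
proof -
  have "resolvent \<epsilon> (H x) = x + cscale (\<i> * of_real \<epsilon>) (resolvent \<epsilon> x)"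
  proof (rule resolvent_eq[OF assms])
    show "shifted_H \<epsilon> (x + cscale (\<i> * of_real \<epsilon>) (resolvent \<epsilon> x)) = H x"
      by (simp add: shifted_H_add shifted_H_cscale shifted_H_resolvent assms) (simp add: shifted_H_def)
  qed
  then have "norm (resolvent \<epsilon> (H x)) \<le> norm x + \<epsilon> * norm (resolvent \<epsilon> x)"
    using norm_triangle_ineq assms by (metis norm_cscale norm_mult norm_ii mult_1 norm_of_real abs_of_pos)
  then show ?thesis using norm_resolvent_le[OF assms, of x] by linarith
qed

text \<open>The part of \<delta>_n in the range contributes a bounded amount to G, the remainder
  \<open>y\<close> at most \<open>norm y / \<epsilon>\<close>. With \<open>y = 0\<close> this bounds
  G itself; in general it bounds the limit of \<epsilon> |G| by \<open>norm y\<close>.\<close>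

lemma green_le:
  assumes "\<epsilon> > 0" "delta_l2 n = H x + y"
  shows "\<epsilon> * cmod (green a b n n (Complex 0 \<epsilon>)) \<le> 2 * \<epsilon> * norm x + norm y"
proof -
  have "cmod (green a b n n (Complex 0 \<epsilon>)) \<le> norm (resolvent \<epsilon> (H x) + resolvent \<epsilon> y)"
    using norm_coord_le[of "resolvent \<epsilon> (H x) + resolvent \<epsilon> y" n] assms
    by (simp add: green_eq_resolvent resolvent_add)
  also have "\<dots> \<le> 2 * norm x + norm (resolvent \<epsilon> y)"
    using resolvent_H[OF assms(1), of x] norm_triangle_ineq[of "resolvent \<epsilon> (H x)" "resolvent \<epsilon> y"] by linarith
  finally have "\<epsilon> * cmod (green a b n n (Complex 0 \<epsilon>)) \<le> \<epsilon> * (2 * norm x + norm (resolvent \<epsilon> y))"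
    using assms(1) by (intro mult_left_mono) auto
  then show ?thesis using norm_resolvent_le[OF assms(1), of y] by (simp add: algebra_simps)
qed

text \<open>Pairing \<open>(H - i\<epsilon>)x = \<delta>\<^sub>n\<close> with \<open>i x\<close> gives \<open>Im x\<^sub>n = \<epsilon> \<parallel>x\<parallel>\<^sup>2\<close>, while pairing it with \<open>\<psi>\<close> gives
  \<open>\<bar>\<psi>\<^sub>n\<bar> = \<epsilon> \<bar>\<langle>\<psi>, x\<rangle>\<bar>\<close>; for the latter \<open>\<psi>\<close> is rotated so that \<open>\<psi>\<^sub>n\<close> becomes real.\<close>

lemma green_ge_eigenvector:
  assumes "\<epsilon> > 0" "H \<psi> = 0"
  shows "(cmod (coord \<psi> n))\<^sup>2 \<le> (norm \<psi>)\<^sup>2 * (\<epsilon> * cmod (green a b n n (Complex 0 \<epsilon>)))"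
proof -
  define x where "x = resolvent \<epsilon> (delta_l2 n)"
  have x: "shifted_H \<epsilon> x = delta_l2 n" by (simp add: x_def shifted_H_resolvent assms)
  have "Im (coord x n) = cscale (- \<i>) x \<bullet> delta_l2 n"
    by (simp add: inner_delta_l2 inner_complex_def)
  also have "\<dots> = x \<bullet> cscale \<i> (shifted_H \<epsilon> x)" by (simp add: inner_cscale x)
  also have "cscale \<i> (shifted_H \<epsilon> x) = \<epsilon> *\<^sub>R x + cscale \<i> (H x)"
    by (auto intro!: l2_eqI simp: shifted_H_def scaleR_conv_of_real algebra_simps)
  also have "x \<bullet> \<dots> = \<epsilon> * (norm x)\<^sup>2"
    by (simp add: inner_add_right inner_H_imaginary power2_norm_eq_inner)
  finally have im: "\<epsilon> * (norm x)\<^sup>2 = Im (coord x n)" by simp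
  define c where "c = cnj (sgn (coord \<psi> n))"
  have cs: "c * coord \<psi> n = of_real (cmod (coord \<psi> n))"
  proof (cases "coord \<psi> n = 0")
    case False
    then show ?thesis
      using complex_norm_square[of "coord \<psi> n"] by (simp add: c_def sgn_eq power2_eq_square field_simps)
  qed simp
  have c1: "cmod c \<le> 1" by (simp add: c_def norm_sgn)
  have "cmod (coord \<psi> n) = cscale c \<psi> \<bullet> delta_l2 n"
    by (simp add: inner_delta_l2 cs inner_complex_def)
  also have "\<dots> = cscale c \<psi> \<bullet> H x - cscale c \<psi> \<bullet> cscale (\<i> * of_real \<epsilon>) x"
    by (simp add: inner_diff_right shifted_H_def flip: x)
  also have "cscale c \<psi> \<bullet> H x = 0"
    by (simp add: H_cscale assms cscale_0_right flip: H_symmetric)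
  finally have "cmod (coord \<psi> n) \<le> norm (cscale c \<psi>) * norm (cscale (\<i> * of_real \<epsilon>) x)"
    using Cauchy_Schwarz_ineq2[of "cscale c \<psi>" "cscale (\<i> * of_real \<epsilon>) x"] by linarith
  also have "\<dots> \<le> norm \<psi> * (\<epsilon> * norm x)"
    using c1 assms by (intro mult_mono) (auto simp: norm_cscale norm_mult mult_left_le_one_le)
  finally have "(cmod (coord \<psi> n))\<^sup>2 \<le> (norm \<psi> * (\<epsilon> * norm x))\<^sup>2" by (intro power_mono) auto
  also have "\<dots> = (norm \<psi>)\<^sup>2 * (\<epsilon> * (\<epsilon> * (norm x)\<^sup>2))" by (simp add: power2_eq_square)
  also have "\<dots> \<le> (norm \<psi>)\<^sup>2 * (\<epsilon> * cmod (coord x n))"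
    unfolding im using assms abs_Im_le_cmod[of "coord x n"] by (intro mult_left_mono) auto
  finally show ?thesis by (simp add: green_eq_resolvent assms x_def)
qed

text \<open>The resolvent identity: the difference of the two resolvent vectors is the resolvent at
  \<epsilon> applied to i(\<delta> - \<epsilon>) times the one at \<delta>.\<close>

lemma green_lipschitz:
  assumes "\<epsilon> > 0" "\<delta> > 0"
  shows "cmod (green a b n n (Complex 0 \<delta>) - green a b n n (Complex 0 \<epsilon>)) \<le> \<bar>\<delta> - \<epsilon>\<bar> / (\<epsilon> * \<delta>)"
proof -
  define x y where "x = resolvent \<epsilon> (delta_l2 n)" and "y = resolvent \<delta> (delta_l2 n)"
  have "shifted_H \<epsilon> (y - x) = shifted_H \<delta> y + cscale (\<i> * of_real (\<delta> - \<epsilon>)) y - shifted_H \<epsilon> x"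
    by (auto intro!: l2_eqI simp: shifted_H_def H_diff algebra_simps)
  then have "shifted_H \<epsilon> (y - x) = cscale (\<i> * of_real (\<delta> - \<epsilon>)) y"
    by (simp add: x_def y_def shifted_H_resolvent assms)
  then have "\<epsilon> * norm (y - x) \<le> \<bar>\<delta> - \<epsilon>\<bar> * norm y"
    using norm_le_shifted_H[OF assms(1), of "y - x"] by (simp add: norm_cscale norm_mult flip: of_real_diff)
  moreover have "\<delta> * norm y \<le> 1" using norm_resolvent_le[OF assms(2), of "delta_l2 n"] by (simp add: y_def norm_delta_l2)
  then have "\<bar>\<delta> - \<epsilon>\<bar> * norm y \<le> \<bar>\<delta> - \<epsilon>\<bar> * (1 / \<delta>)"
    using assms by (intro mult_left_mono) (auto simp: field_simps)
  ultimately have "\<epsilon> * norm (y - x) \<le> \<bar>\<delta> - \<epsilon>\<bar> * (1 / \<delta>)" by linarith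
  then have "norm (y - x) \<le> \<bar>\<delta> - \<epsilon>\<bar> / (\<epsilon> * \<delta>)"
    using assms by (simp add: field_simps)
  then show ?thesis
    using norm_coord_le[of "y - x" n] assms by (simp add: green_eq_resolvent x_def y_def)
qed

lemma green_continuous: "continuous_on {0<..} (\<lambda>\<epsilon>. green a b n n (Complex 0 \<epsilon>))"
proof (intro continuous_at_imp_continuous_on ballI)
  fix \<epsilon> :: real assume "\<epsilon> \<in> {0<..}"
  then have e: "\<epsilon> > 0" by simp
  have "(\<lambda>\<delta>. \<bar>\<delta> - \<epsilon>\<bar> / (\<epsilon> * \<delta>)) \<midarrow>\<epsilon>\<rightarrow> \<bar>\<epsilon> - \<epsilon>\<bar> / (\<epsilon> * \<epsilon>)"
    using e by (intro tendsto_intros) auto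
  then have "(\<lambda>\<delta>. \<bar>\<delta> - \<epsilon>\<bar> / (\<epsilon> * \<delta>)) \<midarrow>\<epsilon>\<rightarrow> 0" by simp
  moreover have "\<forall>\<^sub>F \<delta> in at \<epsilon>. norm (green a b n n (Complex 0 \<delta>) - green a b n n (Complex 0 \<epsilon>))
      \<le> \<bar>\<delta> - \<epsilon>\<bar> / (\<epsilon> * \<delta>)"
    using eventually_at_in_open'[of "{0<..}" \<epsilon>] e
    by (auto elim!: eventually_mono intro: green_lipschitz)
  ultimately have "(\<lambda>\<delta>. green a b n n (Complex 0 \<delta>) - green a b n n (Complex 0 \<epsilon>)) \<midarrow>\<epsilon>\<rightarrow> 0"
    by (rule Lim_null_comparison[rotated])
  then show "isCont (\<lambda>\<epsilon>. green a b n n (Complex 0 \<epsilon>)) \<epsilon>"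
    unfolding isCont_def by (rule LIM_zero_cancel)
qed

end

section \<open>Solutions and the range of a Jacobi operator\<close>

lemma coord_tendsto_0: "(\<lambda>k. coord x (int k)) \<longlonglongrightarrow> 0"
proof -
  have "(\<lambda>n. (cmod (coord x n))\<^sup>2) summable_on range int"
    by (rule summable_on_subset_banach[OF coord_sq_summable]) auto
  then have "((\<lambda>n. (cmod (coord x n))\<^sup>2) \<circ> int) summable_on UNIV"
    by (subst (asm) summable_on_reindex) auto
  then have "(\<lambda>k. (cmod (coord x (int k)))\<^sup>2) \<longlonglongrightarrow> 0"
    by (intro summable_LIMSEQ_zero summable_on_imp_summable) (simp add: o_def)
  then have "(\<lambda>k. sqrt ((cmod (coord x (int k)))\<^sup>2)) \<longlonglongrightarrow> sqrt 0" by (rule tendsto_real_sqrt)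
  then show ?thesis by (simp add: tendsto_norm_zero_iff)
qed

context bounded_jacobi
begin

lemma range_H_diff: "x \<in> range H \<Longrightarrow> y \<in> range H \<Longrightarrow> x - y \<in> range H"
  by (auto simp flip: H_diff)

lemma range_H_cscale: "x \<in> range H \<Longrightarrow> cscale c x \<in> range H"
  by (auto simp flip: H_cscale)

lemma H_delta: "H (delta_l2 m) = cscale (of_real (b m)) (delta_l2 m)
   + cscale (a (m - 1)) (delta_l2 (m - 1)) + cscale (cnj (a m)) (delta_l2 (m + 1))"
  by (auto intro!: l2_eqI simp: coord_H jacobi_op_def ell2_delta_def)

text \<open>\<open>H\<close> applied to a truncated solution only sees the two sites next to the cut.\<close>

lemma cutoff_in_range_H:
  assumes sol: "\<And>n. jacobi_op a b u n = 0"
    and cut: "(\<lambda>n. if n \<ge> 0 then u n else 0) \<in> ell2 \<or> (\<lambda>n. if n < 0 then u n else 0) \<in> ell2"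
  shows "cscale (a (- 1) * u 0) (delta_l2 (- 1)) - cscale (cnj (a (- 1)) * u (- 1)) (delta_l2 0) \<in> range H"
    (is "?d \<in> _")
proof -
  have sol': "a n * u (n + 1) + of_real (b n) * u n = - cnj (a (n - 1)) * u (n - 1)" for n
    using sol[of n] unfolding jacobi_op_def by (simp add: eq_neg_iff_add_eq_0 algebra_simps)
  from cut show ?thesis
  proof
    assume *: "(\<lambda>n. if n \<ge> 0 then u n else 0) \<in> ell2"
    define x where "x = Abs_l2 (\<lambda>n. if n \<ge> 0 then u n else 0)"
    have cx: "coord x = (\<lambda>n. if n \<ge> 0 then u n else 0)" by (simp add: x_def * Abs_l2_inverse)
    have "H x = ?d"
    proof (rule l2_eqI)
      fix n :: int
      consider "n < - 1" | "n = - 1" | "n = 0" | "n > 0" by linarith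
      then show "coord (H x) n = coord ?d n"
        using sol[of n] sol'[of n]
        by cases (auto simp: coord_H jacobi_op_def cx ell2_delta_def algebra_simps)
    qed
    then show ?thesis by (metis rangeI)
  next
    assume *: "(\<lambda>n. if n < 0 then u n else 0) \<in> ell2"
    define x where "x = Abs_l2 (\<lambda>n. if n < 0 then u n else 0)"
    have cx: "coord x = (\<lambda>n. if n < 0 then u n else 0)" by (simp add: x_def * Abs_l2_inverse)
    \<comment> \<open>The two truncations add up to \<open>u\<close>, which is annihilated, so the
      left one produces the negative of what the right one produces.\<close>
    have "H x = cscale (- 1) ?d"
    proof (rule l2_eqI)
      fix n :: int
      consider "n < - 1" | "n = - 1" | "n = 0" | "n > 0" by linarith
      then show "coord (H x) n = coord (cscale (- 1) ?d) n"
        using sol[of n] sol'[of n]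
        by cases (auto simp: coord_H jacobi_op_def cx ell2_delta_def algebra_simps add_eq_0_iff)
    qed
    then have "cscale (- 1) (H x) = ?d" by (simp add: cscale_cscale cscale_1)
    then show ?thesis by (metis range_H_cscale rangeI)
  qed
qed

text \<open>The imaginary part of \<open>a\<^sub>n u\<^sub>n\<^sub>+\<^sub>1 (cnj u\<^sub>n)\<close> is the Wronskian of \<open>u\<close> with its conjugate, hence
  independent of \<open>n\<close>, and it tends to \<open>0\<close> for a decaying solution.\<close>

lemma right_decaying_real:
  assumes sol: "\<And>n. jacobi_op a b u n = 0"
    and right: "(\<lambda>n. if n \<ge> 0 then u n else 0) \<in> ell2"
  shows "Im (a (- 1) * u 0 * cnj (u (- 1))) = 0"
proof -
  define W where "W n = Im (a n * u (n + 1) * cnj (u n))" for n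
  have step: "W n = W (n - 1)" for n
  proof -
    \<comment> \<open>In the equation at n times \<open>cnj (u n)\<close> the diagonal term is real,
      and the term from n - 1 is the conjugate of the product defining
      \<open>W (n - 1)\<close>.\<close>
    have "Im (jacobi_op a b u n * cnj (u n)) = 0" by (simp add: sol)
    then show ?thesis by (simp add: jacobi_op_def W_def algebra_simps)
  qed
  have W: "W (int k) = W (- 1)" for k
  proof (induction k)
    case 0 then show ?case using step[of 0] by simp
  next
    case (Suc k) then show ?case using step[of "int (Suc k)"] by simp
  qed
  define x where "x = Abs_l2 (\<lambda>n. if n \<ge> 0 then u n else 0)"
  have cx: "coord x = (\<lambda>n. if n \<ge> 0 then u n else 0)" by (simp add: x_def right Abs_l2_inverse)
  have u0: "(\<lambda>k. u (int k)) \<longlonglongrightarrow> 0" using coord_tendsto_0[of x] by (simp add: cx)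
  have u1: "(\<lambda>k. u (int k + 1)) \<longlonglongrightarrow> 0" using LIMSEQ_Suc[OF u0] by (simp add: add.commute)
  have "(\<lambda>k. W (int k)) \<longlonglongrightarrow> 0"
  proof (rule Lim_null_comparison)
    have "(\<lambda>k. K * cmod (u (int k + 1)) * cmod (u (int k))) \<longlonglongrightarrow> K * 0 * 0"
      by (intro tendsto_intros tendsto_norm_zero u0 u1)
    then show "(\<lambda>k. K * cmod (u (int k + 1)) * cmod (u (int k))) \<longlonglongrightarrow> 0" by simp
    have "\<bar>W (int k)\<bar> \<le> K * cmod (u (int k + 1)) * cmod (u (int k))" for k
      unfolding W_def using a_le[of "int k"]
      by (intro order_trans[OF abs_Im_le_cmod]) (auto simp: norm_mult intro!: mult_right_mono)
    then show "\<forall>\<^sub>F k in sequentially. norm (W (int k)) \<le> K * cmod (u (int k + 1)) * cmod (u (int k))"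
      by simp
  qed
  then have "W (- 1) = 0" by (simp add: W LIMSEQ_const_iff)
  then show ?thesis by (simp add: W_def)
qed

text \<open>\<open>H_delta\<close> says that modulo the range the vectors \<delta>_n obey the
  three-term recurrence that the numbers \<open>cnj (u n)\<close> obey. It remains to match two
  neighbouring sites; there the truncated solution supplies one relation, and reality of the
  Wronskian makes that relation the right one.\<close>

lemma right_decaying_delta_mod_range:
  assumes sol: "\<And>n. jacobi_op a b u n = 0" and nz: "\<And>n. a n \<noteq> 0"
    and right: "(\<lambda>n. if n \<ge> 0 then u n else 0) \<in> ell2"
    and u: "u 0 \<noteq> 0 \<or> u (- 1) \<noteq> 0"
  obtains y where "\<And>k. delta_l2 (int k) - cscale (cnj (u (int k))) y \<in> range H"
proof -
  \<comment> \<open>A number with vanishing imaginary part equals its conjugate. This is the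
    compatibility needed for the coefficients of \<open>d\<close> to annihilate the pair
    \<open>cnj (u (- 1))\<close>, \<open>cnj (u 0)\<close>.\<close>
  have real: "a (- 1) * u 0 * cnj (u (- 1)) = cnj (a (- 1)) * u (- 1) * cnj (u 0)"
    using right_decaying_real[OF sol right]
    by (auto simp: complex_eq_iff algebra_simps)
  define d where "d = cscale (a (- 1) * u 0) (delta_l2 (- 1)) - cscale (cnj (a (- 1)) * u (- 1)) (delta_l2 0)"
  have d: "d \<in> range H" unfolding d_def using cutoff_in_range_H[OF sol] right by blast
  obtain y where y: "delta_l2 0 - cscale (cnj (u 0)) y \<in> range H"
    "delta_l2 (- 1) - cscale (cnj (u (- 1))) y \<in> range H"
  proof (cases "u 0 = 0")
    case False
    define y where "y = cscale (inverse (cnj (u 0))) (delta_l2 0)"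
    have 1: "delta_l2 0 - cscale (cnj (u 0)) y = cscale 0 d"
      using False by (simp add: y_def cscale_cscale cscale_1 cscale_0_left)
    have "delta_l2 (- 1) - cscale (cnj (u (- 1))) y = cscale (inverse (a (- 1) * u 0)) d"
    proof -
      have eq: "cnj (u (- 1)) * inverse (cnj (u 0)) = inverse (a (- 1) * u 0) * (cnj (a (- 1)) * u (- 1))"
        using False nz[of "- 1"] real by (simp add: field_simps)
      show ?thesis using False nz[of "- 1"]
        by (simp only: y_def d_def cscale_diff_right cscale_cscale eq)
          (simp add: cscale_1 field_simps)
    qed
    then show thesis using that[of y] 1 d range_H_cscale by metis
  next
    case True
    then have um: "u (- 1) \<noteq> 0" using u by simp
    define y where "y = cscale (inverse (cnj (u (- 1)))) (delta_l2 (- 1))"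
    have 1: "delta_l2 (- 1) - cscale (cnj (u (- 1))) y = cscale 0 d"
      using um by (simp add: y_def cscale_cscale cscale_1 cscale_0_left)
    have "cscale (inverse (- (cnj (a (- 1)) * u (- 1)))) d = delta_l2 0 - cscale (cnj (u 0)) y"
      using True um nz[of "- 1"]
      by (intro l2_eqI) (simp add: d_def cscale_diff_right cscale_cscale cscale_0_left field_simps)
    then show thesis using that[of y] 1 d range_H_cscale by metis
  qed
  \<comment> \<open>The recurrence is of second order, so the induction carries two consecutive
    sites.\<close>
  have "delta_l2 (int k) - cscale (cnj (u (int k))) y \<in> range H \<and>
      delta_l2 (int k - 1) - cscale (cnj (u (int k - 1))) y \<in> range H" for k
  proof (induction k)
    case 0 then show ?case using y by simp
  next
    case (Suc k)
    define n where "n = int k"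
    have ih: "delta_l2 n - cscale (cnj (u n)) y \<in> range H"
      "delta_l2 (n - 1) - cscale (cnj (u (n - 1))) y \<in> range H"
      using Suc by (auto simp: n_def)
    have rec: "cnj (a n) * cnj (u (n + 1)) = - (of_real (b n) * cnj (u n) + a (n - 1) * cnj (u (n - 1)))"
      using arg_cong[OF sol[of n], of cnj]
      by (simp add: jacobi_op_def algebra_simps add_eq_0_iff)
    have "delta_l2 (n + 1) - cscale (cnj (u (n + 1))) y
      = cscale (inverse (cnj (a n))) (H (delta_l2 n) - cscale (of_real (b n)) (delta_l2 n - cscale (cnj (u n)) y)
          - cscale (a (n - 1)) (delta_l2 (n - 1) - cscale (cnj (u (n - 1))) y))" (is "?l = cscale _ ?r")
    proof -
      have "?r = cscale (cnj (a n)) (delta_l2 (n + 1))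
          + cscale (of_real (b n) * cnj (u n) + a (n - 1) * cnj (u (n - 1))) y"
        by (auto intro!: l2_eqI simp: H_delta algebra_simps)
      also have "\<dots> = cscale (cnj (a n)) ?l"
        by (intro l2_eqI) (simp add: right_diff_distrib rec flip: mult.assoc, simp add: algebra_simps)
      finally show ?thesis using nz[of n] by (simp add: cscale_cscale cscale_1)
    qed
    then have "?l \<in> range H" by (metis ih range_H_cscale range_H_diff rangeI)
    then show ?case using Suc by (simp add: n_def add.commute)
  qed
  then show thesis using that by blast
qed

text \<open>\<open>r k\<close> is |u_k| times the norm of the fixed vector. \<open>C\<close> may
  depend on k, but it carries a factor \<epsilon>, so letting \<epsilon> tend to 0 at fixed k leaves
  only \<open>r k\<close>.\<close>

lemma right_decaying_green:
  assumes sol: "\<And>n. jacobi_op a b u n = 0" and nz: "\<And>n. a n \<noteq> 0"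
    and right: "(\<lambda>n. if n \<ge> 0 then u n else 0) \<in> ell2"
    and u: "u 0 \<noteq> 0 \<or> u (- 1) \<noteq> 0"
  obtains r where "r \<longlonglongrightarrow> 0"
    "\<And>k. \<exists>C. \<forall>\<epsilon>>0. \<epsilon> * cmod (green a b (int k) (int k) (Complex 0 \<epsilon>)) \<le> \<epsilon> * C + r k"
proof -
  obtain y where y: "\<And>k. delta_l2 (int k) - cscale (cnj (u (int k))) y \<in> range H"
    using right_decaying_delta_mod_range[OF assms] by blast
  define x where "x = Abs_l2 (\<lambda>n. if n \<ge> 0 then u n else 0)"
  have cx: "coord x = (\<lambda>n. if n \<ge> 0 then u n else 0)" by (simp add: x_def right Abs_l2_inverse)
  have "(\<lambda>k. cmod (u (int k)) * norm y) \<longlonglongrightarrow> 0"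
    using coord_tendsto_0[of x] by (intro tendsto_mult_left_zero tendsto_norm_zero) (simp add: cx)
  moreover have "\<exists>C. \<forall>\<epsilon>>0. \<epsilon> * cmod (green a b (int k) (int k) (Complex 0 \<epsilon>)) \<le> \<epsilon> * C + cmod (u (int k)) * norm y" for k
  proof -
    obtain z where "delta_l2 (int k) - cscale (cnj (u (int k))) y = H z" using y by blast
    then have "delta_l2 (int k) = H z + cscale (cnj (u (int k))) y" by (metis diff_add_cancel)
    from green_le[OF _ this] show ?thesis
      by (intro exI[of _ "2 * norm z"]) (auto simp: norm_cscale algebra_simps)
  qed
  ultimately show thesis using that by blast
qed

text \<open>The cutoff vectors of \<open>u\<close> and \<open>v\<close> both lie in the span of
  \<delta>_{-1} and \<delta>_0, and their determinant is the Wronskian-like quantity in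
  \<open>indep\<close> up to a nonzero factor. Elimination puts both basis vectors into the range,
  and \<open>H_delta\<close> at 0 adds \<delta>_1.\<close>

lemma independent_green_bounded:
  assumes "\<And>n. jacobi_op a b u n = 0" "\<And>n. jacobi_op a b v n = 0" and nz: "\<And>n. a n \<noteq> 0"
    and "(\<lambda>n. if n \<ge> 0 then u n else 0) \<in> ell2" "(\<lambda>n. if n < 0 then v n else 0) \<in> ell2"
    and indep: "u 0 * v (- 1) \<noteq> u (- 1) * v 0"
  obtains C where "\<And>\<epsilon>. \<epsilon> > 0 \<Longrightarrow> cmod (green a b 0 0 (Complex 0 \<epsilon>)) \<le> C"
    "\<And>\<epsilon>. \<epsilon> > 0 \<Longrightarrow> cmod (green a b 1 1 (Complex 0 \<epsilon>)) \<le> C"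
proof -
  define d where "d u = cscale (a (- 1) * u 0) (delta_l2 (- 1)) - cscale (cnj (a (- 1)) * u (- 1)) (delta_l2 0)"
    for u :: "int \<Rightarrow> complex"
  have d: "d u \<in> range H" "d v \<in> range H"
    unfolding d_def using assms cutoff_in_range_H[of u] cutoff_in_range_H[of v] by blast+
  define w where "w = u 0 * v (- 1) - u (- 1) * v 0"
  have w: "w \<noteq> 0" using indep by (simp add: w_def)
  have "cscale (v (- 1)) (d u) - cscale (u (- 1)) (d v) = cscale (a (- 1) * w) (delta_l2 (- 1))"
    "cscale (v 0) (d u) - cscale (u 0) (d v) = cscale (cnj (a (- 1)) * w) (delta_l2 0)"
    by (auto intro!: l2_eqI simp: d_def w_def algebra_simps)
  then have "delta_l2 (- 1) = cscale (inverse (a (- 1) * w)) (cscale (v (- 1)) (d u) - cscale (u (- 1)) (d v))"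
    "delta_l2 0 = cscale (inverse (cnj (a (- 1)) * w)) (cscale (v 0) (d u) - cscale (u 0) (d v))"
    using w nz[of "- 1"] by (simp_all add: cscale_cscale cscale_1 del: inverse_mult_distrib)
  then have 0: "delta_l2 (- 1) \<in> range H" "delta_l2 0 \<in> range H"
    by (metis d range_H_cscale range_H_diff)+
  have "delta_l2 1 = cscale (inverse (cnj (a 0)))
      (H (delta_l2 0) - cscale (of_real (b 0)) (delta_l2 0) - cscale (a (- 1)) (delta_l2 (- 1)))"
    using nz[of 0] by (auto intro!: l2_eqI simp: H_delta)
  then have 1: "delta_l2 1 \<in> range H" by (metis 0 range_H_cscale range_H_diff rangeI)
  have bd: "\<exists>C. \<forall>\<epsilon>>0. cmod (green a b n n (Complex 0 \<epsilon>)) \<le> C" if "delta_l2 n \<in> range H" for n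
  proof -
    from that obtain z where "delta_l2 n = H z + 0" by auto
    from green_le[OF _ this] show ?thesis by (intro exI[of _ "2 * norm z"]) auto
  qed
  obtain C0 C1 where "\<forall>\<epsilon>>0. cmod (green a b 0 0 (Complex 0 \<epsilon>)) \<le> C0"
    "\<forall>\<epsilon>>0. cmod (green a b 1 1 (Complex 0 \<epsilon>)) \<le> C1"
    using bd 0 1 by metis
  then show thesis using that[of "max C0 C1"] by (auto simp: le_max_iff_disj)
qed

lemma eigenvector_green:
  assumes "\<And>n. jacobi_op a b u n = 0" "u \<in> ell2" "u n \<noteq> 0"
  obtains c where "c > 0" "\<And>\<epsilon>. \<epsilon> > 0 \<Longrightarrow> c \<le> \<epsilon> * cmod (green a b n n (Complex 0 \<epsilon>))"
proof -
  define x where "x = Abs_l2 u"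
  have cx: "coord x = u" by (simp add: x_def assms Abs_l2_inverse)
  have H: "H x = 0" by (rule l2_eqI) (simp add: coord_H cx assms)
  have "norm x > 0" using norm_coord_le[of x n] assms(3) by (simp add: cx) (auto simp: cx)
  then have "(cmod (u n))\<^sup>2 / (norm x)\<^sup>2 \<le> \<epsilon> * cmod (green a b n n (Complex 0 \<epsilon>))" if "\<epsilon> > 0" for \<epsilon>
    using green_ge_eigenvector[OF that H, of n] by (simp add: cx field_simps)
  then show thesis using that[of "(cmod (u n))\<^sup>2 / (norm x)\<^sup>2"] \<open>norm x > 0\<close> assms(3) by simp
qed

text \<open>\<open>shift_l2 n\<close> intertwines the operator with its translate and carries
  \<delta>_n to \<delta>_0. Along an orbit this turns the diagonal Green's function into a
  stationary sequence.\<close>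

lemma green_shift:
  assumes "\<epsilon> > 0"
  shows "green (\<lambda>k. a (k + n)) (\<lambda>k. b (k + n)) 0 0 (Complex 0 \<epsilon>) = green a b n n (Complex 0 \<epsilon>)"
proof -
  interpret shifted: bounded_jacobi "\<lambda>k. a (k + n)" "\<lambda>k. b (k + n)" K
    by unfold_locales (auto intro: a_le b_le)
  have "shifted.shifted_H \<epsilon> (shift_l2 n (resolvent \<epsilon> (delta_l2 n)))
      = shift_l2 n (shifted_H \<epsilon> (resolvent \<epsilon> (delta_l2 n)))"
    by (intro l2_eqI) (simp add: shifted.shifted_H_def shifted_H_def shifted.coord_H coord_H
        jacobi_op_def algebra_simps)
  also have "\<dots> = delta_l2 0"
    by (auto intro!: l2_eqI simp: shifted_H_resolvent assms ell2_delta_def)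
  finally show ?thesis
    using shifted.resolvent_eq[OF assms, of "shift_l2 n (resolvent \<epsilon> (delta_l2 n))" "delta_l2 0"]
    by (simp add: green_eq_resolvent shifted.green_eq_resolvent assms)
qed

end

text \<open>By continuity a large value at a real point is nearly attained at rational points, so
  countably many conditions suffice. One \<open>N\<close> serves both as height and as inverse
  distance to 0.\<close>

lemma Limsup_at_right_0_eq_infinity_iff:
  fixes f :: "real \<Rightarrow> real"
  assumes cont: "continuous_on {0<..} f"
  shows "Limsup (at_right 0) (\<lambda>\<epsilon>. ereal (f \<epsilon>)) = \<infinity> \<longleftrightarrow>
    (\<forall>N::nat. \<exists>r. 0 < real_of_rat r \<and> of_rat r < 1 / real (Suc N) \<and> f (of_rat r) > real N)"
    (is "?L = _ \<longleftrightarrow> ?R")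
proof
  assume L: "?L = \<infinity>"
  show ?R
  proof (rule ccontr)
    assume "\<not> ?R"
    then obtain N :: nat where N: "\<And>r. 0 < real_of_rat r \<Longrightarrow> of_rat r < 1 / real (Suc N) \<Longrightarrow> f (of_rat r) \<le> real N"
      by (meson not_less)
    have "f \<epsilon> \<le> real N" if "\<epsilon> \<in> {0<..<1 / real (Suc N)}" for \<epsilon>
    proof (rule ccontr)
      assume "\<not> f \<epsilon> \<le> real N"
      have "continuous_on {0<..<1 / real (Suc N)} f"
        by (rule continuous_on_subset[OF cont]) auto
      then have "open ({0<..<1 / real (Suc N)} \<inter> f -` {real N<..})"
        by (rule continuous_open_preimage) auto
      moreover have "\<epsilon> \<in> {0<..<1 / real (Suc N)} \<inter> f -` {real N<..}"
        using that \<open>\<not> f \<epsilon> \<le> real N\<close> by auto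
      ultimately obtain d where d: "d > 0" "\<And>y. dist y \<epsilon> < d \<Longrightarrow> y \<in> {0<..<1 / real (Suc N)} \<inter> f -` {real N<..}"
        unfolding open_dist by blast
      obtain r where "\<epsilon> < of_rat r" "of_rat r < \<epsilon> + d"
        using of_rat_dense[of \<epsilon> "\<epsilon> + d"] d by auto
      then have "of_rat r \<in> {0<..<1 / real (Suc N)} \<inter> f -` {real N<..}"
        by (intro d) (simp add: dist_real_def)
      then show False using N[of r] by auto
    qed
    then have "\<forall>\<^sub>F \<epsilon> in at_right 0. ereal (f \<epsilon>) \<le> ereal (real N)"
      unfolding eventually_at_right_field by (intro exI[of _ "1 / real (Suc N)"]) auto
    then have "?L \<le> ereal (real N)" by (rule Limsup_bounded)
    then show False using L by simp
  qed
next
  assume R: ?R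
  show "?L = \<infinity>"
  proof (rule ccontr)
    assume "?L \<noteq> \<infinity>"
    then obtain c :: real where "?L < ereal c"
      by (metis less_PInf_Ex_of_nat ereal_infty_less(1))
    then have "\<forall>\<^sub>F \<epsilon> in at_right 0. ereal (f \<epsilon>) < ereal c" by (rule Limsup_lessD)
    then obtain d where d: "d > 0" "\<And>\<epsilon>. 0 < \<epsilon> \<Longrightarrow> \<epsilon> < d \<Longrightarrow> f \<epsilon> < c"
      by (auto simp: eventually_at_right_field)
    obtain N1 :: nat where N1: "1 / real (Suc N1) < d" using d(1) nat_approx_posE by blast
    obtain N2 :: nat where N2: "c \<le> real N2" using real_arch_simple by blast
    define N where "N = max N1 N2"
    have "1 / real (Suc N) \<le> 1 / real (Suc N1)" by (simp add: N_def frac_le)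
    moreover obtain r :: rat where r: "0 < real_of_rat r" "of_rat r < 1 / real (Suc N)" "f (of_rat r) > real N"
      using R by blast
    moreover have "c \<le> real N" using N2 by (simp add: N_def)
    ultimately show False using d(2)[of "of_rat r"] N1 by linarith
  qed
qed

section \<open>The subadditive ergodic theorem\<close>

lemma fekete:
  fixes e :: "nat \<Rightarrow> real"
  assumes sub: "\<And>m n. e (m + n) \<le> e m + e n" and nonneg: "\<And>n. 0 \<le> e n"
  obtains \<gamma> where "(\<lambda>n. e n / real n) \<longlonglongrightarrow> \<gamma>" "\<And>n. real n * \<gamma> \<le> e n"
proof -
  define \<gamma> where "\<gamma> = (INF n\<in>{1..}. e n / real n)"
  have bdd: "bdd_below ((\<lambda>n. e n / real n) ` {1..})"
    by (rule bdd_belowI[of _ 0]) (auto simp: nonneg)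
  have low: "\<gamma> \<le> e n / real n" if "n \<ge> 1" for n
    unfolding \<gamma>_def using bdd that by (intro cINF_lower) auto
  have low': "real n * \<gamma> \<le> e n" for n
    using low[of n] nonneg[of 0] by (cases "n = 0") (auto simp: field_simps)
  have "(\<lambda>n. e n / real n) \<longlonglongrightarrow> \<gamma>"
  proof (rule order_tendstoI)
    fix c assume "c < \<gamma>"
    then show "\<forall>\<^sub>F n in sequentially. c < e n / real n"
      using low by (auto intro!: eventually_sequentiallyI[of 1] intro: less_le_trans)
  next
    fix c assume "\<gamma> < c"
    then obtain N where N: "N \<ge> 1" "e N / real N < c"
      unfolding \<gamma>_def using cINF_less_iff[OF _ bdd, of c] by auto
    \<comment> \<open>A bound for \<open>e\<close> at every remainder modulo \<open>N\<close>, all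
      terms being nonnegative.\<close>
    define C where "C = (\<Sum>s<N. e s)"
    have mult: "e (q * N) \<le> real q * e N + e 0" for q
    proof (induction q)
      case (Suc q) then show ?case using sub[of N "q * N"] by (simp add: algebra_simps)
    qed simp
    have bound: "e n \<le> real n * (e N / real N) + (C + e 0)" for n
    proof -
      define q where "q = n div N"
      have "e n \<le> e (q * N) + e (n mod N)" using sub[of "q * N" "n mod N"] by (simp add: q_def)
      moreover have "e (n mod N) \<le> C" unfolding C_def
        using N nonneg by (intro member_le_sum) auto
      moreover have "real q * e N \<le> real n * (e N / real N)"
      proof -
        have "real q \<le> real n / real N" unfolding q_def by (rule of_nat_div_le_of_nat)
        then have "real q * e N \<le> (real n / real N) * e N" by (intro mult_right_mono nonneg)
        then show ?thesis by simp
      qed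
      ultimately show ?thesis using mult[of q] by linarith
    qed
    have "(\<lambda>n. e N / real N + (C + e 0) / real n) \<longlonglongrightarrow> e N / real N + 0"
      by (intro tendsto_intros lim_const_over_n)
    then have "\<forall>\<^sub>F n in sequentially. e N / real N + (C + e 0) / real n < c"
      using N by (intro order_tendstoD(2)) auto
    then show "\<forall>\<^sub>F n in sequentially. e n / real n < c"
      using eventually_gt_at_top[of 0]
    proof eventually_elim
      case (elim n)
      then show ?case using bound[of n] by (simp add: field_simps)
    qed
  qed
  then show thesis using that low' by blast
qed

context invertible_ergodic
begin

lemma T_in_space: "\<omega> \<in> space M \<Longrightarrow> T \<omega> \<in> space M"
  using measurable_T by (rule measurable_space)

lemma measurable_iterate [measurable]: "T ^^ n \<in> measurable M M"
  by (induction n) (use measurable_comp measurable_T in \<open>auto simp: o_def\<close>)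

lemma iterate_in_space: "\<omega> \<in> space M \<Longrightarrow> (T ^^ n) \<omega> \<in> space M"
  using measurable_iterate by (rule measurable_space)

lemma distr_iterate: "distr M M (T ^^ n) = M"
proof (induction n)
  case (Suc n)
  have "distr M M (T ^^ Suc n) = distr (distr M M (T ^^ n)) M T"
    using distr_distr[OF measurable_T measurable_iterate[of n]] by simp
  then show ?case unfolding Suc preserving .
qed (simp add: distr_id2)

lemma
  fixes f :: "'w \<Rightarrow> real"
  assumes "integrable M f"
  shows integrable_iterate: "integrable M (\<lambda>\<omega>. f ((T ^^ n) \<omega>))"
    and integral_iterate: "(\<integral>\<omega>. f ((T ^^ n) \<omega>) \<partial>M) = (\<integral>\<omega>. f \<omega> \<partial>M)"
proof -
  have "integrable (distr M M (T ^^ n)) f" by (simp add: distr_iterate assms)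
  then show "integrable M (\<lambda>\<omega>. f ((T ^^ n) \<omega>))"
    by (rule integrable_distr[OF measurable_iterate])
  show "(\<integral>\<omega>. f ((T ^^ n) \<omega>) \<partial>M) = (\<integral>\<omega>. f \<omega> \<partial>M)"
    using integral_distr[OF measurable_iterate, of f n] assms by (simp add: distr_iterate)
qed

lemma AE_iterate:
  assumes "AE \<omega> in M. P \<omega>"
  shows "AE \<omega> in M. P ((T ^^ n) \<omega>)"
  by (rule AE_distrD[OF measurable_iterate]) (unfold distr_iterate, rule assms)

lemma prob_iterate_vimage:
  assumes "B \<in> events"
  shows "prob ((T ^^ n) -` B \<inter> space M) = prob B"
  using measure_distr[OF measurable_iterate, of B n] assms by (simp add: distr_iterate)

text \<open>The preimages of \<open>B\<close> decrease and all have the probability of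
  \<open>B\<close>, hence so does their intersection. That intersection is strictly invariant, as
  \<open>ergodic\<close> demands.\<close>

lemma ergodic_backward_invariant:
  assumes B: "B \<in> events" and inv: "T -` B \<inter> space M \<subseteq> B"
  shows "prob B = 0 \<or> prob B = 1"
proof -
  define C where "C n = (T ^^ n) -` B \<inter> space M" for n
  have C: "C n \<in> events" for n unfolding C_def using B by measurable
  have "decseq C"
  proof (rule decseq_SucI, rule subsetI)
    fix n \<omega> assume "\<omega> \<in> C (Suc n)"
    then have "T ((T ^^ n) \<omega>) \<in> B" "\<omega> \<in> space M" by (auto simp: C_def)
    then show "\<omega> \<in> C n" using inv iterate_in_space[of \<omega> n] by (auto simp: C_def)
  qed
  then have "(\<lambda>n. prob (C n)) \<longlonglongrightarrow> prob (\<Inter>n. C n)"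
    using C by (intro finite_Lim_measure_decseq) auto
  moreover have "prob (C n) = prob B" for n by (simp add: C_def prob_iterate_vimage B)
  ultimately have eq: "prob (\<Inter>n. C n) = prob B" by (simp add: LIMSEQ_const_iff)
  have "T -` (\<Inter>n. C n) \<inter> space M = (\<Inter>n. C n)"
  proof (intro equalityI subsetI)
    fix \<omega> assume *: "\<omega> \<in> T -` (\<Inter>n. C n) \<inter> space M"
    then have TB: "(T ^^ n) (T \<omega>) \<in> B" for n by (auto simp: C_def)
    have "(T ^^ n) \<omega> \<in> B" for n
      using TB[of 0] TB[of "n - 1"] inv * by (cases n) (auto simp: funpow_swap1)
    then show "\<omega> \<in> (\<Inter>n. C n)" using * by (simp add: C_def)
  next
    fix \<omega> assume *: "\<omega> \<in> (\<Inter>n. C n)"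
    then have "\<omega> \<in> C (Suc n)" "\<omega> \<in> C 0" for n by blast+
    then show "\<omega> \<in> T -` (\<Inter>n. C n) \<inter> space M" by (auto simp: C_def funpow_swap1 T_in_space)
  qed
  moreover have "(\<Inter>n. C n) \<in> events" using C by blast
  ultimately show ?thesis using ergodic eq by metis
qed

section \<open>Lower bound for subadditive sequences and Birkhoff's theorem\<close>

lemma subadditive_le_sum:
  assumes sub: "\<And>m n \<omega>. \<omega> \<in> space M \<Longrightarrow> g (m + n) \<omega> \<le> g m \<omega> + g n ((T ^^ m) \<omega>)"
    and "g 0 = (\<lambda>_. 0 :: real)" "\<omega> \<in> space M"
  shows "g n \<omega> \<le> (\<Sum>j<n. g 1 ((T ^^ j) \<omega>))"
  using assms(3)
proof (induction n)
  case (Suc n) then show ?case using sub[of \<omega> n 1] by simp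
qed (simp add: assms(2))

text \<open>The covering argument of Katznelson and Weiss: if blocks of length at most \<open>K\<close> with average below
  \<open>d\<close> start at most points, then an orbit segment can be cut greedily into such blocks, a few single
  points and a final piece of length at most \<open>K\<close>.\<close>

lemma subadditive_covering:
  fixes g :: "nat \<Rightarrow> 'w \<Rightarrow> real" and d :: real and K :: nat
  assumes sub: "\<And>m n \<omega>. \<omega> \<in> space M \<Longrightarrow> g (m + n) \<omega> \<le> g m \<omega> + g n ((T ^^ m) \<omega>)"
    and g0: "g 0 = (\<lambda>_. 0 :: real)"
  defines "h \<equiv> \<lambda>\<omega>. \<bar>g 1 \<omega>\<bar> + \<bar>d\<bar>"
  defines "F \<equiv> \<lambda>\<omega>. if \<exists>n\<in>{1..K}. g n \<omega> < real n * d then d else h \<omega>"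
  assumes "\<omega> \<in> space M"
  shows "g n \<omega> \<le> (\<Sum>j<n. F ((T ^^ j) \<omega>)) + (\<Sum>j\<in>{n - K..<n}. h ((T ^^ j) \<omega>))"
  using \<open>\<omega> \<in> space M\<close>
proof (induction n arbitrary: \<omega> rule: less_induct)
  case (less n)
  \<comment> \<open>The summand \<bar>d\<bar> in \<open>h\<close> makes
    \<open>g 1 \<omega> \<le> F \<omega> + h \<omega>\<close> hold even where \<open>F\<close> takes
    a negative value \<open>d\<close>.\<close>
  have h0: "0 \<le> h \<omega>" and dF: "d \<le> F \<omega>" and gFh: "g 1 \<omega> \<le> F \<omega> + h \<omega>" for \<omega>
    by (auto simp: h_def F_def)
  consider "n \<le> K" | k where "n > K" "k \<in> {1..K}" "g k \<omega> < real k * d"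
    | "n > K" "\<not> (\<exists>k\<in>{1..K}. g k \<omega> < real k * d)" by force
  then show ?case
  proof cases
    \<comment> \<open>A segment of length at most \<open>K\<close> is entirely final piece:
      \<open>n - K\<close> is 0 here.\<close>
    case 1
    have "g n \<omega> \<le> (\<Sum>j<n. g 1 ((T ^^ j) \<omega>))" by (rule subadditive_le_sum[OF sub g0 less.prems])
    also have "\<dots> \<le> (\<Sum>j<n. F ((T ^^ j) \<omega>) + h ((T ^^ j) \<omega>))" by (intro sum_mono gFh)
    finally show ?thesis using 1 by (simp add: sum.distrib atLeast0LessThan)
  next
    case 2
    define m where "m = n - k"
    have n: "n = k + m" "m < n" using 2 by (auto simp: m_def)
    have "g n \<omega> \<le> g k \<omega> + g m ((T ^^ k) \<omega>)" unfolding n(1) using less.prems by (rule sub)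
    also have "g m ((T ^^ k) \<omega>) \<le> (\<Sum>j<m. F ((T ^^ j) ((T ^^ k) \<omega>)))
        + (\<Sum>j\<in>{m - K..<m}. h ((T ^^ j) ((T ^^ k) \<omega>)))"
      using n(2) less.prems by (intro less.IH iterate_in_space)
    also have "(\<Sum>j<m. F ((T ^^ j) ((T ^^ k) \<omega>))) = (\<Sum>j\<in>{k..<n}. F ((T ^^ j) \<omega>))"
      unfolding n(1) by (rule sum.reindex_bij_witness[of _ "\<lambda>j. j - k" "\<lambda>j. j + k"])
        (auto simp: funpow_add)
    also have "(\<Sum>j\<in>{m - K..<m}. h ((T ^^ j) ((T ^^ k) \<omega>))) = (\<Sum>j\<in>{m - K + k..<n}. h ((T ^^ j) \<omega>))"
      unfolding n(1) by (rule sum.reindex_bij_witness[of _ "\<lambda>j. j - k" "\<lambda>j. j + k"])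
        (auto simp: funpow_add)
    also have "\<dots> \<le> (\<Sum>j\<in>{n - K..<n}. h ((T ^^ j) \<omega>))"
      using h0 n by (intro sum_mono2) auto
    also have "g k \<omega> \<le> (\<Sum>j<k. F ((T ^^ j) \<omega>))"
    proof -
      have "g k \<omega> \<le> (\<Sum>j<k. d)" using 2 by simp
      also have "\<dots> \<le> (\<Sum>j<k. F ((T ^^ j) \<omega>))" by (intro sum_mono dF)
      finally show ?thesis .
    qed
    finally show ?thesis
      using sum.union_disjoint[of "{..<k}" "{k..<n}" "\<lambda>j. F ((T ^^ j) \<omega>)"] n
      by (simp add: ivl_disj_un_one ivl_disj_int_one)
  next
    case 3
    define m where "m = n - 1"
    have n: "n = 1 + m" "m < n" using 3 by (auto simp: m_def)
    have F: "F \<omega> = h \<omega>" using 3 by (simp add: F_def)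
    have "g n \<omega> \<le> g 1 \<omega> + g m ((T ^^ 1) \<omega>)" unfolding n(1) using less.prems by (rule sub)
    also have "g m ((T ^^ 1) \<omega>) \<le> (\<Sum>j<m. F ((T ^^ j) ((T ^^ 1) \<omega>)))
        + (\<Sum>j\<in>{m - K..<m}. h ((T ^^ j) ((T ^^ 1) \<omega>)))"
      using n(2) less.prems by (intro less.IH iterate_in_space)
    also have "(\<Sum>j\<in>{m - K..<m}. h ((T ^^ j) ((T ^^ 1) \<omega>))) = (\<Sum>j\<in>{m - K + 1..<n}. h ((T ^^ j) \<omega>))"
      unfolding n(1) by (rule sum.reindex_bij_witness[of _ "\<lambda>j. j - 1" "\<lambda>j. j + 1"])
        (auto simp: funpow_swap1)
    also have "\<dots> \<le> (\<Sum>j\<in>{n - K..<n}. h ((T ^^ j) \<omega>))"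
      using h0 n by (intro sum_mono2) auto
    also have "g 1 \<omega> \<le> F \<omega>" unfolding F by (simp add: h_def)
    finally show ?thesis
      unfolding n(1) by (simp add: sum.lessThan_Suc_shift funpow_swap1 del: sum.lessThan_Suc)
  qed
qed

text \<open>The event that the liminf of g_n / n lies below \<open>d\<close> has probability 0 or 1.
  Were it 1, good blocks would start almost everywhere, the integrals of \<open>F K\<close> would
  tend to \<open>d\<close>, and the covering estimate would give \<gamma> \<le> d although
  \<open>d\<close> was chosen below \<gamma>.\<close>

lemma subadditive_lower:
  assumes sub: "\<And>m n \<omega>. \<omega> \<in> space M \<Longrightarrow> g (m + n) \<omega> \<le> g m \<omega> + g n ((T ^^ m) \<omega>)"
    and g0: "g 0 = (\<lambda>_. 0 :: real)" and int: "\<And>n. integrable M (g n)"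
    and lower: "\<And>n. real n * \<gamma> \<le> (\<integral>\<omega>. g n \<omega> \<partial>M)" and "c < \<gamma>"
  shows "AE \<omega> in M. \<forall>\<^sub>F n in sequentially. real n * c < g n \<omega>"
proof -
  define d where "d = (c + \<gamma>) / 2"
  have d: "c < d" "d < \<gamma>" using \<open>c < \<gamma>\<close> by (auto simp: d_def)
  have meas [measurable]: "g n \<in> borel_measurable M" for n using int by auto
  \<comment> \<open>The margin 1/(k+1) encodes a liminf strictly below \<open>d\<close>. It makes
    \<open>B\<close> backward invariant: passing from \<open>T \<omega>\<close> to \<omega> costs
    \<open>g 1 \<omega>\<close> once, which is absorbed for large n by replacing k with k +
    1.\<close>
  define B where "B = {\<omega>\<in>space M. \<exists>k. \<exists>\<^sub>F n in sequentially. g n \<omega> < real n * (d - 1 / real (Suc k))}"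
  have B: "B \<in> events" unfolding B_def frequently_sequentially by measurable
  have "T -` B \<inter> space M \<subseteq> B"
  proof safe
    fix \<omega> assume \<omega>: "\<omega> \<in> space M" "T \<omega> \<in> B"
    then obtain k where k: "\<exists>\<^sub>F n in sequentially. g n (T \<omega>) < real n * (d - 1 / real (Suc k))"
      by (auto simp: B_def)
    define p q where "p = d - 1 / real (Suc k)" and "q = d - 1 / real (Suc (Suc k))"
    have pq: "p < q" by (simp add: p_def q_def field_simps)
    obtain n0 :: nat where n0: "(g 1 \<omega> - q) / (q - p) < real n0" using reals_Archimedean2 by blast
    have "\<exists>n\<ge>N. g n \<omega> < real n * q" for N
    proof -
      obtain n where n: "n \<ge> N + n0" "g n (T \<omega>) < real n * p"
        using k unfolding frequently_sequentially p_def by blast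
      have "(g 1 \<omega> - q) / (q - p) < real n" using n0 n by linarith
      then have "g 1 \<omega> - q < real n * (q - p)" using pq by (simp add: field_simps)
      moreover have "g (1 + n) \<omega> \<le> g 1 \<omega> + g n ((T ^^ 1) \<omega>)" using \<omega> by (intro sub)
      ultimately have "g (1 + n) \<omega> < real (1 + n) * q" using n by (simp add: algebra_simps)
      then show ?thesis using n by (intro exI[of _ "1 + n"]) auto
    qed
    then show "\<omega> \<in> B" using \<omega> unfolding B_def frequently_sequentially q_def by blast
  qed
  then consider "prob B = 0" | "prob B = 1" using ergodic_backward_invariant[OF B] by blast
  then show ?thesis
  proof cases
    case 1
    then have "AE \<omega> in M. \<omega> \<notin> B" using B by (simp add: prob_eq_0)
    then show ?thesis using AE_space
    proof eventually_elim
      case (elim \<omega>)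
      obtain k where k: "1 / real (Suc k) < d - c" using d nat_approx_posE[of "d - c"] by auto
      have "\<forall>\<^sub>F n in sequentially. \<not> g n \<omega> < real n * (d - 1 / real (Suc k))"
        using elim by (auto simp: B_def not_frequently)
      then show ?case using eventually_gt_at_top[of 0]
      proof eventually_elim
        case (elim n)
        have "real n * c < real n * (d - 1 / real (Suc k))" using k elim by (intro mult_strict_left_mono) auto
        then show ?case using elim by linarith
      qed
    qed
  next
    case 2
    define h where "h \<omega> = \<bar>g 1 \<omega>\<bar> + \<bar>d\<bar>" for \<omega>
    define S where "S K = {\<omega>\<in>space M. \<exists>n\<in>{1..K}. g n \<omega> < real n * d}" for K
    define F where "F K \<omega> = (if \<exists>n\<in>{1..K}. g n \<omega> < real n * d then d else h \<omega>)" for K \<omega>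
    have S [measurable]: "S K \<in> events" for K unfolding S_def by measurable
    have h: "integrable M h" unfolding h_def using int by auto
    have Fm [measurable]: "F K \<in> borel_measurable M" for K
      using h unfolding F_def by measurable
    have Fh: "\<bar>F K \<omega>\<bar> \<le> h \<omega>" for K \<omega> by (auto simp: F_def h_def)
    have F: "integrable M (F K)" for K
      by (rule Bochner_Integration.integrable_bound[OF h]) (use Fh in \<open>auto simp: h_def\<close>)
    \<comment> \<open>On \<open>B\<close> some good block length n exists, and \<open>F K\<close>
      equals \<open>d\<close> at that point as soon as K reaches n; \<open>h\<close>
      dominates.\<close>
    have "(\<lambda>K. \<integral>\<omega>. F K \<omega> \<partial>M) \<longlonglongrightarrow> (\<integral>\<omega>. d \<partial>M)"
    proof (rule integral_dominated_convergence[where w = h])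
      have "AE \<omega> in M. \<omega> \<in> B" using 2 B by (simp add: prob_eq_1)
      then show "AE \<omega> in M. (\<lambda>K. F K \<omega>) \<longlonglongrightarrow> d"
      proof eventually_elim
        case (elim \<omega>)
        then obtain k where "\<exists>\<^sub>F n in sequentially. g n \<omega> < real n * (d - 1 / real (Suc k))"
          by (auto simp: B_def)
        then obtain n where n: "n \<ge> 1" "g n \<omega> < real n * (d - 1 / real (Suc k))"
          unfolding frequently_sequentially by blast
        moreover have "real n * (d - 1 / real (Suc k)) \<le> real n * d" by (intro mult_left_mono) auto
        ultimately have "g n \<omega> < real n * d" by linarith
        then have "\<forall>\<^sub>F K in sequentially. F K \<omega> = d"
          using n by (intro eventually_sequentiallyI[of n]) (auto simp: F_def)
        then show ?case by (rule tendsto_eventually)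
      qed
    qed (use h Fh in auto)
    then have lim: "(\<lambda>K. \<integral>\<omega>. F K \<omega> \<partial>M) \<longlonglongrightarrow> d" by (simp add: prob_space)
    have "\<gamma> \<le> (\<integral>\<omega>. F K \<omega> \<partial>M)" for K
    proof -
      define H where "H = (\<integral>\<omega>. h \<omega> \<partial>M)"
      have H: "0 \<le> H" unfolding H_def h_def by (intro integral_nonneg_AE) auto
      have cover: "g n \<omega> \<le> (\<Sum>j<n. F K ((T ^^ j) \<omega>)) + (\<Sum>j\<in>{n - K..<n}. h ((T ^^ j) \<omega>))"
        if "\<omega> \<in> space M" for n \<omega>
        using subadditive_covering[OF sub g0 that, of n K d] unfolding F_def h_def .
      \<comment> \<open>The final piece has at most \<open>K\<close> sites, so its share per site
        vanishes as n grows with \<open>K\<close> fixed.\<close>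
      have "\<gamma> \<le> (\<integral>\<omega>. F K \<omega> \<partial>M) + real K * H / real n" if "n \<ge> 1" for n
      proof -
        have "real n * \<gamma> \<le> (\<integral>\<omega>. g n \<omega> \<partial>M)" by (rule lower)
        also have "\<dots> \<le> (\<integral>\<omega>. (\<Sum>j<n. F K ((T ^^ j) \<omega>)) + (\<Sum>j\<in>{n - K..<n}. h ((T ^^ j) \<omega>)) \<partial>M)"
          by (intro integral_mono int Bochner_Integration.integrable_add Bochner_Integration.integrable_sum
              integrable_iterate F h cover)
        also have "\<dots> = real n * (\<integral>\<omega>. F K \<omega> \<partial>M) + real (n - (n - K)) * H"
          by (simp add: Bochner_Integration.integral_add Bochner_Integration.integral_sum
              integrable_iterate integral_iterate F h H_def)
        also have "real (n - (n - K)) * H \<le> real K * H" using H by (intro mult_right_mono) auto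
        finally show ?thesis using that by (simp add: field_simps)
      qed
      moreover have "(\<lambda>n. (\<integral>\<omega>. F K \<omega> \<partial>M) + real K * H / real n) \<longlonglongrightarrow> (\<integral>\<omega>. F K \<omega> \<partial>M) + 0"
        by (intro tendsto_intros lim_const_over_n)
      ultimately show ?thesis by (intro LIMSEQ_le_const[where a = \<gamma>]) auto
    qed
    then have "\<gamma> \<le> d" using lim by (intro LIMSEQ_le_const) auto
    then show ?thesis using d by simp
  qed
qed

text \<open>Birkhoff sums are additive, hence subadditive, with expectation exactly n times the
  mean. The matching upper bound will come from the same statement for \<open>- f\<close>.\<close>

lemma birkhoff_lower:
  fixes f :: "'w \<Rightarrow> real"
  assumes f: "integrable M f" and "c < (\<integral>\<omega>. f \<omega> \<partial>M)"
  shows "AE \<omega> in M. \<forall>\<^sub>F n in sequentially. c < (\<Sum>j<n. f ((T ^^ j) \<omega>)) / real n"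
proof -
  have "AE \<omega> in M. \<forall>\<^sub>F n in sequentially. real n * c < (\<Sum>j<n. f ((T ^^ j) \<omega>))"
  proof (rule subadditive_lower[where g = "\<lambda>n \<omega>. \<Sum>j<n. f ((T ^^ j) \<omega>)" and \<gamma> = "\<integral>\<omega>. f \<omega> \<partial>M"])
    fix m n \<omega>
    have "(\<Sum>j<n. f ((T ^^ j) ((T ^^ m) \<omega>))) = (\<Sum>j\<in>{m..<m + n}. f ((T ^^ j) \<omega>))"
      by (rule sum.reindex_bij_witness[of _ "\<lambda>j. j - m" "\<lambda>j. j + m"]) (auto simp: funpow_add)
    then show "(\<Sum>j<m + n. f ((T ^^ j) \<omega>)) \<le> (\<Sum>j<m. f ((T ^^ j) \<omega>)) + (\<Sum>j<n. f ((T ^^ j) ((T ^^ m) \<omega>)))"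
      using sum.union_disjoint[of "{..<m}" "{m..<m + n}" "\<lambda>j. f ((T ^^ j) \<omega>)"]
      by (simp add: ivl_disj_un_one ivl_disj_int_one)
  qed (use assms in \<open>auto simp: integrable_iterate integral_iterate Bochner_Integration.integral_sum\<close>)
  then show ?thesis
  proof eventually_elim
    case (elim \<omega>)
    then show ?case using eventually_gt_at_top[of 0]
      by eventually_elim (simp add: field_simps)
  qed
qed

lemma birkhoff:
  fixes f :: "'w \<Rightarrow> real"
  assumes f: "integrable M f"
  shows "AE \<omega> in M. (\<lambda>n. (\<Sum>j<n. f ((T ^^ j) \<omega>)) / real n) \<longlonglongrightarrow> (\<integral>\<omega>. f \<omega> \<partial>M)"
proof -
  define m where "m = (\<integral>\<omega>. f \<omega> \<partial>M)"
  have "AE \<omega> in M. \<forall>k. \<forall>\<^sub>F n in sequentially. m - 1 / real (Suc k) < (\<Sum>j<n. f ((T ^^ j) \<omega>)) / real n"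
    unfolding AE_all_countable by (intro allI birkhoff_lower f) (simp add: m_def)
  moreover have "AE \<omega> in M. \<forall>k. \<forall>\<^sub>F n in sequentially.
      - m - 1 / real (Suc k) < (\<Sum>j<n. - f ((T ^^ j) \<omega>)) / real n"
    unfolding AE_all_countable using f by (intro allI birkhoff_lower) (auto simp: m_def)
  ultimately show ?thesis unfolding m_def[symmetric]
  proof eventually_elim
    case (elim \<omega>)
    show ?case
    proof (rule order_tendstoI)
      fix c assume "c < m"
      then obtain k where "1 / real (Suc k) < m - c" using nat_approx_posE[of "m - c"] by auto
      then show "\<forall>\<^sub>F n in sequentially. c < (\<Sum>j<n. f ((T ^^ j) \<omega>)) / real n"
        using elim(1)[rule_format, of k] by (auto elim!: eventually_mono)
    next
      fix c assume "m < c"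
      then obtain k where "1 / real (Suc k) < c - m" using nat_approx_posE[of "c - m"] by auto
      then show "\<forall>\<^sub>F n in sequentially. (\<Sum>j<n. f ((T ^^ j) \<omega>)) / real n < c"
        using elim(2)[rule_format, of k] by (auto elim!: eventually_mono simp: sum_negf)
    qed
  qed
qed

end

text \<open>Both \<open>s (n + N)\<close> and \<open>s n\<close>, divided by n + N, tend to
  \<open>l\<close>. This disposes of single orbit terms and of boundary windows of fixed length
  \<open>N\<close>.\<close>

lemma averages_increment_tendsto_0:
  fixes s :: "nat \<Rightarrow> real"
  assumes "(\<lambda>n. s n / real n) \<longlonglongrightarrow> l"
  shows "(\<lambda>n. (s (n + N) - s n) / real (n + N)) \<longlonglongrightarrow> 0"
proof -
  have "(\<lambda>n. real n / real (n + N)) \<longlonglongrightarrow> 1"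
  proof -
    have "(\<lambda>n. 1 - real N / real (n + N)) \<longlonglongrightarrow> 1 - 0"
      by (intro tendsto_intros LIMSEQ_ignore_initial_segment lim_const_over_n)
    moreover have "\<forall>\<^sub>F n in sequentially. 1 - real N / real (n + N) = real n / real (n + N)"
      using eventually_gt_at_top[of 0] by eventually_elim (simp add: field_simps)
    ultimately show ?thesis by (auto intro: Lim_transform_eventually)
  qed
  then have "(\<lambda>n. s (n + N) / real (n + N) - s n / real n * (real n / real (n + N))) \<longlonglongrightarrow> l - l * 1"
    using assms by (intro tendsto_intros LIMSEQ_ignore_initial_segment)
  moreover have "\<forall>\<^sub>F n in sequentially. s (n + N) / real (n + N) - s n / real n * (real n / real (n + N))
      = (s (n + N) - s n) / real (n + N)"
    using eventually_gt_at_top[of 0] by eventually_elim (simp add: diff_divide_distrib)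
  ultimately show ?thesis by (auto intro: Lim_transform_eventually)
qed

context invertible_ergodic
begin

lemma tempered:
  fixes f :: "'w \<Rightarrow> real"
  assumes f: "integrable M f"
  shows "AE \<omega> in M. (\<lambda>n. f ((T ^^ n) \<omega>) / real (n + 1)) \<longlonglongrightarrow> 0"
  using birkhoff[OF f]
proof eventually_elim
  case (elim \<omega>)
  from averages_increment_tendsto_0[OF this, of 1] show ?case by simp
qed

text \<open>Cutting the orbit segment into blocks of length \<open>N\<close>, starting at each of the \<open>N\<close> possible offsets,
  and averaging over the offset; this avoids the (possibly non-ergodic) map \<open>T\<^sup>N\<close>.\<close>

lemma subadditive_average:
  assumes sub: "\<And>m n \<omega>. \<omega> \<in> space M \<Longrightarrow> g (m + n) \<omega> \<le> g m \<omega> + g n ((T ^^ m) \<omega>)"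
    and g0: "g 0 = (\<lambda>_. 0 :: real)" and nonneg: "\<And>n \<omega>. \<omega> \<in> space M \<Longrightarrow> 0 \<le> g n \<omega>"
    and \<omega>: "\<omega> \<in> space M" and N: "N \<ge> 1"
  shows "real N * g (n + N) \<omega> \<le> (\<Sum>j<n + N. g N ((T ^^ j) \<omega>)) + (\<Sum>r<N. g r \<omega>)
           + real N * (\<Sum>j\<in>{n..<n + N}. g 1 ((T ^^ j) \<omega>))"
proof -
  define n' where "n' = n + N"
  define m where "m r = (n' - r) div N" for r
  have nn: "0 \<le> g k ((T ^^ j) \<omega>)" for k j using \<omega> by (intro nonneg iterate_in_space)
  have block: "g (r + k * N) \<omega> \<le> g r \<omega> + (\<Sum>i<k. g N ((T ^^ (r + i * N)) \<omega>))" for r k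
  proof (induction k)
    case (Suc k)
    have "g (r + k * N + N) \<omega> \<le> g (r + k * N) \<omega> + g N ((T ^^ (r + k * N)) \<omega>)" using \<omega> by (rule sub)
    then show ?case using Suc by (simp add: algebra_simps)
  qed simp
  have each: "g n' \<omega> \<le> g r \<omega> + (\<Sum>i<m r. g N ((T ^^ (r + i * N)) \<omega>)) + (\<Sum>j\<in>{n..<n + N}. g 1 ((T ^^ j) \<omega>))"
    if r: "r < N" for r
  proof -
    \<comment> \<open>The piece left over after the last full block has fewer than \<open>N\<close>
      sites and so lies in the last window of length \<open>N\<close>, whatever the offset
      r.\<close>
    define q where "q = (n' - r) mod N"
    have qN: "q < N" using N by (simp add: q_def)
    have eq: "n' = (r + m r * N) + q" using r by (simp add: m_def q_def n'_def)
    have "g n' \<omega> \<le> g (r + m r * N) \<omega> + g q ((T ^^ (r + m r * N)) \<omega>)"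
      by (subst eq) (rule sub[OF \<omega>])
    also have "g q ((T ^^ (r + m r * N)) \<omega>) \<le> (\<Sum>j<q. g 1 ((T ^^ j) ((T ^^ (r + m r * N)) \<omega>)))"
      using \<omega> by (intro subadditive_le_sum sub g0 iterate_in_space)
    also have "\<dots> = (\<Sum>j\<in>{n' - q..<n'}. g 1 ((T ^^ j) \<omega>))"
      by (rule sum.reindex_bij_witness[of _ "\<lambda>j. j - (r + m r * N)" "\<lambda>j. j + (r + m r * N)"])
        (use eq in \<open>auto simp: funpow_add\<close>)
    also have "\<dots> \<le> (\<Sum>j\<in>{n..<n + N}. g 1 ((T ^^ j) \<omega>))"
      using qN nn by (intro sum_mono2) (auto simp: n'_def)
    finally show ?thesis using block[of r "m r"] by linarith
  qed
  have "real N * g n' \<omega> = (\<Sum>r<N. g n' \<omega>)" by simp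
  also have "\<dots> \<le> (\<Sum>r<N. g r \<omega> + (\<Sum>i<m r. g N ((T ^^ (r + i * N)) \<omega>)) + (\<Sum>j\<in>{n..<n + N}. g 1 ((T ^^ j) \<omega>)))"
    by (intro sum_mono each) auto
  also have "\<dots> = (\<Sum>r<N. g r \<omega>) + (\<Sum>r<N. \<Sum>i<m r. g N ((T ^^ (r + i * N)) \<omega>))
      + real N * (\<Sum>j\<in>{n..<n + N}. g 1 ((T ^^ j) \<omega>))"
    by (simp add: sum.distrib)
  also have "(\<Sum>r<N. \<Sum>i<m r. g N ((T ^^ (r + i * N)) \<omega>)) \<le> (\<Sum>j<n'. g N ((T ^^ j) \<omega>))"
  proof -
    \<comment> \<open>Offset and block number determine the starting site r + i N uniquely, by
      division with remainder. Over all offsets each site therefore starts at most one block, and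
      nonnegativity allows the sum to be extended to all sites.\<close>
    define P where "P = (SIGMA r:{..<N}. {..<m r})"
    define \<phi> where "\<phi> = (\<lambda>(r, i). r + i * N)"
    have inj: "inj_on \<phi> P"
    proof (rule inj_onI, clarsimp simp: P_def \<phi>_def)
      fix r i s j assume *: "r < N" "s < N" "r + i * N = s + j * N"
      then have "(r + i * N) mod N = (s + j * N) mod N" by simp
      then have "r = s" using *(1,2) by simp
      then show "r = s \<and> i = j" using * by simp
    qed
    have sub': "\<phi> ` P \<subseteq> {..<n'}"
    proof (clarsimp simp: P_def \<phi>_def)
      fix r i assume *: "r < N" "i < m r"
      have "m r * N \<le> n' - r" by (simp add: m_def)
      moreover have "Suc i * N \<le> m r * N" using * by (intro mult_right_mono) auto
      ultimately have "i * N + N \<le> n' - r" by simp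
      then show "r + i * N < n'" using * N by linarith
    qed
    have "(\<Sum>r<N. \<Sum>i<m r. g N ((T ^^ (r + i * N)) \<omega>)) = (\<Sum>p\<in>P. g N ((T ^^ \<phi> p) \<omega>))"
      unfolding P_def \<phi>_def by (subst sum.Sigma) (auto simp: case_prod_beta)
    also have "\<dots> = (\<Sum>j\<in>\<phi> ` P. g N ((T ^^ j) \<omega>))" by (simp add: sum.reindex[OF inj])
    also have "\<dots> \<le> (\<Sum>j<n'. g N ((T ^^ j) \<omega>))" using sub' nn by (intro sum_mono2) auto
    finally show ?thesis .
  qed
  finally show ?thesis by (simp add: n'_def)
qed

text \<open>Divided by n + N, the averaged block estimate tends to the integral of
  \<open>g N\<close> by Birkhoff's theorem: the fixed sum over r and the last window both vanish in
  the limit.\<close>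

lemma subadditive_upper:
  assumes sub: "\<And>m n \<omega>. \<omega> \<in> space M \<Longrightarrow> g (m + n) \<omega> \<le> g m \<omega> + g n ((T ^^ m) \<omega>)"
    and g0: "g 0 = (\<lambda>_. 0 :: real)" and nonneg: "\<And>n \<omega>. \<omega> \<in> space M \<Longrightarrow> 0 \<le> g n \<omega>"
    and int: "\<And>n. integrable M (g n)" and N: "N \<ge> 1" and c: "(\<integral>\<omega>. g N \<omega> \<partial>M) < real N * c"
  shows "AE \<omega> in M. \<forall>\<^sub>F n in sequentially. g n \<omega> / real n < c"
  using birkhoff[OF int[of N]] birkhoff[OF int[of 1]] AE_space
proof eventually_elim
  case (elim \<omega>)
  define s where "s n = (\<Sum>j<n. g 1 ((T ^^ j) \<omega>))" for n
  have s: "(\<Sum>j\<in>{n..<n + N}. g 1 ((T ^^ j) \<omega>)) = s (n + N) - s n" for n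
    using sum.union_disjoint[of "{..<n}" "{n..<n + N}" "\<lambda>j. g 1 ((T ^^ j) \<omega>)"]
    by (simp add: s_def ivl_disj_un_one ivl_disj_int_one)
  have "(\<lambda>n. (\<Sum>j<n + N. g N ((T ^^ j) \<omega>)) / real (n + N) + (\<Sum>r<N. g r \<omega>) / real (n + N)
      + real N * ((s (n + N) - s n) / real (n + N))) \<longlonglongrightarrow> (\<integral>\<omega>. g N \<omega> \<partial>M) + 0 + real N * 0"
    using elim(1) averages_increment_tendsto_0[OF elim(2)]
    by (intro tendsto_add tendsto_mult tendsto_const LIMSEQ_ignore_initial_segment lim_const_over_n)
      (auto simp: s_def)
  then have "\<forall>\<^sub>F n in sequentially. (\<Sum>j<n + N. g N ((T ^^ j) \<omega>)) / real (n + N) + (\<Sum>r<N. g r \<omega>) / real (n + N)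
      + real N * ((s (n + N) - s n) / real (n + N)) < real N * c"
    using c by (intro order_tendstoD(2)) auto
  then have "\<forall>\<^sub>F n in sequentially. g (n + N) \<omega> / real (n + N) < c"
  proof eventually_elim
    case (elim n)
    have "real N * (g (n + N) \<omega> / real (n + N)) = real N * g (n + N) \<omega> / real (n + N)" by simp
    also have "\<dots> \<le> ((\<Sum>j<n + N. g N ((T ^^ j) \<omega>)) + (\<Sum>r<N. g r \<omega>) + real N * (s (n + N) - s n)) / real (n + N)"
      using subadditive_average[OF sub g0 nonneg \<open>\<omega> \<in> space M\<close> N, of n] by (intro divide_right_mono) (auto simp: s simp del: One_nat_def)
    also have "\<dots> < real N * c" using elim by (simp add: add_divide_distrib)
    finally show ?case by (rule mult_left_less_imp_less) simp
  qed
  then show ?case by (rule eventually_sequentially_seg[THEN iffD1])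
qed

theorem subadditive_ergodic:
  assumes sub: "\<And>m n \<omega>. \<omega> \<in> space M \<Longrightarrow> g (m + n) \<omega> \<le> g m \<omega> + g n ((T ^^ m) \<omega>)"
    and g0: "g 0 = (\<lambda>_. 0 :: real)" and nonneg: "\<And>n \<omega>. \<omega> \<in> space M \<Longrightarrow> 0 \<le> g n \<omega>"
    and int: "\<And>n. integrable M (g n)"
  obtains \<gamma> where "(\<lambda>n. (\<integral>\<omega>. g n \<omega> \<partial>M) / real n) \<longlonglongrightarrow> \<gamma>"
    "AE \<omega> in M. (\<lambda>n. g n \<omega> / real n) \<longlonglongrightarrow> \<gamma>"
proof -
  have e_sub: "(\<integral>\<omega>. g (m + n) \<omega> \<partial>M) \<le> (\<integral>\<omega>. g m \<omega> \<partial>M) + (\<integral>\<omega>. g n \<omega> \<partial>M)" for m n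
  proof -
    have "(\<integral>\<omega>. g (m + n) \<omega> \<partial>M) \<le> (\<integral>\<omega>. g m \<omega> + g n ((T ^^ m) \<omega>) \<partial>M)"
      by (intro integral_mono int Bochner_Integration.integrable_add integrable_iterate sub)
    then show ?thesis by (simp add: int integrable_iterate integral_iterate)
  qed
  obtain \<gamma> where \<gamma>: "(\<lambda>n. (\<integral>\<omega>. g n \<omega> \<partial>M) / real n) \<longlonglongrightarrow> \<gamma>" "\<And>n. real n * \<gamma> \<le> (\<integral>\<omega>. g n \<omega> \<partial>M)"
    using fekete[of "\<lambda>n. \<integral>\<omega>. g n \<omega> \<partial>M", OF e_sub] nonneg by (auto intro: Bochner_Integration.integral_nonneg)
  have "AE \<omega> in M. \<forall>k. \<forall>\<^sub>F n in sequentially. real n * (\<gamma> - 1 / real (Suc k)) < g n \<omega>"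
    unfolding AE_all_countable by (intro allI subadditive_lower[OF sub g0 int \<gamma>(2)]) auto
  moreover have "AE \<omega> in M. \<forall>k. \<forall>\<^sub>F n in sequentially. g n \<omega> / real n < \<gamma> + 1 / real (Suc k)"
    unfolding AE_all_countable
  proof
    fix k
    have "\<forall>\<^sub>F n in sequentially. (\<integral>\<omega>. g n \<omega> \<partial>M) / real n < \<gamma> + 1 / real (Suc k)"
      using \<gamma>(1) by (rule order_tendstoD(2)) simp
    then obtain N where N: "N \<ge> 1" "(\<integral>\<omega>. g N \<omega> \<partial>M) / real N < \<gamma> + 1 / real (Suc k)"
      unfolding eventually_sequentially by (metis max.cobounded1 max.cobounded2)
    then show "AE \<omega> in M. \<forall>\<^sub>F n in sequentially. g n \<omega> / real n < \<gamma> + 1 / real (Suc k)"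
      by (intro subadditive_upper[OF sub g0 nonneg int, of N]) (auto simp: field_simps)
  qed
  ultimately have "AE \<omega> in M. (\<lambda>n. g n \<omega> / real n) \<longlonglongrightarrow> \<gamma>"
  proof eventually_elim
    case (elim \<omega>)
    show ?case
    proof (rule order_tendstoI)
      fix c assume "c < \<gamma>"
      then obtain k where k: "1 / real (Suc k) < \<gamma> - c" using nat_approx_posE[of "\<gamma> - c"] by auto
      show "\<forall>\<^sub>F n in sequentially. c < g n \<omega> / real n"
        using elim(1)[rule_format, of k] eventually_gt_at_top[of 0]
      proof eventually_elim
        case (elim n)
        then have "\<gamma> - 1 / real (Suc k) < g n \<omega> / real n" by (simp add: pos_less_divide_eq mult.commute)
        then show ?case using k by linarith
      qed
    next
      fix c assume "\<gamma> < c"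
      then obtain k where "1 / real (Suc k) < c - \<gamma>" using nat_approx_posE[of "c - \<gamma>"] by auto
      then show "\<forall>\<^sub>F n in sequentially. g n \<omega> / real n < c"
        using elim(2)[rule_format, of k] by (auto elim!: eventually_mono)
    qed
  qed
  then show thesis using that \<gamma>(1) by blast
qed

end

section \<open>Stable directions of unimodular cocycles\<close>

lemma norm_vec_sq: "(norm (x :: 'a::real_normed_vector ^ 'n))\<^sup>2 = (\<Sum>i\<in>UNIV. (norm (x $ i))\<^sup>2)"
  by (simp add: norm_vec_def L2_set_def sum_nonneg)

lemma norm_dot_le:
  fixes x y :: "complex ^ 'n"
  shows "(norm (\<Sum>k\<in>UNIV. x $ k * y $ k))\<^sup>2 \<le> (norm x)\<^sup>2 * (norm y)\<^sup>2"
proof -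
  have "norm (\<Sum>k\<in>UNIV. x $ k * y $ k) \<le> (\<Sum>k\<in>UNIV. \<bar>norm (x $ k)\<bar> * \<bar>norm (y $ k)\<bar>)"
    by (rule order_trans[OF norm_sum]) (simp add: norm_mult)
  also have "\<dots> \<le> norm x * norm y"
    unfolding norm_vec_def by (rule L2_set_mult_ineq)
  finally have "(norm (\<Sum>k\<in>UNIV. x $ k * y $ k))\<^sup>2 \<le> (norm x * norm y)\<^sup>2" by (intro power_mono) auto
  then show ?thesis by (simp add: power_mult_distrib)
qed

text \<open>\<open>norm\<close> of a matrix is here the Frobenius norm, so this is Cauchy-Schwarz
  applied to each row.\<close>

lemma norm_matrix_vector_le:
  fixes A :: "complex ^ 'n ^ 'm"
  shows "norm (A *v x) \<le> norm A * norm x"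
proof (rule power2_le_imp_le)
  have "(norm (A *v x))\<^sup>2 = (\<Sum>i\<in>UNIV. (norm (\<Sum>j\<in>UNIV. A $ i $ j * x $ j))\<^sup>2)"
    by (simp add: norm_vec_sq matrix_vector_mult_def)
  also have "\<dots> \<le> (\<Sum>i\<in>UNIV. (norm (A $ i))\<^sup>2 * (norm x)\<^sup>2)"
    by (intro sum_mono norm_dot_le)
  finally have "(norm (A *v x))\<^sup>2 \<le> (\<Sum>i\<in>UNIV. (norm (A $ i))\<^sup>2 * (norm x)\<^sup>2)" .
  then show "(norm (A *v x))\<^sup>2 \<le> (norm A * norm x)\<^sup>2"
    by (simp add: norm_vec_sq[of A] power_mult_distrib sum_distrib_right)
qed simp

lemma norm_matrix_mult_le:
  fixes A :: "complex ^ 'n ^ 'm" and B :: "complex ^ 'k ^ 'n"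
  shows "norm (A ** B) \<le> norm A * norm B"
proof (rule power2_le_imp_le)
  have B: "(\<Sum>j\<in>UNIV. (norm (column j B))\<^sup>2) = (norm B)\<^sup>2"
    unfolding norm_vec_sq column_def vec_lambda_beta by (rule sum.swap)
  have "(norm (A ** B))\<^sup>2 = (\<Sum>i\<in>UNIV. \<Sum>j\<in>UNIV. (norm (\<Sum>k\<in>UNIV. A $ i $ k * column j B $ k))\<^sup>2)"
    unfolding norm_vec_sq matrix_matrix_mult_def column_def by simp
  also have "\<dots> \<le> (\<Sum>i\<in>UNIV. \<Sum>j\<in>UNIV. (norm (A $ i))\<^sup>2 * (norm (column j B))\<^sup>2)"
    by (intro sum_mono norm_dot_le)
  also have "\<dots> = (norm A * norm B)\<^sup>2"
    by (simp add: power_mult_distrib norm_vec_sq[of A] sum_distrib_right B flip: sum_distrib_left)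
  finally show "(norm (A ** B))\<^sup>2 \<le> (norm A * norm B)\<^sup>2" .
qed simp

text \<open>The determinant of the matrix with columns \<open>x\<close> and \<open>y\<close>. For
  unit vectors its modulus is the sine of the angle between the complex lines they span, and serves
  as a distance of directions blind to phases.\<close>

definition wedge :: "complex ^ 2 \<Rightarrow> complex ^ 2 \<Rightarrow> complex" where
  "wedge x y = x $ 1 * y $ 2 - x $ 2 * y $ 1"

lemma norm_complex2_sq: "(norm (x :: complex ^ 2))\<^sup>2 = (cmod (x $ 1))\<^sup>2 + (cmod (x $ 2))\<^sup>2"
  by (simp add: norm_vec_sq sum_2)

lemma norm_matrix2_sq:
  "(norm (A :: complex ^ 2 ^ 2))\<^sup>2 = (cmod (A $ 1 $ 1))\<^sup>2 + (cmod (A $ 1 $ 2))\<^sup>2 + (cmod (A $ 2 $ 1))\<^sup>2 + (cmod (A $ 2 $ 2))\<^sup>2"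
  by (simp add: norm_vec_sq sum_2)

lemma wedge_matrix: "wedge (A *v x) (A *v y) = det A * wedge x y"
  by (simp add: wedge_def det_2 matrix_vector_mult_def sum_2 algebra_simps)

lemma norm_wedge_le: "cmod (wedge x y) \<le> norm x * norm y"
proof -
  have eq: "wedge x y = (\<Sum>k\<in>UNIV. x $ k * vector [y $ 2, - y $ 1] $ k)"
    by (simp add: wedge_def sum_2)
  have "(cmod (wedge x y))\<^sup>2 \<le> (norm x)\<^sup>2 * (norm (vector [y $ 2, - y $ 1] :: complex ^ 2))\<^sup>2"
    unfolding eq by (rule norm_dot_le)
  then have "(cmod (wedge x y))\<^sup>2 \<le> (norm x * norm y)\<^sup>2"
    by (simp add: norm_complex2_sq[of y] norm_complex2_sq[of "vector _"] power_mult_distrib add.commute)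
  then show ?thesis by (rule power2_le_imp_le) simp
qed

text \<open>The linear dependence of three vectors in a plane, as given by Cramer's rule.\<close>

lemma wedge_cycle: "wedge x y *s z + wedge y z *s x + wedge z x *s y = 0"
  by (simp add: vec_eq_iff forall_2 wedge_def algebra_simps)

lemma norm_smult_complex [simp]: "norm (c *s (x :: complex ^ 'n)) = cmod c * norm x"
proof -
  have "(norm (c *s x))\<^sup>2 = (cmod c * norm x)\<^sup>2"
    by (simp add: norm_vec_sq norm_mult power_mult_distrib sum_distrib_left)
  then show ?thesis by (simp add: power2_eq_iff_nonneg)
qed

lemma wedge_triangle:
  assumes "norm x = 1" "norm y = 1" "norm z = 1"
  shows "cmod (wedge x z) \<le> cmod (wedge x y) + cmod (wedge y z)"
proof -
  have "wedge x z *s y = wedge x y *s z + wedge y z *s x"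
    using wedge_cycle[of x y z] by (simp add: vec_eq_iff wedge_def algebra_simps)
  then have "norm (wedge x z *s y) \<le> norm (wedge x y *s z) + norm (wedge y z *s x)"
    by (metis norm_triangle_ineq)
  then show ?thesis using assms by simp
qed

lemma norm_matrix_vector_wedge_le:
  assumes s: "norm s = 1" and v: "norm v = 1"
  shows "norm (A *v v) \<le> norm (A *v s) + norm A * cmod (wedge v s)"
proof -
  \<comment> \<open>The unit vector orthogonal to \<open>s\<close>; the component of
    \<open>v\<close> along \<open>p\<close> has modulus |v \<and> s|.\<close>
  define p :: "complex ^ 2" where "p = vector [- cnj (s $ 2), cnj (s $ 1)]"
  have "(cmod (s $ 1))\<^sup>2 + (cmod (s $ 2))\<^sup>2 = 1" using s norm_complex2_sq[of s] by simp
  then have sp: "wedge s p = 1" and np: "norm p = 1"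
  proof -
    assume *: "(cmod (s $ 1))\<^sup>2 + (cmod (s $ 2))\<^sup>2 = 1"
    then have "complex_of_real ((cmod (s $ 1))\<^sup>2 + (cmod (s $ 2))\<^sup>2) = 1" by simp
    then show "wedge s p = 1"
      unfolding of_real_add complex_norm_square by (simp add: wedge_def p_def)
    have "(norm p)\<^sup>2 = 1" using * by (simp add: norm_complex2_sq p_def)
    then show "norm p = 1" using norm_ge_zero[of p] by (simp add: power2_eq_1_iff)
  qed
  have "v = wedge v p *s s - wedge v s *s p"
  proof -
    have "wedge p v = - wedge v p" by (simp add: wedge_def)
    then have "v - (wedge v p *s s - wedge v s *s p) = 0"
      using wedge_cycle[of s p v] sp by (simp add: algebra_simps)
    then show ?thesis by simp
  qed
  then have "A *v v = wedge v p *s (A *v s) - wedge v s *s (A *v p)"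
    by (metis matrix_vector_mult_diff_distrib vec.scale)
  then have "norm (A *v v) \<le> cmod (wedge v p) * norm (A *v s) + cmod (wedge v s) * norm (A *v p)"
    by (metis norm_triangle_ineq4 norm_smult_complex)
  also have "cmod (wedge v p) * norm (A *v s) \<le> norm (A *v s)"
    using norm_wedge_le[of v p] v np by (simp add: mult_left_le_one_le)
  also have "cmod (wedge v s) * norm (A *v p) \<le> norm A * cmod (wedge v s)"
    using norm_matrix_vector_le[of A p] np by (simp add: mult.commute[of "norm A"] mult_left_mono)
  finally show ?thesis by simp
qed

text \<open>The determinant is bounded by the squared Frobenius norm. Logarithms of norms of such
  products are therefore nonnegative, as the subadditive theorem requires.\<close>

lemma unimodular_norm_ge_1:
  fixes A :: "complex ^ 2 ^ 2"
  assumes "cmod (det A) = 1"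
  shows "1 \<le> norm A"
proof -
  have "1 \<le> cmod (A $ 1 $ 1) * cmod (A $ 2 $ 2) + cmod (A $ 1 $ 2) * cmod (A $ 2 $ 1)"
    using norm_triangle_ineq4[of "A $ 1 $ 1 * A $ 2 $ 2" "A $ 1 $ 2 * A $ 2 $ 1"] assms
    by (simp add: det_2 norm_mult)
  also have "\<dots> \<le> (norm A)\<^sup>2"
    using sum_squares_bound[of "cmod (A $ 1 $ 1)" "cmod (A $ 2 $ 2)"]
      sum_squares_bound[of "cmod (A $ 1 $ 2)" "cmod (A $ 2 $ 1)"]
      mult_nonneg_nonneg[OF norm_ge_zero[of "A $ 1 $ 1"] norm_ge_zero[of "A $ 2 $ 2"]]
      mult_nonneg_nonneg[OF norm_ge_zero[of "A $ 1 $ 2"] norm_ge_zero[of "A $ 2 $ 1"]]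
    unfolding norm_matrix2_sq by linarith
  finally have "1\<^sup>2 \<le> (norm A)\<^sup>2" by simp
  then show ?thesis by (rule power2_le_imp_le) simp
qed

text \<open>\<open>A\<close> maps the columns \<open>w1\<close>, \<open>w2\<close> of its adjugate
  to vectors of norm |det A| = 1, while the adjugate has the Frobenius norm of \<open>A\<close>. The
  longer column, normalised, is contracted; the constant 2 is a convenient bound for the square root
  of 2.\<close>

lemma unimodular_contracted_vector:
  fixes A :: "complex ^ 2 ^ 2"
  assumes "cmod (det A) = 1"
  obtains s where "norm s = 1" "norm (A *v s) \<le> 2 / norm A"
proof -
  define w1 w2 :: "complex ^ 2" where
    "w1 = vector [A $ 2 $ 2, - A $ 2 $ 1]" and "w2 = vector [- A $ 1 $ 2, A $ 1 $ 1]"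
  have pos: "norm A > 0" using unimodular_norm_ge_1[OF assms] by linarith
  have "(norm w1)\<^sup>2 + (norm w2)\<^sup>2 = (norm A)\<^sup>2"
    by (simp add: w1_def w2_def norm_complex2_sq norm_matrix2_sq)
  moreover have "(norm (A *v w1))\<^sup>2 = (cmod (det A))\<^sup>2" "(norm (A *v w2))\<^sup>2 = (cmod (det A))\<^sup>2"
    by (simp_all add: w1_def w2_def norm_complex2_sq matrix_vector_mult_def sum_2 det_2 algebra_simps)
  then have "norm (A *v w1) = 1" "norm (A *v w2) = 1"
    using assms norm_ge_zero[of "A *v w1"] norm_ge_zero[of "A *v w2"]
    by (auto simp: power2_eq_1_iff)
  ultimately obtain w where w: "norm (A *v w) = 1" "(norm A)\<^sup>2 \<le> 2 * (norm w)\<^sup>2"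
    by (metis linear mult_2 add_left_mono add_right_mono)
  have "(norm A)\<^sup>2 \<le> 4 * (norm w)\<^sup>2" using w(2) zero_le_power2[of "norm w"] by linarith
  then have "(norm A / 2)\<^sup>2 \<le> (norm w)\<^sup>2" by (simp add: power_divide)
  then have le: "norm A / 2 \<le> norm w" by (rule power2_le_imp_le) simp
  have wpos: "norm w > 0" using le pos by linarith
  define s where "s = of_real (1 / norm w) *s w"
  have "norm s = 1" using wpos by (simp add: s_def norm_divide)
  moreover have "norm (A *v s) = 1 / norm w"
    unfolding s_def using wpos w(1) by (simp add: vec.scale norm_divide)
  then have "norm (A *v s) \<le> 2 / norm A" using frac_le[of 1 1 "norm A / 2" "norm w"] le pos by simp
  ultimately show thesis by (rule that)
qed

lemma wedge_continuous: "(s \<longlongrightarrow> v) F \<Longrightarrow> ((\<lambda>n. wedge x (s n)) \<longlongrightarrow> wedge x v) F"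
  unfolding wedge_def by (intro tendsto_intros)

text \<open>The lines spanned by the \<open>s n\<close> form a Cauchy sequence, but the unit vectors
  themselves need not converge, their phases being arbitrary. Compactness of the sphere gives a
  cluster point, to which the phase-blind bounds pass.\<close>

lemma limiting_direction:
  fixes s :: "nat \<Rightarrow> complex ^ 2"
  assumes s: "\<And>n. norm (s n) = 1" and step: "\<And>k. k \<ge> n0 \<Longrightarrow> cmod (wedge (s k) (s (Suc k))) \<le> C * q ^ k"
    and q: "0 < q" "q < 1"
  obtains v where "norm v = 1" "\<And>n. n \<ge> n0 \<Longrightarrow> cmod (wedge (s n) v) \<le> C / (1 - q) * q ^ n"
proof -
  have "0 \<le> C * q ^ n0" using step[of n0] norm_ge_zero order_trans by blast
  then have C: "0 \<le> C" using zero_less_power[OF q(1), of n0] by (simp add: zero_le_mult_iff)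
  have part: "cmod (wedge (s n) (s (n + m))) \<le> C / (1 - q) * (q ^ n - q ^ (n + m))" if "n \<ge> n0" for n m
  proof (induction m)
    case (Suc m)
    have "cmod (wedge (s n) (s (n + Suc m))) \<le> cmod (wedge (s n) (s (n + m))) + cmod (wedge (s (n + m)) (s (Suc (n + m))))"
      using wedge_triangle s by simp
    also have "\<dots> \<le> C / (1 - q) * (q ^ n - q ^ (n + m)) + C * q ^ (n + m)"
      using that by (intro add_mono Suc step) auto
    also have "\<dots> = C / (1 - q) * (q ^ n - q ^ (n + Suc m))" using q by (simp add: field_simps)
    finally show ?case .
  qed (simp add: wedge_def)
  have "compact (sphere (0 :: complex ^ 2) 1)" by simp
  then obtain v r where v: "v \<in> sphere 0 1" "strict_mono r" "(s \<circ> r) \<longlonglongrightarrow> v"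
    unfolding compact_def using s by (metis mem_sphere_0)
  have "cmod (wedge (s n) v) \<le> C / (1 - q) * q ^ n" if "n \<ge> n0" for n
  proof (rule LIMSEQ_le_const2)
    show "(\<lambda>k. cmod (wedge (s n) ((s \<circ> r) k))) \<longlonglongrightarrow> cmod (wedge (s n) v)"
      by (intro tendsto_norm wedge_continuous v)
    have "cmod (wedge (s n) ((s \<circ> r) k)) \<le> C / (1 - q) * q ^ n" if "k \<ge> n" for k
    proof -
      have "n \<le> r k" using that v(2) seq_suble order_trans by blast
      then have "cmod (wedge (s n) ((s \<circ> r) k)) \<le> C / (1 - q) * (q ^ n - q ^ r k)"
        using part[OF \<open>n \<ge> n0\<close>, of "r k - n"] by simp
      also have "\<dots> \<le> C / (1 - q) * q ^ n" using q C by (intro mult_left_mono) auto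
      finally show ?thesis .
    qed
    then show "\<exists>N. \<forall>k\<ge>N. cmod (wedge (s n) ((s \<circ> r) k)) \<le> C / (1 - q) * q ^ n" by blast
  qed
  then show thesis using that v(1) by simp
qed

text \<open>The two-dimensional case of the multiplicative ergodic theorem: the nearly contracted directions
  \<open>s\<^sub>n\<close> of the products \<open>A\<^sub>n\<close> converge, since
  \<open>\<bar>s\<^sub>n \<and> s\<^sub>n\<^sub>+\<^sub>1\<bar> = \<bar>A\<^sub>n\<^sub>+\<^sub>1 s\<^sub>n \<and> A\<^sub>n\<^sub>+\<^sub>1 s\<^sub>n\<^sub>+\<^sub>1\<bar> \<le> 4 \<parallel>B\<^sub>n\<parallel> / (\<parallel>A\<^sub>n\<parallel> \<parallel>A\<^sub>n\<^sub>+\<^sub>1\<parallel>)\<close>.\<close>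

lemma stable_direction:
  fixes A B :: "nat \<Rightarrow> complex ^ 2 ^ 2"
  assumes Suc: "\<And>n. A (Suc n) = B n ** A n" and det: "\<And>n. cmod (det (A n)) = 1"
    and growth: "(\<lambda>n. ln (norm (A n)) / real n) \<longlonglongrightarrow> \<gamma>" and "\<gamma> > 0"
    and temp: "(\<lambda>n. ln (norm (B n)) / real (n + 1)) \<longlonglongrightarrow> 0"
  obtains v where "v \<noteq> 0" "summable (\<lambda>n. (norm (A n *v v))\<^sup>2)"
proof -
  \<comment> \<open>Rates in units of \<gamma>/8: the norm of A_n lies between exp(7\<eta>n) and
    exp(9\<eta>n), and that of B_n is below exp(\<eta>(n+1)). Consecutive directions then differ by
    order exp((1 - 7 - 7)\<eta>n), and multiplying by the norm of A_n leaves exp((9 -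
    13)\<eta>n).\<close>
  define \<eta> where "\<eta> = \<gamma> / 8"
  have \<eta>: "\<eta> > 0" "\<gamma> = 8 * \<eta>" using \<open>\<gamma> > 0\<close> by (auto simp: \<eta>_def)
  have Apos: "norm (A n) > 0" for n using unimodular_norm_ge_1[OF det[of n]] by linarith
  have "\<forall>\<^sub>F n in sequentially. 7 * \<eta> < ln (norm (A n)) / real n"
    "\<forall>\<^sub>F n in sequentially. ln (norm (A n)) / real n < 9 * \<eta>"
    using \<eta> by (auto intro!: order_tendstoD(1)[OF growth] order_tendstoD(2)[OF growth])
  moreover have "\<forall>\<^sub>F n in sequentially. ln (norm (B n)) / real (n + 1) < \<eta>"
    by (rule order_tendstoD(2)[OF temp \<eta>(1)])
  ultimately have "\<forall>\<^sub>F n in sequentially. exp (7 * \<eta> * real n) \<le> norm (A n) \<and> norm (A n) \<le> exp (9 * \<eta> * real n)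
      \<and> norm (B n) \<le> exp (\<eta> * real (n + 1))"
    using eventually_gt_at_top[of 0]
  proof eventually_elim
    case (elim n)
    have "7 * \<eta> * real n \<le> ln (norm (A n))" "ln (norm (A n)) \<le> 9 * \<eta> * real n"
      using elim by (auto simp: field_simps)
    then have "exp (7 * \<eta> * real n) \<le> norm (A n)" "norm (A n) \<le> exp (9 * \<eta> * real n)"
      using Apos[of n] by (metis exp_le_cancel_iff exp_ln)+
    moreover have "norm (B n) \<le> exp (\<eta> * real (n + 1))"
    \<comment> \<open>With \<open>ln 0 = 0\<close> the logarithmic bound says nothing about a zero
      matrix, for which the claim is trivial.\<close>
    proof (cases "norm (B n) = 0")
      case False
      then have "norm (B n) = exp (ln (norm (B n)))" by simp
      also have "\<dots> \<le> exp (\<eta> * real (n + 1))" using elim by (simp add: field_simps)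
      finally show ?thesis .
    qed simp
    ultimately show ?case by blast
  qed
  then obtain n0 where n0: "\<And>n. n \<ge> n0 \<Longrightarrow> exp (7 * \<eta> * real n) \<le> norm (A n)"
    "\<And>n. n \<ge> n0 \<Longrightarrow> norm (A n) \<le> exp (9 * \<eta> * real n)"
    "\<And>n. n \<ge> n0 \<Longrightarrow> norm (B n) \<le> exp (\<eta> * real (n + 1))"
    unfolding eventually_sequentially by blast
  have "\<exists>s. norm s = 1 \<and> norm (A n *v s) \<le> 2 / norm (A n)" for n
    using unimodular_contracted_vector[OF det[of n]] by metis
  then obtain s where s: "\<And>n. norm (s n) = 1" "\<And>n. norm (A n *v s n) \<le> 2 / norm (A n)" by metis
  have inv: "2 / norm (A n) \<le> 2 * exp (- 7 * \<eta> * real n)" if "n \<ge> n0" for n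
    using n0(1)[OF that] Apos[of n] by (simp add: exp_minus field_simps)
  define q where "q = exp (- 13 * \<eta>)"
  have q: "0 < q" "q < 1" "q ^ n = exp (- 13 * \<eta> * real n)" for n
    using \<eta> by (auto simp: q_def mult.commute simp flip: exp_of_nat_mult)
  have "cmod (wedge (s k) (s (Suc k))) \<le> 4 * q ^ k" if k: "k \<ge> n0" for k
  proof -
    have "cmod (wedge (s k) (s (Suc k))) = cmod (wedge (A (Suc k) *v s k) (A (Suc k) *v s (Suc k)))"
      by (simp add: wedge_matrix norm_mult det)
    also have "\<dots> \<le> norm (B k *v (A k *v s k)) * norm (A (Suc k) *v s (Suc k))"
      unfolding Suc[of k] by (simp add: norm_wedge_le flip: matrix_vector_mul_assoc)
    also have "\<dots> \<le> (norm (B k) * norm (A k *v s k)) * norm (A (Suc k) *v s (Suc k))"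
      by (intro mult_right_mono norm_matrix_vector_le) auto
    also have "\<dots> \<le> (exp (\<eta> * real (k + 1)) * (2 * exp (- 7 * \<eta> * real k))) * (2 * exp (- 7 * \<eta> * real (Suc k)))"
      using k by (intro mult_mono n0 order_trans[OF s(2) inv]) auto
    also have "\<dots> = 4 * exp (- 13 * \<eta> * real k - 6 * \<eta>)"
      by (simp add: algebra_simps flip: exp_add)
    also have "\<dots> \<le> 4 * q ^ k" using \<eta> by (simp add: q)
    finally show ?thesis .
  qed
  from limiting_direction[OF s(1) this q(1,2)] obtain v where
    v: "norm v = 1" "\<And>n. n \<ge> n0 \<Longrightarrow> cmod (wedge (s n) v) \<le> 4 / (1 - q) * q ^ n" by blast
  define C where "C = 2 + 4 / (1 - q)"
  have "norm (A n *v v) \<le> C * exp (- 4 * \<eta> * real n)" if n: "n \<ge> n0" for n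
  proof -
    have "norm (A n *v v) \<le> norm (A n *v s n) + norm (A n) * cmod (wedge v (s n))"
      by (rule norm_matrix_vector_wedge_le) (use s v in auto)
    also have "cmod (wedge v (s n)) = cmod (wedge (s n) v)"
      by (metis minus_diff_eq norm_minus_cancel wedge_def mult.commute)
    also have "norm (A n *v s n) + norm (A n) * cmod (wedge (s n) v)
        \<le> 2 * exp (- 7 * \<eta> * real n) + exp (9 * \<eta> * real n) * (4 / (1 - q) * q ^ n)"
      using n by (intro add_mono mult_mono n0 v order_trans[OF s(2) inv]) auto
    also have "\<dots> = 2 * exp (- 7 * \<eta> * real n) + 4 / (1 - q) * exp (- 4 * \<eta> * real n)"
      unfolding q by (simp flip: exp_add)
    also have "\<dots> \<le> 2 * exp (- 4 * \<eta> * real n) + 4 / (1 - q) * exp (- 4 * \<eta> * real n)"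
      using \<eta> by (intro add_right_mono mult_left_mono) auto
    finally show ?thesis by (simp add: C_def algebra_simps)
  qed
  then have bound: "(norm (A n *v v))\<^sup>2 \<le> C\<^sup>2 * exp (- 8 * \<eta>) ^ n" if "n \<ge> n0" for n
  proof -
    have "(norm (A n *v v))\<^sup>2 \<le> (C * exp (- 4 * \<eta> * real n))\<^sup>2"
      using \<open>\<And>n. n \<ge> n0 \<Longrightarrow> norm (A n *v v) \<le> C * exp (- 4 * \<eta> * real n)\<close>[OF that] by (intro power_mono) auto
    also have "\<dots> = C\<^sup>2 * exp (- 8 * \<eta>) ^ n"
      by (simp add: power_mult_distrib power2_eq_square mult.commute flip: exp_of_nat_mult exp_add)
    finally show ?thesis .
  qed
  have "summable (\<lambda>n. C\<^sup>2 * exp (- 8 * \<eta>) ^ n)"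
    using \<eta> by (intro summable_mult summable_geometric) auto
  then have "summable (\<lambda>n. (norm (A n *v v))\<^sup>2)"
    by (rule summable_comparison_test') (use bound in auto)
  moreover have "v \<noteq> 0" using v(1) by auto
  ultimately show thesis by (rule that[rotated])
qed

section \<open>Matrix cocycles over the ergodic map\<close>

lemma continuous_on_matrix_mult:
  "continuous_on UNIV (\<lambda>p :: (complex^2^2) \<times> (complex^2^2). fst p ** snd p)"
  unfolding matrix_matrix_mult_def by (intro continuous_intros)

lemma borel_measurable_matrix_mult [measurable]:
  fixes A B :: "'a \<Rightarrow> complex^2^2"
  assumes "A \<in> borel_measurable M" "B \<in> borel_measurable M"
  shows "(\<lambda>x. A x ** B x) \<in> borel_measurable M"
  using borel_measurable_continuous_Pair[OF assms, of "(**)"] continuous_on_matrix_mult by simp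

primrec cocycle :: "('w \<Rightarrow> 'w) \<Rightarrow> ('w \<Rightarrow> complex^2^2) \<Rightarrow> nat \<Rightarrow> 'w \<Rightarrow> complex^2^2" where
  "cocycle T B 0 \<omega> = mat 1"
| "cocycle T B (Suc n) \<omega> = B ((T ^^ n) \<omega>) ** cocycle T B n \<omega>"

lemma cocycle_add: "cocycle T B (m + n) \<omega> = cocycle T B n ((T ^^ m) \<omega>) ** cocycle T B m \<omega>"
  by (induction n) (simp_all add: matrix_mul_assoc funpow_add add.commute[of m])

context invertible_ergodic
begin

context
  fixes B :: "'w \<Rightarrow> complex^2^2"
  assumes B [measurable]: "B \<in> borel_measurable M"
    and det: "\<And>\<omega>. \<omega> \<in> space M \<Longrightarrow> cmod (det (B \<omega>)) = 1"
    and int: "integrable M (\<lambda>\<omega>. ln (norm (B \<omega>)))"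
begin

lemma cocycle_det: "\<omega> \<in> space M \<Longrightarrow> cmod (det (cocycle T B n \<omega>)) = 1"
  by (induction n) (auto simp: det_mul norm_mult det iterate_in_space)

lemma cocycle_measurable [measurable]: "cocycle T B n \<in> borel_measurable M"
proof (induction n)
  case (Suc n)
  then have "(\<lambda>\<omega>. B ((T ^^ n) \<omega>) ** cocycle T B n \<omega>) \<in> borel_measurable M"
    by (intro borel_measurable_matrix_mult measurable_compose[OF measurable_iterate] B)
  then show ?case by simp
qed simp

lemma cocycle_norm_ge_1: "\<omega> \<in> space M \<Longrightarrow> 1 \<le> norm (cocycle T B n \<omega>)"
  by (intro unimodular_norm_ge_1 cocycle_det)

lemma log_cocycle_growth:
  obtains \<gamma> where "(\<lambda>n. (\<integral>\<omega>. ln (norm (cocycle T B n \<omega>)) \<partial>M) / real n) \<longlonglongrightarrow> \<gamma>"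
    "AE \<omega> in M. (\<lambda>n. ln (norm (cocycle T B n \<omega>)) / real n) \<longlonglongrightarrow> \<gamma>"
    "\<And>n. integrable M (\<lambda>\<omega>. ln (norm (cocycle T B n \<omega>)))"
proof -
  \<comment> \<open>The value at 0 is set by hand: the Frobenius norm of the identity is the square
    root of 2, while the subadditive theorem asks for \<open>g 0 = 0\<close>.\<close>
  define g where "g n \<omega> = (if n = 0 then 0 else ln (norm (cocycle T B n \<omega>)))" for n \<omega>
  have ge1: "1 \<le> norm (cocycle T B n \<omega>)" if "\<omega> \<in> space M" for n \<omega>
    using that by (rule cocycle_norm_ge_1)
  have nonneg: "0 \<le> g n \<omega>" if "\<omega> \<in> space M" for n \<omega> using ge1[OF that, of n] by (simp add: g_def)
  have sub: "g (m + n) \<omega> \<le> g m \<omega> + g n ((T ^^ m) \<omega>)" if \<omega>: "\<omega> \<in> space M" for m n \<omega>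
  proof (cases "m = 0 \<or> n = 0")
    case False
    have ge: "1 \<le> norm (cocycle T B m \<omega>)" "1 \<le> norm (cocycle T B n ((T ^^ m) \<omega>))" "1 \<le> norm (cocycle T B (m + n) \<omega>)"
      using \<omega> by (auto intro!: ge1 iterate_in_space)
    then have "ln (norm (cocycle T B (m + n) \<omega>)) \<le> ln (norm (cocycle T B n ((T ^^ m) \<omega>)) * norm (cocycle T B m \<omega>))"
      unfolding cocycle_add
      by (intro ln_le_cancel_iff[THEN iffD2] mult_pos_pos norm_matrix_mult_le)
        (use ge in \<open>auto simp only: cocycle_add intro: less_le_trans[OF zero_less_one]\<close>)
    also have "\<dots> = ln (norm (cocycle T B n ((T ^^ m) \<omega>))) + ln (norm (cocycle T B m \<omega>))"
    proof (rule ln_mult_pos)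
      show "norm (cocycle T B n ((T ^^ m) \<omega>)) > 0" "norm (cocycle T B m \<omega>) > 0"
        using ge by linarith+
    qed
    finally show ?thesis using False by (simp add: g_def)
  qed (auto simp: g_def)
  have g0: "g 0 = (\<lambda>_. 0)" by (simp add: g_def fun_eq_iff)
  have "g 1 = (\<lambda>\<omega>. ln (norm (B \<omega>)))" by (simp add: g_def fun_eq_iff)
  then have g1: "integrable M (g 1)" using int by simp
  have meas: "g n \<in> borel_measurable M" for n unfolding g_def by measurable
  have gint: "integrable M (g n)" for n
  \<comment> \<open>Nonnegativity from below and the sum of one-step logarithms from above enclose
    \<open>g n\<close> between integrable functions.\<close>
  proof (rule Bochner_Integration.integrable_bound)
    show "integrable M (\<lambda>\<omega>. \<Sum>j<n. g 1 ((T ^^ j) \<omega>))"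
      by (intro Bochner_Integration.integrable_sum integrable_iterate g1)
    show "AE \<omega> in M. norm (g n \<omega>) \<le> norm (\<Sum>j<n. g 1 ((T ^^ j) \<omega>))"
      using AE_space
    proof eventually_elim
      case (elim \<omega>)
      have "g n \<omega> \<le> (\<Sum>j<n. g 1 ((T ^^ j) \<omega>))" by (rule subadditive_le_sum[OF sub g0 elim])
      then show ?case using nonneg[OF elim, of n] unfolding real_norm_def by linarith
    qed
  qed (rule meas)
  obtain \<gamma> where \<gamma>: "(\<lambda>n. (\<integral>\<omega>. g n \<omega> \<partial>M) / real n) \<longlonglongrightarrow> \<gamma>" "AE \<omega> in M. (\<lambda>n. g n \<omega> / real n) \<longlonglongrightarrow> \<gamma>"
    using subadditive_ergodic[OF sub g0 nonneg gint] by blast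
  have ev: "\<forall>\<^sub>F n in sequentially. g n = (\<lambda>\<omega>. ln (norm (cocycle T B n \<omega>)))"
    using eventually_gt_at_top[of 0] by eventually_elim (simp add: g_def fun_eq_iff)
  show thesis
  proof (rule that)
    show "(\<lambda>n. (\<integral>\<omega>. ln (norm (cocycle T B n \<omega>)) \<partial>M) / real n) \<longlonglongrightarrow> \<gamma>"
      using \<gamma>(1) by (rule Lim_transform_eventually) (use ev in eventually_elim, simp)
    show "AE \<omega> in M. (\<lambda>n. ln (norm (cocycle T B n \<omega>)) / real n) \<longlonglongrightarrow> \<gamma>"
      using \<gamma>(2)
    proof eventually_elim
      case (elim \<omega>)
      then show ?case by (rule Lim_transform_eventually) (use ev in eventually_elim, simp)
    qed
    show "integrable M (\<lambda>\<omega>. ln (norm (cocycle T B n \<omega>)))" for n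
    proof (cases "n = 0")
      case False
      then have "g n = (\<lambda>\<omega>. ln (norm (cocycle T B n \<omega>)))" by (simp add: g_def fun_eq_iff)
      then show ?thesis using gint[of n] by simp
    qed simp
  qed
qed

theorem stable_vector:
  assumes "(\<lambda>n. (\<integral>\<omega>. ln (norm (cocycle T B n \<omega>)) \<partial>M) / real n) \<longlonglongrightarrow> \<gamma>" "\<gamma> > 0"
  shows "AE \<omega> in M. \<exists>v. v \<noteq> 0 \<and> summable (\<lambda>n. (norm (cocycle T B n \<omega> *v v))\<^sup>2)"
proof -
  have "AE \<omega> in M. (\<lambda>n. ln (norm (cocycle T B n \<omega>)) / real n) \<longlonglongrightarrow> \<gamma>"
  proof (rule log_cocycle_growth)
    fix \<gamma>'
    assume "(\<lambda>n. (\<integral>\<omega>. ln (norm (cocycle T B n \<omega>)) \<partial>M) / real n) \<longlonglongrightarrow> \<gamma>'"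
      and ae: "AE \<omega> in M. (\<lambda>n. ln (norm (cocycle T B n \<omega>)) / real n) \<longlonglongrightarrow> \<gamma>'"
    then have "\<gamma> = \<gamma>'" using LIMSEQ_unique[OF assms(1)] by blast
    then show ?thesis using ae by simp
  qed
  then show ?thesis using tempered[OF int] AE_space
  proof eventually_elim
    case (elim \<omega>)
    obtain v where "v \<noteq> 0" "summable (\<lambda>n. (norm (cocycle T B n \<omega> *v v))\<^sup>2)"
      by (rule stable_direction[of "\<lambda>n. cocycle T B n \<omega>" "\<lambda>n. B ((T ^^ n) \<omega>)" \<gamma>])
        (use elim assms(2) in \<open>auto simp: cocycle_det\<close>)
    then show ?case by blast
  qed
qed

end

end

section \<open>Transfer matrices of an ergodic family\<close>

context invertible_ergodic
begin

abbreviation S :: "'w \<Rightarrow> 'w" where "S \<equiv> the_inv_into (space M) T"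

lemma S_in_space: "\<omega> \<in> space M \<Longrightarrow> S \<omega> \<in> space M"
  using measurable_inv_T by (rule measurable_space)

lemma T_S: "\<omega> \<in> space M \<Longrightarrow> T (S \<omega>) = \<omega>"
  using bij by (intro f_the_inv_into_f) (auto simp: bij_betw_def)

lemma S_T: "\<omega> \<in> space M \<Longrightarrow> S (T \<omega>) = \<omega>"
  using bij by (intro the_inv_into_f_f) (auto simp: bij_betw_def)

text \<open>Gives every result on cocycles over \<open>T\<close> also for \<open>S\<close>, which
  governs solutions on the left half-line.\<close>

lemma inverse_ergodic: "invertible_ergodic M S"
proof
  show bS: "bij_betw S (space M) (space M)" using bij by (rule bij_betw_the_inv_into)
  show "S \<in> measurable M M" by (rule measurable_inv_T)
  have "the_inv_into (space M) S \<omega> = T \<omega>" if "\<omega> \<in> space M" for \<omega>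
    using that bS bij by (intro the_inv_into_f_eq) (auto simp: bij_betw_def S_T T_in_space)
  then show "the_inv_into (space M) S \<in> measurable M M"
    using measurable_T by (simp cong: measurable_cong)
  have "distr M M S = distr (distr M M T) M S" by (simp add: preserving)
  also have "\<dots> = distr M M (S \<circ> T)" by (rule distr_distr[OF measurable_inv_T measurable_T])
  also have "\<dots> = distr M M (\<lambda>\<omega>. \<omega>)" by (intro distr_cong) (auto simp: S_T)
  finally show "distr M M S = M" by (simp add: distr_id2)
  fix A assume A: "A \<in> events" "S -` A \<inter> space M = A"
  have "T -` A \<inter> space M = A"
  proof (intro equalityI subsetI)
    fix \<omega> assume "\<omega> \<in> T -` A \<inter> space M"
    then have "T \<omega> \<in> S -` A \<inter> space M" "\<omega> \<in> space M" using A(2) by auto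
    then show "\<omega> \<in> A" by (simp add: S_T)
  next
    fix \<omega> assume \<omega>: "\<omega> \<in> A"
    then have "\<omega> \<in> space M" using A(1) sets.sets_into_space by blast
    then have "T \<omega> \<in> S -` A \<inter> space M" using \<omega> by (simp add: S_T T_in_space)
    then show "\<omega> \<in> T -` A \<inter> space M" using A(2) \<open>\<omega> \<in> space M\<close> by blast
  qed
  with A(1) show "prob A = 0 \<or> prob A = 1" by (rule ergodic)
qed

lemmas inverse_iterate_in_space = invertible_ergodic.iterate_in_space[OF inverse_ergodic]
  and inverse_measurable_iterate [measurable] = invertible_ergodic.measurable_iterate[OF inverse_ergodic]
  and inverse_integrable_iterate = invertible_ergodic.integrable_iterate[OF inverse_ergodic]
  and inverse_integral_iterate = invertible_ergodic.integral_iterate[OF inverse_ergodic]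
  and inverse_AE_iterate = invertible_ergodic.AE_iterate[OF inverse_ergodic]
  and inverse_stable_vector = invertible_ergodic.stable_vector[OF inverse_ergodic]

end

text \<open>The energy-zero transfer matrix in the variables (u_n, cnj a_{n-1} u_{n-1}); its
  determinant cnj \<alpha> / \<alpha> has modulus 1. The value \<open>mat 1\<close> at \<alpha> = 0
  keeps this true at every point.\<close>

definition step_matrix :: "complex \<Rightarrow> real \<Rightarrow> complex^2^2" where
  "step_matrix \<alpha> \<beta> = (if \<alpha> = 0 then mat 1
     else vector [vector [- of_real \<beta> / \<alpha>, - 1 / \<alpha>], vector [cnj \<alpha>, 0]])"

definition back_matrix :: "complex \<Rightarrow> real \<Rightarrow> complex^2^2" where
  "back_matrix \<alpha> \<beta> = (if \<alpha> = 0 then mat 1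
     else vector [vector [0, 1 / cnj \<alpha>], vector [- \<alpha>, - of_real \<beta> / cnj \<alpha>]])"

lemma back_step_matrix: "back_matrix \<alpha> \<beta> ** step_matrix \<alpha> \<beta> = mat 1"
  and step_back_matrix: "step_matrix \<alpha> \<beta> ** back_matrix \<alpha> \<beta> = mat 1"
  by (auto simp: step_matrix_def back_matrix_def vec_eq_iff forall_2 matrix_matrix_mult_def sum_2 mat_def)

lemma det_step_matrix: "cmod (det (step_matrix \<alpha> \<beta>)) = 1"
  and det_back_matrix: "cmod (det (back_matrix \<alpha> \<beta>)) = 1"
  by (auto simp: step_matrix_def back_matrix_def det_2 norm_mult norm_divide mat_def)

lemma norm_step_matrix_le:
  assumes "\<alpha> \<noteq> 0" "cmod \<alpha> \<le> K" "\<bar>\<beta>\<bar> \<le> K"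
  shows "norm (step_matrix \<alpha> \<beta>) \<le> (1 + K + K\<^sup>2) / cmod \<alpha>"
proof (rule power2_le_imp_le)
  have K: "0 \<le> K" using assms(2) norm_ge_zero order_trans by blast
  then show "0 \<le> (1 + K + K\<^sup>2) / cmod \<alpha>" by simp
  have "(norm (step_matrix \<alpha> \<beta>))\<^sup>2 = (\<bar>\<beta>\<bar>\<^sup>2 + 1 + ((cmod \<alpha>)\<^sup>2)\<^sup>2) / (cmod \<alpha>)\<^sup>2"
    using assms(1) unfolding norm_matrix2_sq
    by (simp add: step_matrix_def norm_divide field_simps power2_eq_square)
  also have "\<dots> \<le> (K\<^sup>2 + 1 + (K\<^sup>2)\<^sup>2) / (cmod \<alpha>)\<^sup>2"
    using assms by (intro divide_right_mono add_mono power_mono) auto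
  also have "\<dots> \<le> (1 + K + K\<^sup>2)\<^sup>2 / (cmod \<alpha>)\<^sup>2"
    using K by (intro divide_right_mono) (auto simp: power2_eq_square algebra_simps)
  finally show "(norm (step_matrix \<alpha> \<beta>))\<^sup>2 \<le> ((1 + K + K\<^sup>2) / cmod \<alpha>)\<^sup>2"
    by (simp add: power_divide)
qed

text \<open>In dimension two the inverse is the adjugate divided by the determinant, and the
  adjugate permutes the entries up to sign.\<close>

lemma unimodular_inverse_norm:
  fixes A B :: "complex^2^2"
  assumes AB: "A ** B = mat 1" and det: "cmod (det B) = 1"
  shows "norm A = norm B"
proof -
  define J :: "complex^2^2" where "J = vector [vector [B $ 2 $ 2, - B $ 1 $ 2], vector [- B $ 2 $ 1, B $ 1 $ 1]]"
  have "B ** J = mat (det B)"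
    by (simp add: J_def vec_eq_iff forall_2 matrix_matrix_mult_def sum_2 mat_def det_2 algebra_simps)
  then have "A ** mat (det B) = J" by (metis AB matrix_mul_assoc matrix_mul_lid)
  moreover have "(norm (A ** mat (det B)))\<^sup>2 = (cmod (det B))\<^sup>2 * (norm A)\<^sup>2"
    by (simp add: norm_matrix2_sq matrix_matrix_mult_def sum_2 mat_def norm_mult power_mult_distrib algebra_simps)
  ultimately have "(norm J)\<^sup>2 = (norm A)\<^sup>2" using det by simp
  moreover have "(norm J)\<^sup>2 = (norm B)\<^sup>2" by (simp add: norm_matrix2_sq J_def)
  ultimately show ?thesis by (simp add: power2_eq_iff_nonneg)
qed

section \<open>Measurability of matrix-valued maps; operator norm against Frobenius norm\<close>

lemma borel_measurable_cnj [measurable]: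
  "f \<in> borel_measurable M \<Longrightarrow> (\<lambda>x. cnj (f x)) \<in> borel_measurable M"
  by (rule borel_measurable_continuous_on[where f = cnj]) (intro continuous_intros)

lemma borel_measurable_matrix2 [measurable]:
  fixes f g h k :: "'a \<Rightarrow> complex"
  assumes [measurable]: "f \<in> borel_measurable M" "g \<in> borel_measurable M" "h \<in> borel_measurable M" "k \<in> borel_measurable M"
  shows "(\<lambda>x. vector [vector [f x, g x], vector [h x, k x]] :: complex^2^2) \<in> borel_measurable M"
proof (subst borel_measurable_euclidean_space, rule ballI)
  fix B :: "complex^2^2" assume "B \<in> Basis"
  then obtain i j u where B: "B = axis i (axis j u)" by (auto simp: Basis_vec_def)
  show "(\<lambda>x. (vector [vector [f x, g x], vector [h x, k x]] :: complex^2^2) \<bullet> B) \<in> borel_measurable M"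
    unfolding B inner_axis
    using exhaust_2[of i] exhaust_2[of j] by (elim disjE) simp_all
qed

lemma continuous_on_onorm_matrix: "continuous_on UNIV (\<lambda>A :: complex^2^2. onorm ((*v) A))"
proof -
  have le: "onorm ((*v) A) \<le> onorm ((*v) B) + dist A B" for A B :: "complex^2^2"
  proof -
    have "(*v) A = (\<lambda>x. B *v x + (A - B) *v x)"
      by (simp add: fun_eq_iff matrix_vector_mult_diff_rdistrib)
    then have "onorm ((*v) A) \<le> onorm ((*v) B) + onorm ((*v) (A - B))"
      by (metis onorm_triangle matrix_vector_mul_bounded_linear)
    also have "onorm ((*v) (A - B)) \<le> norm (A - B)"
      by (rule onorm_bound) (auto simp: norm_matrix_vector_le)
    finally show ?thesis by (simp add: dist_norm)
  qed
  have "dist (onorm ((*v) A)) (onorm ((*v) B)) \<le> dist A B" for A B :: "complex^2^2"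
    using le[of A B] le[of B A] by (simp add: dist_real_def dist_commute abs_le_iff)
  then show ?thesis unfolding continuous_on_iff by (meson le_less_trans)
qed

lemma onorm_matrix_bounds:
  fixes A :: "complex^2^2"
  shows "onorm ((*v) A) \<le> norm A" "norm A \<le> 2 * onorm ((*v) A)"
proof -
  show "onorm ((*v) A) \<le> norm A"
    by (rule onorm_bound) (auto simp: norm_matrix_vector_le)
  have nonneg: "0 \<le> onorm ((*v) A)" by (rule onorm_pos_le) simp
  have col: "norm (A *v axis i 1) \<le> onorm ((*v) A)" for i
    using onorm[OF matrix_vector_mul_bounded_linear, of A "axis i 1"] by simp
  have "(norm A)\<^sup>2 = (norm (A *v axis 1 1))\<^sup>2 + (norm (A *v axis 2 1))\<^sup>2"
    by (simp add: norm_matrix2_sq norm_complex2_sq matrix_vector_mult_def sum_2 axis_def)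
  also have "\<dots> \<le> (onorm ((*v) A))\<^sup>2 + (onorm ((*v) A))\<^sup>2"
    by (intro add_mono power_mono col) auto
  also have "\<dots> \<le> (2 * onorm ((*v) A))\<^sup>2" by (simp add: power_mult_distrib)
  finally show "norm A \<le> 2 * onorm ((*v) A)" by (rule power2_le_imp_le) (use nonneg in simp)
qed

section \<open>Two-sided orbits\<close>

context invertible_ergodic
begin

lemma int_iter_nonneg: "int_iter M T (int k) = T ^^ k"
  by (simp add: int_iter_def)

lemma int_iter_neg: "int_iter M T (- int k) = S ^^ k"
  by (cases "k = 0") (auto simp: int_iter_def)

lemma int_iter_in_space: "\<omega> \<in> space M \<Longrightarrow> int_iter M T n \<omega> \<in> space M"
  by (simp add: int_iter_def iterate_in_space inverse_iterate_in_space)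

lemma int_iter_measurable [measurable]: "int_iter M T n \<in> measurable M M"
  by (cases n rule: int_cases2) (simp_all add: int_iter_nonneg int_iter_neg)

lemma int_iter_T:
  assumes "\<omega> \<in> space M"
  shows "int_iter M T n (T \<omega>) = int_iter M T (n + 1) \<omega>"
proof (cases "n \<ge> 0")
  case True
  then obtain k where n: "n = int k" by (metis nat_0_le)
  have "int_iter M T (int k + 1) = T ^^ Suc k" using int_iter_nonneg[of "Suc k"] by (simp add: add.commute)
  then show ?thesis by (simp add: n int_iter_nonneg funpow_swap1)
next
  case False
  then obtain k where n: "n = - int (Suc k)" by (metis negD not_le)
  have "(S ^^ Suc k) (T \<omega>) = (S ^^ k) \<omega>" using assms by (simp add: funpow_swap1 S_T)
  then show ?thesis unfolding n int_iter_neg using int_iter_neg[of k] by simp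
qed

lemma orbit_seq_T: "\<omega> \<in> space M \<Longrightarrow> orbit_seq M T f (T \<omega>) n = orbit_seq M T f \<omega> (n + 1)"
  by (simp add: orbit_seq_def int_iter_T)

lemma orbit_seq_iterate: "\<omega> \<in> space M \<Longrightarrow> orbit_seq M T f ((T ^^ k) \<omega>) n = orbit_seq M T f \<omega> (n + int k)"
  by (induction k arbitrary: n) (auto simp: orbit_seq_T iterate_in_space algebra_simps)

lemma orbit_seq_S: "\<omega> \<in> space M \<Longrightarrow> orbit_seq M T f (S \<omega>) n = orbit_seq M T f \<omega> (n - 1)"
  using orbit_seq_T[of "S \<omega>" f "n - 1"] by (simp add: S_in_space T_S)

lemma orbit_seq_nonneg: "orbit_seq M T f \<omega> (int k) = f ((T ^^ k) \<omega>)"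
  by (simp add: orbit_seq_def int_iter_nonneg)

lemma orbit_seq_neg: "orbit_seq M T f \<omega> (- int k) = f ((S ^^ k) \<omega>)"
  by (simp add: orbit_seq_def int_iter_neg)

lemma AE_int_iter:
  assumes "AE \<omega> in M. P \<omega>"
  shows "AE \<omega> in M. P (int_iter M T n \<omega>)"
  using AE_iterate[OF assms] inverse_AE_iterate[OF assms]
  by (cases n rule: int_cases2) (simp_all add: int_iter_nonneg int_iter_neg)

lemma
  fixes f :: "'w \<Rightarrow> real"
  assumes "integrable M f"
  shows integrable_int_iter: "integrable M (\<lambda>\<omega>. f (int_iter M T n \<omega>))"
    and integral_int_iter: "(\<integral>\<omega>. f (int_iter M T n \<omega>) \<partial>M) = (\<integral>\<omega>. f \<omega> \<partial>M)"
  using integrable_iterate[OF assms] inverse_integrable_iterate[OF assms]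
    integral_iterate[OF assms] inverse_integral_iterate[OF assms]
  by (cases n rule: int_cases2, simp_all add: int_iter_nonneg int_iter_neg)+

end

section \<open>The forward and backward unimodular cocycles\<close>

context ergodic_jacobi
begin

definition fwd :: "'w \<Rightarrow> complex^2^2" where
  "fwd \<omega> = step_matrix (a \<omega>) (b \<omega>)"

text \<open>Moving left from site 0 undoes the step at site -1, whose coefficients are read at
  \<open>S \<omega>\<close>.\<close>

definition bwd :: "'w \<Rightarrow> complex^2^2" where
  "bwd \<omega> = back_matrix (a (S \<omega>)) (b (S \<omega>))"

definition bound :: real where
  "bound = (SOME K. 1 \<le> K \<and> (\<forall>\<omega>\<in>space M. cmod (a \<omega>) \<le> K \<and> \<bar>b \<omega>\<bar> \<le> K))"

lemma bound: "1 \<le> bound" "\<omega> \<in> space M \<Longrightarrow> cmod (a \<omega>) \<le> bound" "\<omega> \<in> space M \<Longrightarrow> \<bar>b \<omega>\<bar> \<le> bound"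
proof -
  obtain K1 K2 where "\<forall>\<omega>\<in>space M. cmod (a \<omega>) \<le> K1" "\<forall>\<omega>\<in>space M. \<bar>b \<omega>\<bar> \<le> K2"
    using bounded_a bounded_b by (auto simp: bounded_iff)
  then have "1 \<le> max 1 (max K1 K2) \<and> (\<forall>\<omega>\<in>space M. cmod (a \<omega>) \<le> max 1 (max K1 K2) \<and> \<bar>b \<omega>\<bar> \<le> max 1 (max K1 K2))"
    by (auto simp: le_max_iff_disj)
  then have *: "1 \<le> bound \<and> (\<forall>\<omega>\<in>space M. cmod (a \<omega>) \<le> bound \<and> \<bar>b \<omega>\<bar> \<le> bound)"
    unfolding bound_def by (rule someI)
  then show "1 \<le> bound" "\<omega> \<in> space M \<Longrightarrow> cmod (a \<omega>) \<le> bound" "\<omega> \<in> space M \<Longrightarrow> \<bar>b \<omega>\<bar> \<le> bound" by auto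
qed

lemma ab_measurable [measurable]: "a \<in> borel_measurable M" "b \<in> borel_measurable M"
  by (rule random_variable_a random_variable_b)+

lemma S_measurable [measurable]: "S \<in> measurable M M"
  by (rule measurable_inv_T)

lemma fwd_measurable [measurable]: "fwd \<in> borel_measurable M"
  unfolding fwd_def step_matrix_def by measurable

lemma bwd_measurable [measurable]: "bwd \<in> borel_measurable M"
  unfolding bwd_def back_matrix_def by measurable

lemma det_fwd: "cmod (det (fwd \<omega>)) = 1" and det_bwd: "cmod (det (bwd \<omega>)) = 1"
  by (simp_all add: fwd_def bwd_def det_step_matrix det_back_matrix)

lemma norm_bwd: "norm (bwd \<omega>) = norm (fwd (S \<omega>))"
  unfolding bwd_def fwd_def by (rule unimodular_inverse_norm[OF back_step_matrix det_step_matrix])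

text \<open>Unimodularity gives the lower bound 0 and \<open>norm_step_matrix_le\<close> the upper
  bound C - ln |a|, so the hypothesis on ln |a| enters here.\<close>

lemma integrable_ln_fwd: "integrable M (\<lambda>\<omega>. ln (norm (fwd \<omega>)))"
proof (rule Bochner_Integration.integrable_bound)
  define C where "C = ln (1 + bound + bound\<^sup>2)"
  show "integrable M (\<lambda>\<omega>. C - ln (cmod (a \<omega>)))" using integrable_ln_a by simp
  show "AE \<omega> in M. norm (ln (norm (fwd \<omega>))) \<le> norm (C - ln (cmod (a \<omega>)))"
    using a_nonzero AE_space
  proof eventually_elim
    case (elim \<omega>)
    have B: "0 < 1 + bound + bound\<^sup>2" using bound(1) by (simp add: add_pos_nonneg)
    have ge: "1 \<le> norm (fwd \<omega>)" unfolding fwd_def by (intro unimodular_norm_ge_1 det_step_matrix)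
    have le: "norm (fwd \<omega>) \<le> (1 + bound + bound\<^sup>2) / cmod (a \<omega>)"
      unfolding fwd_def using elim bound by (intro norm_step_matrix_le) auto
    have "ln (norm (fwd \<omega>)) \<le> ln ((1 + bound + bound\<^sup>2) / cmod (a \<omega>))"
      using ge le by (intro ln_le_cancel_iff[THEN iffD2]) linarith+
    also have "\<dots> = C - ln (cmod (a \<omega>))" unfolding C_def using B elim by (intro ln_divide_pos) auto
    finally show ?case using ge by simp
  qed
qed measurable

lemma integrable_ln_bwd: "integrable M (\<lambda>\<omega>. ln (norm (bwd \<omega>)))"
  unfolding norm_bwd using inverse_integrable_iterate[OF integrable_ln_fwd, of 1] by simp

lemma cocycle_bwd_inverse:
  assumes "\<omega> \<in> space M"
  shows "cocycle S bwd n \<omega> ** cocycle T fwd n ((S ^^ n) \<omega>) = mat 1"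
proof (induction n)
  case (Suc n)
  have s: "(S ^^ n) \<omega> \<in> space M" using assms by (rule inverse_iterate_in_space)
  have "cocycle T fwd (1 + n) (S ((S ^^ n) \<omega>)) = cocycle T fwd n ((S ^^ n) \<omega>) ** fwd (S ((S ^^ n) \<omega>))"
    unfolding cocycle_add using s by (simp add: T_S)
  then have "cocycle S bwd (Suc n) \<omega> ** cocycle T fwd (Suc n) ((S ^^ Suc n) \<omega>)
     = bwd ((S ^^ n) \<omega>) ** (cocycle S bwd n \<omega> ** cocycle T fwd n ((S ^^ n) \<omega>)) ** fwd (S ((S ^^ n) \<omega>))"
    by (simp add: matrix_mul_assoc)
  also have "\<dots> = mat 1" unfolding Suc by (simp add: bwd_def fwd_def back_step_matrix)
  finally show ?case .
qed simp

text \<open>The n steps back from \<omega> invert the n steps forward from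
  \<open>(S ^^ n) \<omega>\<close>, and unimodular inverses have equal norms.\<close>

lemma norm_cocycle_bwd:
  assumes "\<omega> \<in> space M"
  shows "norm (cocycle S bwd n \<omega>) = norm (cocycle T fwd n ((S ^^ n) \<omega>))"
proof (rule unimodular_inverse_norm[OF cocycle_bwd_inverse[OF assms]])
  show "cmod (det (cocycle T fwd n ((S ^^ n) \<omega>))) = 1"
    by (intro cocycle_det fwd_measurable det_fwd integrable_ln_fwd inverse_iterate_in_space assms)
qed

definition diag_coef :: "complex \<Rightarrow> complex^2^2" where
  "diag_coef c = vector [vector [1, 0], vector [0, c]]"

lemma norm_diag_coef_le: "norm (diag_coef c) \<le> 1 + cmod c"
  by (rule power2_le_imp_le) (auto simp: norm_matrix2_sq diag_coef_def power2_sum)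

lemma diag_coef_inverse: "c \<noteq> 0 \<Longrightarrow> diag_coef c ** diag_coef (inverse c) = mat 1"
  by (simp add: diag_coef_def vec_eq_iff forall_2 matrix_matrix_mult_def sum_2 mat_def)

end

text \<open>The transfer matrices act on \<open>(u\<^sub>n, u\<^sub>n\<^sub>-\<^sub>1)\<close>, the unimodular ones on
  \<open>(u\<^sub>n, cnj a\<^sub>n\<^sub>-\<^sub>1 u\<^sub>n\<^sub>-\<^sub>1)\<close>; the diagonal matrices change between the two.\<close>

lemma (in ergodic_jacobi) transfer_prod_conj:
  assumes nz: "\<And>n. orbit_seq M T a \<omega> n \<noteq> 0"
  shows "diag_coef (cnj (orbit_seq M T a \<omega> (int n - 1))) ** transfer_prod (orbit_seq M T a \<omega>) (orbit_seq M T b \<omega>) 0 n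
    = cocycle T fwd n \<omega> ** diag_coef (cnj (orbit_seq M T a \<omega> (- 1)))"
proof (induction n)
  case (Suc n)
  define \<alpha> \<beta> where "\<alpha> = orbit_seq M T a \<omega>" and "\<beta> = orbit_seq M T b \<omega>"
  have f: "fwd ((T ^^ n) \<omega>) = step_matrix (\<alpha> (int n)) (\<beta> (int n))"
    by (simp add: fwd_def \<alpha>_def \<beta>_def orbit_seq_nonneg)
  have "diag_coef (cnj (\<alpha> (int n))) ** transfer_step \<alpha> \<beta> 0 (int n)
      = fwd ((T ^^ n) \<omega>) ** diag_coef (cnj (\<alpha> (int n - 1)))"
    using nz[of "int n"] unfolding f
    by (simp add: \<alpha>_def step_matrix_def transfer_step_def diag_coef_def vec_eq_iff forall_2
        matrix_matrix_mult_def sum_2 mat_def)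
  then have "diag_coef (cnj (\<alpha> (int n))) ** transfer_step \<alpha> \<beta> 0 (int n) ** transfer_prod \<alpha> \<beta> 0 n
      = fwd ((T ^^ n) \<omega>) ** (diag_coef (cnj (\<alpha> (int n - 1))) ** transfer_prod \<alpha> \<beta> 0 n)"
    by (simp add: matrix_mul_assoc)
  then show ?case using Suc by (simp add: \<alpha>_def \<beta>_def matrix_mul_assoc)
qed simp

section \<open>Comparison of the Lyapunov exponent with the growth of the unimodular cocycle\<close>

context ergodic_jacobi
begin

lemma AE_orbit_nonzero: "AE \<omega> in M. \<forall>n. orbit_seq M T a \<omega> n \<noteq> 0"
  unfolding AE_all_countable orbit_seq_def by (intro allI AE_int_iter a_nonzero)

lemma transfer_prod_measurable [measurable]:
  "(\<lambda>\<omega>. transfer_prod (orbit_seq M T a \<omega>) (orbit_seq M T b \<omega>) z n) \<in> borel_measurable M"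
proof (induction n)
  case (Suc n)
  have [measurable]: "(\<lambda>\<omega>. orbit_seq M T a \<omega> k) \<in> borel_measurable M" "(\<lambda>\<omega>. orbit_seq M T b \<omega> k) \<in> borel_measurable M" for k
    unfolding orbit_seq_def by measurable
  have mat: "mat c = (vector [vector [c, 0], vector [0, c]] :: complex^2^2)" for c
    by (simp add: vec_eq_iff forall_2 mat_def)
  have "(\<lambda>\<omega>. transfer_step (orbit_seq M T a \<omega>) (orbit_seq M T b \<omega>) z (int n)) \<in> borel_measurable M"
    unfolding transfer_step_def mat by (intro borel_measurable_matrix_mult borel_measurable_matrix2) measurable
  then show ?case using Suc by simp
qed simp

text \<open>By \<open>transfer_prod_conj\<close> the two products differ by one diagonal matrix on
  each side. Each costs a factor \<open>1 + bound\<close> and, when inverted, a division by |a| at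
  the first or last site; ln 2 pays for the change of norm. By stationarity the bound has an
  expectation independent of n.\<close>

lemma ln_transfer_prod_diff:
  assumes nz: "\<And>n. orbit_seq M T a \<omega> n \<noteq> 0" and \<omega>: "\<omega> \<in> space M"
  shows "\<bar>ln (onorm ((*v) (transfer_prod (orbit_seq M T a \<omega>) (orbit_seq M T b \<omega>) 0 n)))
      - ln (norm (cocycle T fwd n \<omega>))\<bar>
    \<le> ln 2 + 2 * ln (1 + bound) + \<bar>ln (cmod (orbit_seq M T a \<omega> (int n - 1)))\<bar> + \<bar>ln (cmod (orbit_seq M T a \<omega> (- 1)))\<bar>"
proof -
  define p q where "p = cnj (orbit_seq M T a \<omega> (int n - 1))" and "q = cnj (orbit_seq M T a \<omega> (- 1))"
  define P A where "P = transfer_prod (orbit_seq M T a \<omega>) (orbit_seq M T b \<omega>) 0 n" and "A = cocycle T fwd n \<omega>"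
  define L where "L = 1 + bound"
  have L: "L > 0" using bound(1) by (simp add: L_def)
  have pq: "p \<noteq> 0" "q \<noteq> 0" using nz by (auto simp: p_def q_def)
  have le: "cmod p \<le> bound" "cmod q \<le> bound"
    unfolding p_def q_def orbit_seq_def using bound(2) int_iter_in_space[OF \<omega>] by auto
  have eq: "diag_coef p ** P = A ** diag_coef q"
    unfolding p_def q_def P_def A_def by (rule transfer_prod_conj[OF nz])
  have d: "norm (diag_coef c) \<le> L" "norm (diag_coef (inverse c)) \<le> L / cmod c" if "c \<noteq> 0" "cmod c \<le> bound" for c
  proof -
    show "norm (diag_coef c) \<le> L" using norm_diag_coef_le[of c] that by (simp add: L_def)
    show "norm (diag_coef (inverse c)) \<le> L / cmod c"
    proof -
      have "1 + cmod (inverse c) = (cmod c + 1) / cmod c" using that by (simp add: norm_inverse add_divide_distrib inverse_eq_divide[of "cmod c"])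
      also have "\<dots> \<le> L / cmod c" using that by (intro divide_right_mono) (auto simp: L_def)
      finally show ?thesis using norm_diag_coef_le[of "inverse c"] by linarith
    qed
  qed
  have Apos: "1 \<le> norm A" unfolding A_def
    by (intro cocycle_norm_ge_1 fwd_measurable det_fwd integrable_ln_fwd \<omega>)
  then have Anz: "A \<noteq> 0" by auto
  have A: "A = diag_coef p ** P ** diag_coef (inverse q)"
    using eq diag_coef_inverse[OF pq(2)] by (metis matrix_mul_assoc matrix_mul_rid)
  have P: "P = diag_coef (inverse p) ** (A ** diag_coef q)"
    using eq diag_coef_inverse[of "inverse p"] pq by (metis inverse_inverse_eq matrix_mul_assoc matrix_mul_lid nonzero_imp_inverse_nonzero)
  have nA: "norm A \<le> L * norm P * (L / cmod q)"
    unfolding A using L pq le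
    by (intro order_trans[OF norm_matrix_mult_le] mult_mono d mult_nonneg_nonneg) auto
  have nP: "norm P \<le> (L / cmod p) * (norm A * L)"
    unfolding P using L pq le
    by (intro order_trans[OF norm_matrix_mult_le] mult_mono d mult_nonneg_nonneg) auto
  have Ppos: "norm P > 0"
    using nA Apos by (cases "P = 0") auto
  have opos: "onorm ((*v) P) > 0" using onorm_matrix_bounds(2)[of P] Ppos by linarith
  have "ln (norm A) \<le> ln (L * (2 * onorm ((*v) P)) * (L / cmod q))"
  proof (rule ln_le_cancel_iff[THEN iffD2])
    have "L * norm P * (L / cmod q) \<le> L * (2 * onorm ((*v) P)) * (L / cmod q)"
      using L pq by (intro mult_right_mono mult_left_mono onorm_matrix_bounds) auto
    then show "norm A \<le> L * (2 * onorm ((*v) P)) * (L / cmod q)" using nA by linarith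
  qed (use Apos opos L pq in auto)
  also have "\<dots> = 2 * ln L + ln 2 + ln (onorm ((*v) P)) - ln (cmod q)"
    using L opos pq by (simp add: ln_mult_pos ln_divide_pos)
  finally have 1: "ln (norm A) \<le> 2 * ln L + ln 2 + ln (onorm ((*v) P)) - ln (cmod q)" .
  have "ln (onorm ((*v) P)) \<le> ln ((L / cmod p) * (norm A * L))"
    using onorm_matrix_bounds(1)[of P] nP opos Apos L pq by (intro ln_le_cancel_iff[THEN iffD2]) auto
  also have "\<dots> = 2 * ln L + ln (norm A) - ln (cmod p)"
    using L Anz pq by (simp add: ln_mult_pos ln_divide_pos)
  finally have 2: "ln (onorm ((*v) P)) \<le> 2 * ln L + ln (norm A) - ln (cmod p)" .
  have pq_norm: "cmod (orbit_seq M T a \<omega> (int n - 1)) = cmod p" "cmod (orbit_seq M T a \<omega> (- 1)) = cmod q"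
    by (simp_all add: p_def q_def)
  have "0 < ln (2::real)" by simp
  then show ?thesis
    using 1 2 unfolding pq_norm P_def[symmetric] A_def[symmetric] L_def[symmetric] abs_le_iff
    by (intro conjI) linarith+
qed

lemma lyapunov_exponent_eq:
  assumes "(\<lambda>n. (\<integral>\<omega>. ln (norm (cocycle T fwd n \<omega>)) \<partial>M) / real n) \<longlonglongrightarrow> \<gamma>"
  shows "lyapunov_exponent M T a b 0 = \<gamma>"
proof -
  define f where "f n \<omega> = ln (onorm ((*v) (transfer_prod (orbit_seq M T a \<omega>) (orbit_seq M T b \<omega>) 0 n)))" for n \<omega>
  define g where "g n \<omega> = ln (norm (cocycle T fwd n \<omega>))" for n \<omega>
  define h where "h n = (\<lambda>\<omega>. ln 2 + 2 * ln (1 + bound) + \<bar>ln (cmod (orbit_seq M T a \<omega> (int n - 1)))\<bar> + \<bar>ln (cmod (orbit_seq M T a \<omega> (- 1)))\<bar>)" for n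
  define C where "C = ln 2 + 2 * ln (1 + bound) + 2 * (\<integral>\<omega>. \<bar>ln (cmod (a \<omega>))\<bar> \<partial>M)"
  have g: "integrable M (g n)" for n
    unfolding g_def
    by (rule log_cocycle_growth[OF fwd_measurable det_fwd integrable_ln_fwd])
  have la: "integrable M (\<lambda>\<omega>. \<bar>ln (cmod (a \<omega>))\<bar>)" using integrable_ln_a by simp
  have h: "integrable M (h n)" "(\<integral>\<omega>. h n \<omega> \<partial>M) = C" for n
    using integrable_int_iter[OF la] integral_int_iter[OF la]
    by (simp_all add: h_def C_def orbit_seq_def prob_space)
  have AE: "AE \<omega> in M. \<bar>f n \<omega> - g n \<omega>\<bar> \<le> h n \<omega>" for n
    using AE_orbit_nonzero AE_space
    by eventually_elim (unfold f_def g_def h_def, rule ln_transfer_prod_diff, auto)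
  have [measurable]: "f n \<in> borel_measurable M" for n
  proof -
    have "(\<lambda>\<omega>. onorm ((*v) (transfer_prod (orbit_seq M T a \<omega>) (orbit_seq M T b \<omega>) 0 n))) \<in> borel_measurable M"
      using borel_measurable_continuous_on[OF continuous_on_onorm_matrix transfer_prod_measurable] .
    then show ?thesis unfolding f_def by measurable
  qed
  have [measurable]: "g n \<in> borel_measurable M" for n using g by auto
  \<comment> \<open>The Bochner integral of a non-integrable function defaults to 0, so
    \<open>f n\<close> must be shown integrable before the integral of the difference is split; this
    follows from \<open>g n\<close> and the dominated difference.\<close>
  have fg: "integrable M (\<lambda>\<omega>. f n \<omega> - g n \<omega>)" for n
    by (rule Bochner_Integration.integrable_bound[OF h(1)[of n]]) (use AE[of n] in \<open>auto elim!: eventually_mono\<close>)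
  then have f: "integrable M (f n)" for n
    using Bochner_Integration.integrable_add[OF fg[of n] g[of n]] by simp
  have diff: "\<bar>(\<integral>\<omega>. f n \<omega> \<partial>M) - (\<integral>\<omega>. g n \<omega> \<partial>M)\<bar> \<le> C" for n
  proof -
    have "\<bar>\<integral>\<omega>. f n \<omega> - g n \<omega> \<partial>M\<bar> \<le> (\<integral>\<omega>. \<bar>f n \<omega> - g n \<omega>\<bar> \<partial>M)"
      using integral_abs_bound by blast
    also have "\<dots> \<le> (\<integral>\<omega>. h n \<omega> \<partial>M)" using fg by (intro integral_mono_AE AE h) auto
    finally show ?thesis by (simp add: h f g)
  qed
  have "(\<lambda>n. ((\<integral>\<omega>. f n \<omega> \<partial>M) - (\<integral>\<omega>. g n \<omega> \<partial>M)) / real n) \<longlonglongrightarrow> 0"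
  proof (rule Lim_null_comparison)
    show "(\<lambda>n. C / real n) \<longlonglongrightarrow> 0" by (rule lim_const_over_n)
    show "\<forall>\<^sub>F n in sequentially. norm (((\<integral>\<omega>. f n \<omega> \<partial>M) - (\<integral>\<omega>. g n \<omega> \<partial>M)) / real n) \<le> C / real n"
      using diff by (auto intro!: always_eventually divide_right_mono)
  qed
  from tendsto_add[OF this assms[folded g_def]]
  have "(\<lambda>n. 1 / real n * (\<integral>\<omega>. f n \<omega> \<partial>M)) \<longlonglongrightarrow> \<gamma>"
    by (simp add: diff_divide_distrib)
  then show ?thesis unfolding lyapunov_exponent_def f_def by (rule limI)
qed

text \<open>The backward exponent is also \<gamma>: by \<open>norm_cocycle_bwd\<close> the backward
  logarithm is the forward one evaluated at \<open>(S ^^ n) \<omega>\<close>, and \<open>S\<close>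
  preserves the measure.\<close>

lemma stable_vectors:
  assumes pos: "lyapunov_exponent M T a b 0 > 0"
  shows "AE \<omega> in M. \<exists>v. v \<noteq> 0 \<and> summable (\<lambda>n. (norm (cocycle T fwd n \<omega> *v v))\<^sup>2)"
    and "AE \<omega> in M. \<exists>v. v \<noteq> 0 \<and> summable (\<lambda>n. (norm (cocycle S bwd n \<omega> *v v))\<^sup>2)"
proof -
  obtain \<gamma> where \<gamma>: "(\<lambda>n. (\<integral>\<omega>. ln (norm (cocycle T fwd n \<omega>)) \<partial>M) / real n) \<longlonglongrightarrow> \<gamma>"
    and int: "\<And>n. integrable M (\<lambda>\<omega>. ln (norm (cocycle T fwd n \<omega>)))"
    by (rule log_cocycle_growth[OF fwd_measurable det_fwd integrable_ln_fwd]) (rule that)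
  have \<gamma>_pos: "\<gamma> > 0" using lyapunov_exponent_eq[OF \<gamma>] pos by simp
  show "AE \<omega> in M. \<exists>v. v \<noteq> 0 \<and> summable (\<lambda>n. (norm (cocycle T fwd n \<omega> *v v))\<^sup>2)"
    by (rule stable_vector[OF fwd_measurable det_fwd integrable_ln_fwd \<gamma> \<gamma>_pos])
  have "(\<integral>\<omega>. ln (norm (cocycle S bwd n \<omega>)) \<partial>M) = (\<integral>\<omega>. ln (norm (cocycle T fwd n \<omega>)) \<partial>M)" for n
  proof -
    have "(\<integral>\<omega>. ln (norm (cocycle S bwd n \<omega>)) \<partial>M) = (\<integral>\<omega>. ln (norm (cocycle T fwd n ((S ^^ n) \<omega>))) \<partial>M)"
      by (intro Bochner_Integration.integral_cong) (auto simp: norm_cocycle_bwd)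
    then show ?thesis using inverse_integral_iterate[OF int[of n], of n] by simp
  qed
  then have "(\<lambda>n. (\<integral>\<omega>. ln (norm (cocycle S bwd n \<omega>)) \<partial>M) / real n) \<longlonglongrightarrow> \<gamma>" using \<gamma> by simp
  then show "AE \<omega> in M. \<exists>v. v \<noteq> 0 \<and> summable (\<lambda>n. (norm (cocycle S bwd n \<omega> *v v))\<^sup>2)"
    by (rule inverse_stable_vector[OF bwd_measurable det_bwd integrable_ln_bwd _ \<gamma>_pos])
qed

end

section \<open>Absence of point masses and boundedness of the Green's function\<close>

lemma nonneg_part_in_ell2:
  assumes "summable (\<lambda>k. (cmod (u (int k)))\<^sup>2)"
  shows "(\<lambda>n. if n \<ge> 0 then u n else 0) \<in> ell2"
proof -
  have "(\<lambda>k. (cmod (u (int k)))\<^sup>2) summable_on UNIV"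
    using assms by (simp add: summable_on_UNIV_nonneg_real_iff)
  then have "(\<lambda>n. (cmod (u n))\<^sup>2) summable_on range int"
    by (subst summable_on_reindex) (auto simp: o_def)
  then have "(\<lambda>n. (cmod (if n \<ge> 0 then u n else 0))\<^sup>2) summable_on UNIV"
  proof (rule summable_on_cong_neutral[THEN iffD1, rotated -1])
    fix n :: int assume "n \<in> UNIV - range int"
    then have "\<not> n \<ge> 0" by (metis Diff_iff nat_0_le rangeI)
    then show "(cmod (if n \<ge> 0 then u n else 0))\<^sup>2 = 0" by simp
  qed auto
  then show ?thesis by (simp add: ell2_def)
qed

lemma neg_part_in_ell2:
  assumes "summable (\<lambda>k. (cmod (u (- int k)))\<^sup>2)"
  shows "(\<lambda>n. if n < 0 then u n else 0) \<in> ell2"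
proof -
  define w where "w = (\<lambda>n. if n \<ge> 0 then u (- n) else 0)"
  have "w \<in> ell2" unfolding w_def by (rule nonneg_part_in_ell2) (rule assms)
  moreover have "bij_betw (uminus :: int \<Rightarrow> int) UNIV UNIV"
    by (rule bij_betwI[where g = uminus]) auto
  ultimately have "(\<lambda>n. w (- n)) \<in> ell2"
    using summable_on_reindex_bij_betw[of uminus UNIV UNIV "\<lambda>n. (cmod (w n))\<^sup>2"] by (simp add: ell2_def)
  then show ?thesis by (rule ell2_comparison[where c = 1]) (auto simp: w_def)
qed

context ergodic_jacobi
begin

abbreviation \<alpha> :: "'w \<Rightarrow> int \<Rightarrow> complex" where "\<alpha> \<omega> \<equiv> orbit_seq M T a \<omega>"
abbreviation \<beta> :: "'w \<Rightarrow> int \<Rightarrow> real" where "\<beta> \<omega> \<equiv> orbit_seq M T b \<omega>"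
abbreviation G :: "'w \<Rightarrow> int \<Rightarrow> real \<Rightarrow> complex" where "G \<omega> n \<epsilon> \<equiv> green (\<alpha> \<omega>) (\<beta> \<omega>) n n (Complex 0 \<epsilon>)"

lemma bounded_jacobi_orbit: "\<omega> \<in> space M \<Longrightarrow> bounded_jacobi (\<alpha> \<omega>) (\<beta> \<omega>) bound"
  by unfold_locales (auto simp: orbit_seq_def intro!: bound int_iter_in_space)

text \<open>The solution with \<open>(u\<^sub>0, cnj a\<^sub>-\<^sub>1 u\<^sub>-\<^sub>1) = v\<close>.\<close>

definition state :: "'w \<Rightarrow> complex^2 \<Rightarrow> int \<Rightarrow> complex^2" where
  "state \<omega> v n = (if n \<ge> 0 then cocycle T fwd (nat n) \<omega> *v v else cocycle S bwd (nat (- n)) \<omega> *v v)"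

definition solution :: "'w \<Rightarrow> complex^2 \<Rightarrow> int \<Rightarrow> complex" where
  "solution \<omega> v n = state \<omega> v n $ 1"

lemma state_nonneg: "state \<omega> v (int k) = cocycle T fwd k \<omega> *v v"
  and state_nonpos: "state \<omega> v (- int k) = cocycle S bwd k \<omega> *v v"
  by (auto simp: state_def)

lemma state_step: "state \<omega> v (n + 1) = step_matrix (\<alpha> \<omega> n) (\<beta> \<omega> n) *v state \<omega> v n"
proof (cases "n \<ge> 0")
  case True
  then obtain k where n: "n = int k" by (metis nat_0_le)
  have "state \<omega> v (int k + 1) = state \<omega> v (int (Suc k))" by (simp add: add.commute)
  also have "\<dots> = step_matrix (\<alpha> \<omega> (int k)) (\<beta> \<omega> (int k)) *v state \<omega> v (int k)"
    unfolding state_nonneg by (simp add: fwd_def orbit_seq_nonneg matrix_vector_mul_assoc)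
  finally show ?thesis unfolding n .
next
  case False
  then obtain k where n: "n = - int (Suc k)" by (metis negD not_le)
  \<comment> \<open>The last backward factor is \<open>bwd\<close> at
    \<open>(S ^^ k) \<omega>\<close>, which reads its coefficients at
    \<open>(S ^^ Suc k) \<omega>\<close>, that is, at site n.\<close>
  have "state \<omega> v n = back_matrix (\<alpha> \<omega> n) (\<beta> \<omega> n) *v state \<omega> v (- int k)"
    unfolding n state_nonpos orbit_seq_neg by (simp add: bwd_def matrix_vector_mul_assoc)
  then have "step_matrix (\<alpha> \<omega> n) (\<beta> \<omega> n) *v state \<omega> v n = state \<omega> v (- int k)"
    by (simp add: matrix_vector_mul_assoc step_back_matrix)
  then show ?thesis by (simp add: n)
qed

context
  fixes \<omega> :: 'w
  assumes nz: "\<And>n. \<alpha> \<omega> n \<noteq> 0"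
begin

lemma state_second: "state \<omega> v n $ 2 = cnj (\<alpha> \<omega> (n - 1)) * solution \<omega> v (n - 1)"
  using state_step[of \<omega> v "n - 1"] nz[of "n - 1"]
  by (simp add: step_matrix_def matrix_vector_mult_def sum_2 solution_def)

lemma solution_solves: "jacobi_op (\<alpha> \<omega>) (\<beta> \<omega>) (solution \<omega> v) n = 0"
proof -
  have "solution \<omega> v (n + 1) = (- of_real (\<beta> \<omega> n) * solution \<omega> v n - state \<omega> v n $ 2) / \<alpha> \<omega> n"
    using state_step[of \<omega> v n] nz[of n]
    by (simp add: step_matrix_def matrix_vector_mult_def sum_2 solution_def field_simps)
  then show ?thesis unfolding state_second jacobi_op_def using nz[of n] by (simp add: field_simps)
qed

lemma solution_0: "v $ 1 = solution \<omega> v 0" and solution_minus_1: "v $ 2 = cnj (\<alpha> \<omega> (- 1)) * solution \<omega> v (- 1)"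
  using state_second[of v 0] state_nonneg[of \<omega> v 0] by (simp_all add: solution_def)

lemma solution_nontrivial: "v \<noteq> 0 \<Longrightarrow> solution \<omega> v 0 \<noteq> 0 \<or> solution \<omega> v (- 1) \<noteq> 0"
  using solution_0[of v] solution_minus_1[of v] by (auto simp: vec_eq_iff forall_2)

end

lemma right_ell2:
  assumes "summable (\<lambda>k. (norm (cocycle T fwd k \<omega> *v v))\<^sup>2)"
  shows "(\<lambda>n. if n \<ge> 0 then solution \<omega> v n else 0) \<in> ell2"
proof (rule nonneg_part_in_ell2, rule summable_comparison_test'[OF assms, where N = 0])
  fix k show "norm ((cmod (solution \<omega> v (int k)))\<^sup>2) \<le> (norm (cocycle T fwd k \<omega> *v v))\<^sup>2"
    by (simp add: solution_def state_nonneg Finite_Cartesian_Product.norm_nth_le)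
qed

lemma left_ell2:
  assumes "summable (\<lambda>k. (norm (cocycle S bwd k \<omega> *v v))\<^sup>2)"
  shows "(\<lambda>n. if n < 0 then solution \<omega> v n else 0) \<in> ell2"
proof (rule neg_part_in_ell2, rule summable_comparison_test'[OF assms, where N = 0])
  fix k show "norm ((cmod (solution \<omega> v (- int k)))\<^sup>2) \<le> (norm (cocycle S bwd k \<omega> *v v))\<^sup>2"
    by (simp add: solution_def state_nonpos Finite_Cartesian_Product.norm_nth_le)
qed

section \<open>Measurability and stationarity of the diagonal Green's function\<close>

lemma orbit_measurable [measurable]:
  "(\<lambda>\<omega>. \<alpha> \<omega> n) \<in> borel_measurable M" "(\<lambda>\<omega>. \<beta> \<omega> n) \<in> borel_measurable M"
  unfolding orbit_seq_def by measurable

text \<open>A pointwise limit of the measurable iterates. The step size uses the bound common to all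
  \<omega>, so one recursion serves the whole space.\<close>

lemma green_measurable:
  assumes "\<epsilon> > 0"
  shows "(\<lambda>\<omega>. G \<omega> n \<epsilon>) \<in> borel_measurable M"
proof -
  define t where "t = \<epsilon> / (\<epsilon>\<^sup>2 + 9 * bound\<^sup>2)"
  have "(\<lambda>\<omega>. resolvent_iter (\<alpha> \<omega>) (\<beta> \<omega>) \<epsilon> t n k j) \<in> borel_measurable M" for k j
  proof (induction k arbitrary: j)
    case (Suc k)
    note Suc [measurable]
    show ?case by (simp add: jacobi_op_def)
  qed simp
  moreover have "(\<lambda>k. resolvent_iter (\<alpha> \<omega>) (\<beta> \<omega>) \<epsilon> t n k n) \<longlonglongrightarrow> G \<omega> n \<epsilon>" if "\<omega> \<in> space M" for \<omega>
    using bounded_jacobi.resolvent_iter_tendsto_green[OF bounded_jacobi_orbit[OF that] assms]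
      bounded_jacobi.step_size_def[OF bounded_jacobi_orbit[OF that]] by (simp add: t_def)
  ultimately show ?thesis by (rule borel_measurable_LIMSEQ_metric)
qed

lemma green_iterate:
  assumes "\<omega> \<in> space M" "\<epsilon> > 0"
  shows "G ((T ^^ k) \<omega>) 0 \<epsilon> = G \<omega> (int k) \<epsilon>"
proof -
  have "\<alpha> ((T ^^ k) \<omega>) = (\<lambda>n. \<alpha> \<omega> (n + int k))" "\<beta> ((T ^^ k) \<omega>) = (\<lambda>n. \<beta> \<omega> (n + int k))"
    using assms(1) by (simp_all add: fun_eq_iff orbit_seq_iterate)
  then show ?thesis
    using bounded_jacobi.green_shift[OF bounded_jacobi_orbit[OF assms(1)] assms(2), of "int k"] by simp
qed

lemma green_S:
  assumes "\<omega> \<in> space M" "\<epsilon> > 0"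
  shows "G (S \<omega>) 0 \<epsilon> = G \<omega> (- 1) \<epsilon>"
proof -
  have "\<alpha> (S \<omega>) = (\<lambda>n. \<alpha> \<omega> (n + - 1))" "\<beta> (S \<omega>) = (\<lambda>n. \<beta> \<omega> (n + - 1))"
    using assms(1) by (simp_all add: fun_eq_iff orbit_seq_S)
  then show ?thesis
    using bounded_jacobi.green_shift[OF bounded_jacobi_orbit[OF assms(1)] assms(2), of "- 1"] by simp
qed

text \<open>A lower bound of the mass at the energy \<open>0\<close> of the spectral measure of \<open>\<delta>\<^sub>0\<close>; it is positive as soon
  as there is an eigenfunction that does not vanish at the origin. Along an orbit it tends to \<open>0\<close>, since
  \<open>\<delta>\<^sub>n\<close> is a multiple of \<open>cnj u\<^sub>n\<close> modulo the range of the operator; stationarity then forces it to vanish.\<close>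

definition atom :: "'w \<Rightarrow> real" where
  "atom \<omega> = (INF k. 1 / real (Suc k) * cmod (G \<omega> 0 (1 / real (Suc k))))"

lemma atom_bdd: "bdd_below (range (\<lambda>k. 1 / real (Suc k) * cmod (G \<omega> 0 (1 / real (Suc k)))))"
  by (rule bdd_belowI[of _ 0]) auto

lemma atom_nonneg: "0 \<le> atom \<omega>"
  unfolding atom_def by (rule cINF_greatest) auto

lemma atom_le: "atom \<omega> \<le> 1 / real (Suc k) * cmod (G \<omega> 0 (1 / real (Suc k)))"
  unfolding atom_def by (rule cINF_lower[OF atom_bdd]) simp

lemma atom_le_1:
  assumes "\<omega> \<in> space M"
  shows "atom \<omega> \<le> 1"
proof -
  interpret bounded_jacobi "\<alpha> \<omega>" "\<beta> \<omega>" bound using assms by (rule bounded_jacobi_orbit)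
  have "1 * cmod (G \<omega> 0 1) \<le> 2 * 1 * norm (0 :: l2) + norm (delta_l2 0)"
    by (rule green_le) simp_all
  then show ?thesis using atom_le[of \<omega> 0] by (simp add: norm_delta_l2)
qed

lemma atom_measurable [measurable]: "atom \<in> borel_measurable M"
  unfolding atom_def
  by (intro borel_measurable_cINF atom_bdd borel_measurable_times borel_measurable_const
      borel_measurable_norm[THEN measurable_compose[rotated]] green_measurable measurable_compose[OF green_measurable borel_measurable_norm]) auto

lemma atom_iterate_tendsto_0:
  assumes \<omega>: "\<omega> \<in> space M" and nz: "\<And>n. \<alpha> \<omega> n \<noteq> 0"
    and v: "v \<noteq> 0" "summable (\<lambda>k. (norm (cocycle T fwd k \<omega> *v v))\<^sup>2)"
  shows "(\<lambda>k. atom ((T ^^ k) \<omega>)) \<longlonglongrightarrow> 0"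
proof -
  interpret bounded_jacobi "\<alpha> \<omega>" "\<beta> \<omega>" bound using \<omega> by (rule bounded_jacobi_orbit)
  obtain r where r: "r \<longlonglongrightarrow> 0" "\<And>k. \<exists>C. \<forall>\<epsilon>>0. \<epsilon> * cmod (G \<omega> (int k) \<epsilon>) \<le> \<epsilon> * C + r k"
    using right_decaying_green[OF solution_solves[OF nz] nz right_ell2[OF v(2)] solution_nontrivial[OF nz v(1)]]
    by blast
  have "atom ((T ^^ k) \<omega>) \<le> r k" for k
  proof -
    obtain C where C: "\<And>\<epsilon>. \<epsilon> > 0 \<Longrightarrow> \<epsilon> * cmod (G \<omega> (int k) \<epsilon>) \<le> \<epsilon> * C + r k" using r(2) by blast
    \<comment> \<open>At fixed k the constant \<open>C\<close>, whose size is unknown, is removed by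
      letting j tend to infinity; only afterwards does k grow.\<close>
    have "atom ((T ^^ k) \<omega>) \<le> 1 / real (Suc j) * C + r k" for j
      using atom_le[of "(T ^^ k) \<omega>" j] C[of "1 / real (Suc j)"] green_iterate[OF \<omega>, of "1 / real (Suc j)" k] by simp
    moreover have "(\<lambda>j. 1 / real (Suc j) * C + r k) \<longlonglongrightarrow> 0 * C + r k"
      by (intro tendsto_intros LIMSEQ_Suc[OF lim_1_over_n])
    ultimately show ?thesis by (intro LIMSEQ_le_const[of _ "r k"]) auto
  qed
  then show ?thesis
    by (intro real_tendsto_sandwich[OF _ _ tendsto_const r(1)] always_eventually) (auto simp: atom_nonneg)
qed

text \<open>The expectation of \<open>atom\<close> along the orbit is constant by invariance and
  tends to 0 by dominated convergence, \<open>atom\<close> being at most 1.\<close>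

lemma atom_AE_0:
  assumes "lyapunov_exponent M T a b 0 > 0"
  shows "AE \<omega> in M. atom \<omega> = 0"
proof -
  have int: "integrable M atom"
    by (rule integrable_const_bound[of _ 1]) (use AE_space in \<open>auto elim!: eventually_mono simp: atom_nonneg atom_le_1\<close>)
  have "(\<lambda>k. \<integral>\<omega>. atom ((T ^^ k) \<omega>) \<partial>M) \<longlonglongrightarrow> (\<integral>\<omega>. 0 \<partial>M)"
  proof (rule integral_dominated_convergence[where w = "\<lambda>_. 1"])
    show "AE \<omega> in M. (\<lambda>k. atom ((T ^^ k) \<omega>)) \<longlonglongrightarrow> 0"
      using stable_vectors(1)[OF assms] AE_orbit_nonzero AE_space
    proof eventually_elim
      case (elim \<omega>)
      then show ?case using atom_iterate_tendsto_0[of \<omega>] by blast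
    qed
    show "AE \<omega> in M. norm (atom ((T ^^ k) \<omega>)) \<le> 1" for k
      using AE_space by eventually_elim (simp add: atom_nonneg atom_le_1 iterate_in_space)
  qed auto
  then have "(\<integral>\<omega>. atom \<omega> \<partial>M) = 0" by (simp add: integral_iterate[OF int] LIMSEQ_const_iff)
  then show ?thesis using integral_nonneg_eq_0_iff_AE[OF int] atom_nonneg by simp
qed

lemma atom_pos:
  assumes "c > 0" "\<And>\<epsilon>. \<epsilon> > 0 \<Longrightarrow> c \<le> \<epsilon> * cmod (G \<omega> 0 \<epsilon>)"
  shows "atom \<omega> > 0"
proof -
  have "c \<le> atom \<omega>" unfolding atom_def by (rule cINF_greatest) (simp, rule assms(2), simp)
  then show ?thesis using assms(1) by linarith
qed

text \<open>The atom is made to vanish at \<omega> and at \<open>S \<omega>\<close> because a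
  nonzero solution may vanish at site 0 but then not at site -1, and site -1 of \<omega> is the
  origin of \<open>S \<omega>\<close>.\<close>

lemma AE_green_bounded:
  assumes pos: "lyapunov_exponent M T a b 0 > 0"
  shows "AE \<omega> in M. \<exists>C. \<forall>\<epsilon>>0. cmod (G \<omega> 0 \<epsilon>) \<le> C \<and> cmod (G \<omega> 1 \<epsilon>) \<le> C"
  using stable_vectors[OF pos] AE_orbit_nonzero atom_AE_0[OF pos] inverse_AE_iterate[OF atom_AE_0[OF pos], of 1] AE_space
proof eventually_elim
  case (elim \<omega>)
  interpret bounded_jacobi "\<alpha> \<omega>" "\<beta> \<omega>" bound using elim by (intro bounded_jacobi_orbit)
  have nz: "\<And>n. \<alpha> \<omega> n \<noteq> 0" using elim by blast
  obtain v where v: "v \<noteq> 0" "summable (\<lambda>n. (norm (cocycle T fwd n \<omega> *v v))\<^sup>2)" using elim by blast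
  obtain w where w: "w \<noteq> 0" "summable (\<lambda>n. (norm (cocycle S bwd n \<omega> *v w))\<^sup>2)" using elim by blast
  have "wedge v w \<noteq> 0"
  proof
    assume dep: "wedge v w = 0"
    obtain c where c: "v = c *s w"
    proof (cases "w $ 1 = 0")
      case True
      then have "w $ 2 \<noteq> 0" using w(1) by (auto simp: vec_eq_iff forall_2)
      then show thesis using dep True that[of "v $ 2 / w $ 2"] by (simp add: wedge_def vec_eq_iff forall_2)
    next
      case False
      then show thesis using dep that[of "v $ 1 / w $ 1"]
        by (simp add: wedge_def vec_eq_iff forall_2 field_simps)
    qed
    \<comment> \<open>Being a multiple of \<open>w\<close>, the vector \<open>v\<close> decays to
      the left as well, so its two half-line pieces glue to an eigenvector.\<close>
    have "summable (\<lambda>n. (cmod c)\<^sup>2 * (norm (cocycle S bwd n \<omega> *v w))\<^sup>2)" using w(2) by (rule summable_mult)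
    then have "summable (\<lambda>n. (norm (cocycle S bwd n \<omega> *v v))\<^sup>2)"
      unfolding c by (simp add: vec.scale power_mult_distrib)
    from left_ell2[OF this] right_ell2[OF v(2)]
    have "(\<lambda>n. (if n \<ge> 0 then solution \<omega> v n else 0) + (if n < 0 then solution \<omega> v n else 0)) \<in> ell2"
      by (intro ell2_add)
    then have mem: "solution \<omega> v \<in> ell2" by (rule ell2_comparison[where c = 1]) auto
    from solution_nontrivial[OF nz v(1)] show False
    proof
      assume "solution \<omega> v 0 \<noteq> 0"
      then obtain c where "c > 0" "\<And>\<epsilon>. \<epsilon> > 0 \<Longrightarrow> c \<le> \<epsilon> * cmod (G \<omega> 0 \<epsilon>)"
        using eigenvector_green[OF solution_solves[OF nz] mem] by blast
      then show False using atom_pos elim by force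
    next
      assume "solution \<omega> v (- 1) \<noteq> 0"
      then obtain c where "c > 0" "\<And>\<epsilon>. \<epsilon> > 0 \<Longrightarrow> c \<le> \<epsilon> * cmod (G \<omega> (- 1) \<epsilon>)"
        using eigenvector_green[OF solution_solves[OF nz] mem] by blast
      then have "atom (S \<omega>) > 0" using green_S elim by (intro atom_pos) auto
      then show False using elim by simp
    qed
  qed
  \<comment> \<open>The second components carry the common factor cnj a_{-1}, so
    \<open>wedge v w\<close> is that factor times the difference of the two sides.\<close>
  then have "solution \<omega> v 0 * solution \<omega> w (- 1) \<noteq> solution \<omega> v (- 1) * solution \<omega> w 0"
    by (auto simp: wedge_def solution_0[OF nz] solution_minus_1[OF nz])
  from independent_green_bounded[OF solution_solves[OF nz] solution_solves[OF nz] nz right_ell2[OF v(2)] left_ell2[OF w(2)] this]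
  show ?case by metis
qed

lemma null_singular_energy_0:
  assumes pos: "lyapunov_exponent M T a b 0 > 0"
  shows "{\<omega> \<in> space M. 0 \<in> singular_energies (\<alpha> \<omega>) (\<beta> \<omega>)} \<in> null_sets M"
proof -
  define f where "f \<omega> \<epsilon> = Im (G \<omega> 0 \<epsilon>) + Im (G \<omega> 1 \<epsilon>)" for \<omega> \<epsilon>
  have f_meas: "(\<lambda>\<omega>. f \<omega> \<epsilon>) \<in> borel_measurable M" if "\<epsilon> > 0" for \<epsilon>
  proof -
    have [measurable]: "(\<lambda>\<omega>. G \<omega> n \<epsilon>) \<in> borel_measurable M" for n using that by (rule green_measurable)
    show ?thesis unfolding f_def by measurable
  qed
  have singular: "0 \<in> singular_energies (\<alpha> \<omega>) (\<beta> \<omega>) \<longleftrightarrow>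
      (\<forall>N::nat. \<exists>r. 0 < real_of_rat r \<and> of_rat r < 1 / real (Suc N) \<and> f \<omega> (of_rat r) > real N)" if "\<omega> \<in> space M" for \<omega>
  proof -
    interpret bounded_jacobi "\<alpha> \<omega>" "\<beta> \<omega>" bound using that by (rule bounded_jacobi_orbit)
    have "continuous_on {0<..} (f \<omega>)" unfolding f_def by (intro continuous_intros green_continuous)
    from Limsup_at_right_0_eq_infinity_iff[OF this]
    show ?thesis by (simp only: singular_energies_def mem_Collect_eq f_def)
  qed
  \<comment> \<open>Measurability of \<open>f\<close> in \<omega> is available for positive
    arguments only, so the condition on r is put into the index and the set is empty where it
    fails.\<close>
  define X where "X N r = (if 0 < real_of_rat r \<and> of_rat r < 1 / real (Suc N)
      then {\<omega>\<in>space M. f \<omega> (of_rat r) > real N} else {})" for N :: nat and r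
  have X: "X N r \<in> events" for N r
  proof (cases "0 < real_of_rat r")
    case True
    then have [measurable]: "(\<lambda>\<omega>. f \<omega> (of_rat r)) \<in> borel_measurable M" by (rule f_meas)
    have "{\<omega>\<in>space M. f \<omega> (of_rat r) > real N} \<in> events" by measurable
    then show ?thesis by (simp add: X_def)
  qed (simp add: X_def)
  have "{\<omega> \<in> space M. 0 \<in> singular_energies (\<alpha> \<omega>) (\<beta> \<omega>)} = (\<Inter>N. \<Union>r. X N r)"
    by (auto simp: singular X_def split: if_splits)
  also have "\<dots> \<in> events" using X by (intro sets.countable_INT sets.countable_UN) auto
  finally have meas: "{\<omega> \<in> space M. 0 \<in> singular_energies (\<alpha> \<omega>) (\<beta> \<omega>)} \<in> events" .
  have "AE \<omega> in M. 0 \<notin> singular_energies (\<alpha> \<omega>) (\<beta> \<omega>)"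
    using AE_green_bounded[OF pos] AE_space
  proof eventually_elim
    case (elim \<omega>)
    then obtain C where C: "\<And>\<epsilon>. \<epsilon> > 0 \<Longrightarrow> cmod (G \<omega> 0 \<epsilon>) \<le> C \<and> cmod (G \<omega> 1 \<epsilon>) \<le> C" by blast
    obtain N :: nat where N: "2 * C \<le> real N" using real_arch_simple by blast
    have "f \<omega> \<epsilon> \<le> real N" if "\<epsilon> > 0" for \<epsilon>
      using C[OF that] abs_Im_le_cmod[of "G \<omega> 0 \<epsilon>"] abs_Im_le_cmod[of "G \<omega> 1 \<epsilon>"] N
      unfolding f_def by linarith
    then show ?case unfolding singular[OF elim(2)] by (meson not_le)
  qed
  then show ?thesis using meas by (simp add: AE_iff_null)
qed

end

text \<open>Moving \<open>E\<close> from the spectral parameter into the diagonal leaves the map on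
  sequences literally unchanged, so \<open>the_inv_into\<close> inverts the same function on both
  sides.\<close>

lemma green_shift_energy: "green a b n m (Complex E \<epsilon>) = green a (\<lambda>n. b n - E) n m (Complex 0 \<epsilon>)"
proof -
  have "jacobi_op a b \<psi> k - Complex E \<epsilon> * \<psi> k = jacobi_op a (\<lambda>n. b n - E) \<psi> k - Complex 0 \<epsilon> * \<psi> k" for \<psi> k
    by (simp add: jacobi_op_def Complex_eq algebra_simps)
  then show ?thesis by (simp add: green_def jacobi_resolvent_def)
qed

theorem theorem2p6:
  fixes M :: "'w measure" and T :: "'w \<Rightarrow> 'w"
    and a :: "'w \<Rightarrow> complex" and b :: "'w \<Rightarrow> real" and E :: real
  assumes "ergodic_jacobi M T a b"
    and "lyapunov_exponent M T a b (complex_of_real E) > 0"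
  shows "{\<omega> \<in> space M. E \<in> singular_energies (orbit_seq M T a \<omega>) (orbit_seq M T b \<omega>)}
           \<in> null_sets M"
proof -
  define b' where "b' \<omega> = b \<omega> - E" for \<omega>
  interpret jac: ergodic_jacobi M T a b by (rule assms(1))
  interpret shifted: ergodic_jacobi M T a b'
  proof
    show "b' \<in> borel_measurable M" unfolding b'_def using jac.random_variable_b by measurable
    show "bounded (b' ` space M)"
      using bounded_translation[OF jac.bounded_b, of "- E"] by (simp add: b'_def image_image)
  qed (fact jac.random_variable_a jac.bounded_a jac.a_nonzero jac.integrable_ln_a)+
  have orbit: "orbit_seq M T b' \<omega> = (\<lambda>n. orbit_seq M T b \<omega> n - E)" for \<omega>
    by (simp add: orbit_seq_def b'_def fun_eq_iff)
  have step: "transfer_step \<alpha> \<beta> (of_real E) n = transfer_step \<alpha> (\<lambda>n. \<beta> n - E) 0 n" for \<alpha> \<beta> n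
    by (simp add: transfer_step_def)
  have "transfer_prod \<alpha> \<beta> (of_real E) n = transfer_prod \<alpha> (\<lambda>n. \<beta> n - E) 0 n" for \<alpha> \<beta> n
    by (induction n) (simp_all add: step)
  then have "lyapunov_exponent M T a b' 0 = lyapunov_exponent M T a b (of_real E)"
    by (simp add: lyapunov_exponent_def orbit)
  moreover have "E \<in> singular_energies \<alpha> \<beta> \<longleftrightarrow> 0 \<in> singular_energies \<alpha> (\<lambda>n. \<beta> n - E)" for \<alpha> \<beta>
    by (simp add: singular_energies_def green_shift_energy[of \<alpha> \<beta> _ _ E])
  ultimately show ?thesis using shifted.null_singular_energy_0 assms(2) by (simp add: orbit)
qed

end
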